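(* Let $0<p\le 2$, let $\mathcal H$ be a complex Hilbert space, let $A,B\in\mathcal S_p(\mathcal H)$ with $B\ne 0$, and let $t>0$. Then $$\frac{1}{2\pi}\int_0^{2\pi}\|A+te^{i\theta}B\|_p^p\,d\theta-\|A\|_p^p\;\ge\;\frac{p^2}{4}\,\frac{t^2\|B\|_2^2}{(\|A\|_{\mathrm{op}}+t\|B\|_{\mathrm{op}})^{2-p}}.$$ Moreover, the constant $p^2/4$ cannot be increased: if $C\in\mathbb R$ is such that the inequality with $C$ in place of $p^2/4$ holds for all complex Hilbert spaces $\mathcal H$, all $A,B\in\mathcal S_p(\mathcal H)$ with $B\neq 0$ and all $t>0$, then $C\le p^2/4$.
   Context: For a complex Hilbert space $\mathcal H$ and $0<p<\infty$, $\mathcal S_p(\mathcal H)$ is the space of compact operators $A$ on $\mathcal H$ with $\sum_j s_j(A)^p<\infty$, where $s_j(A)$ are the singular values of $A$ counted with multiplicity, and $\|A\|_p^p=\sum_j s_j(A)^p=\operatorname{Tr}|A|^p$. $\|\cdot\|_2$ is the Hilbert–Schmidt norm and $\|\cdot\|_{\mathrm{op}}$ the operator norm. *)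

theory Defs
  imports "HOL-Analysis.Analysis"
begin

text \<open>The inner product is linear in the first argument. The norm, the metric and completeness come
  from \<^class>\<open>real_inner\<close> and \<^class>\<open>banach\<close>; the last axiom makes the norm the one induced
  by the complex inner product.\<close>

class chilbert_space = real_inner + banach +
  fixes scaleC :: "complex \<Rightarrow> 'a \<Rightarrow> 'a" (infixr "*\<^sub>C" 75)
    and cinner :: "'a \<Rightarrow> 'a \<Rightarrow> complex"
  assumes scaleC_add_right: "c *\<^sub>C (x + y) = c *\<^sub>C x + c *\<^sub>C y"
    and scaleC_add_left: "(c + d) *\<^sub>C x = c *\<^sub>C x + d *\<^sub>C x"
    and scaleC_scaleC: "c *\<^sub>C (d *\<^sub>C x) = (c * d) *\<^sub>C x"
    and scaleC_of_real: "complex_of_real r *\<^sub>C x = r *\<^sub>R x"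
    and cinner_commute: "cinner x y = cnj (cinner y x)"
    and cinner_add_left: "cinner (x + y) z = cinner x z + cinner y z"
    and cinner_scaleC_left: "cinner (c *\<^sub>C x) y = c * cinner x y"
    and inner_eq_Re_cinner: "inner x y = Re (cinner x y)"

instantiation complex :: chilbert_space
begin

definition scaleC_complex :: "complex \<Rightarrow> complex \<Rightarrow> complex" where
  "scaleC_complex c x = c * x"

definition cinner_complex :: "complex \<Rightarrow> complex \<Rightarrow> complex" where
  "cinner_complex x y = x * cnj y"

instance
  by standard
    (auto simp: scaleC_complex_def cinner_complex_def inner_complex_def algebra_simps scaleR_conv_of_real)

end

interpretation complex_vector:
  vector_space "scaleC :: complex \<Rightarrow> 'a \<Rightarrow> 'a::chilbert_space"
proof
  fix x :: 'a
  show "1 *\<^sub>C x = x"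
    using scaleC_of_real[of 1 x] by simp
qed (simp_all add: scaleC_add_right scaleC_add_left scaleC_scaleC)

definition compact_operator :: "('a::chilbert_space \<Rightarrow> 'a) \<Rightarrow> bool" where
  "compact_operator A \<longleftrightarrow>
     Vector_Spaces.linear (*\<^sub>C) (*\<^sub>C) A \<and> compact (closure (A ` cball 0 1))"

definition cadjoint :: "('a::chilbert_space \<Rightarrow> 'a) \<Rightarrow> 'a \<Rightarrow> 'a" where
  "cadjoint A = (SOME G. \<forall>x y. cinner (A x) y = cinner x (G y))"

text \<open>The singular values are the square roots of the eigenvalues of \<open>A\<^sup>*A\<close>, and the multiplicity of
  one is the complex dimension of the eigenspace. The eigenspaces for nonzero singular values of a
  compact operator are finite-dimensional, so \<open>complex_vector.dim\<close> (which is 0 on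
  infinite-dimensional spaces) is the true dimension there.\<close>

definition singular_eigenspace :: "('a::chilbert_space \<Rightarrow> 'a) \<Rightarrow> real \<Rightarrow> 'a set" where
  "singular_eigenspace A \<sigma> = {x. cadjoint A (A x) = complex_of_real (\<sigma>\<^sup>2) *\<^sub>C x}"

text \<open>One index \<open>(\<sigma>, k)\<close> for each occurrence of the singular value \<open>\<sigma>\<close>. Vanishing
  singular values are left out, as they contribute nothing to the sums below.\<close>

definition singular_indices :: "('a::chilbert_space \<Rightarrow> 'a) \<Rightarrow> (real \<times> nat) set" where
  "singular_indices A =
     (SIGMA \<sigma>:{0<..}. {..<complex_vector.dim (singular_eigenspace A \<sigma>)})"

definition schatten_class :: "real \<Rightarrow> ('a::chilbert_space \<Rightarrow> 'a) set" where
  "schatten_class p =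
     {A. compact_operator A \<and> (\<lambda>(\<sigma>, k). \<sigma> powr p) summable_on singular_indices A}"

definition schatten_norm :: "real \<Rightarrow> ('a::chilbert_space \<Rightarrow> 'a) \<Rightarrow> real" where
  "schatten_norm p A = (\<Sum>\<^sub>\<infinity>(\<sigma>, k)\<in>singular_indices A. \<sigma> powr p) powr (1 / p)"

end

theory Submission
  imports
    Defs
    "HOL-Complex_Analysis.Complex_Analysis"
    "HOL-Real_Asymp.Real_Asymp"
    "Jordan_Normal_Form.Determinant"
begin

text \<open>Write \<open>T(z) = A + z B\<close>. For \<open>0 < p < 2\<close> the power \<open>s\<^bsup>p\<^esup>\<close> is a constant multiple of
  \<open>\<integral>\<^sub>0\<^sup>\<infinity> ln (1 + s\<^sup>2 / l) l\<^bsup>p/2 - 1\<^esup> dl\<close>, so it suffices to bound circular means of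
  \<open>F(z) = ln det (l + T(z)\<^sup>* T(z))\<close> from below for each \<open>l > 0\<close>. Near \<open>z\<^sub>0\<close>, in bases of singular vectors
  of \<open>T(z\<^sub>0)\<close> and with \<open>w = z - z\<^sub>0\<close>, the operator \<open>l + T\<^sup>* T\<close> is congruent to
  \<open>(1 + w L)\<^sup>* (1 + w L) + |w|\<^sup>2 Y\<^sup>* Y\<close>. Here \<open>ln |det (1 + w L)|\<close> is harmonic in \<open>w\<close>, and \<open>Y\<close> contributes
  at least \<open>c |w|\<^sup>2\<close> to first order, where \<open>c = l \<parallel>B\<parallel>\<^sub>2\<^sup>2 / (l + M\<^sup>2)\<^sup>2\<close> and \<open>M = \<parallel>A\<parallel> + t \<parallel>B\<parallel>\<close>. Hence
  \<open>F - c |z|\<^sup>2\<close> is subharmonic, and integrating \<open>c\<close> over \<open>l\<close> produces exactly \<open>p\<^sup>2/4 \<cdot> M\<^bsup>p - 2\<^esup>\<close>; for \<open>p = 2\<close>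
  the parallelogram law suffices. In infinite dimensions one compresses to a subspace containing
  finitely many singular vectors of \<open>A\<close> and \<open>B\<close> with their images: this does not increase the
  singular values of \<open>T(z)\<close>, and it retains the chosen ones of \<open>A\<close> and \<open>B\<close>. Equality to second order
  as \<open>t \<rightarrow> 0\<close>, for \<open>A = B\<close> a projection of rank one, shows that the constant is sharp.\<close>

subsection \<open>Complex inner product spaces\<close>

text \<open>Why p^2/4: put q = p/2 and let m be the integral of u^q / (1 + u)^2 over the half-line.
  Two integrations by parts (\<open>integral_log_weight\<close>) turn the integral of ln (1 + s^2 /
  l) l^(q-1) into s^(2q) m / q^2, while the gain l / (l + M^2)^2 integrates against the same weight
  to M^(2q-2) m. The quotient of the constants is q^2, and m cancels without being evaluated. At q =
  1 the integral m diverges, which separates p = 2.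

  Why logarithms of determinants: T(z) is affine in z, so the first-order effect of a perturbation,
  which has no definite sign, is exactly ln |det (1 + w L)| and has mean ln |det 1| = 0 on small
  circles. Only the nonnegative contribution of Y remains.

  No Laplacian is computed. The inequality for small circles holds with one radius for all centres
  of the disc, because L and Y are estimated by l, M and the Hilbert-Schmidt norm of B alone; a
  maximum argument for rotational means then reaches the circle of radius t.\<close>

lemma cinner_add_right: "cinner x (y + z) = cinner x y + cinner (x::'a::chilbert_space) z"
  by (metis cinner_add_left cinner_commute complex_cnj_add)

lemma cinner_scaleC_right: "cinner x (c *\<^sub>C y) = cnj c * cinner (x::'a::chilbert_space) y"
  by (metis cinner_commute cinner_scaleC_left complex_cnj_mult)

lemma cinner_zero_left [simp]: "cinner 0 (x::'a::chilbert_space) = 0"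
  by (metis add_cancel_right_right cinner_add_left add_0)

lemma cinner_zero_right [simp]: "cinner (x::'a::chilbert_space) 0 = 0"
  by (metis cinner_commute cinner_zero_left complex_cnj_zero)

lemma cinner_diff_left: "cinner (x - y) (z::'a::chilbert_space) = cinner x z - cinner y z"
  by (metis add_diff_cancel cinner_add_left diff_add_cancel)

lemma cinner_diff_right: "cinner z (x - y) = cinner z x - cinner (z::'a::chilbert_space) y"
  by (metis add_diff_cancel cinner_add_right diff_add_cancel)

lemma cinner_sum_left: "cinner (\<Sum>i\<in>I. f i) (z::'a::chilbert_space) = (\<Sum>i\<in>I. cinner (f i) z)"
  by (induction I rule: infinite_finite_induct) (auto simp: cinner_add_left)

lemma cinner_sum_right: "cinner (z::'a::chilbert_space) (\<Sum>i\<in>I. f i) = (\<Sum>i\<in>I. cinner z (f i))"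
  by (induction I rule: infinite_finite_induct) (auto simp: cinner_add_right)

lemma cinner_self: "cinner x x = complex_of_real ((norm (x::'a::chilbert_space))\<^sup>2)"
proof (rule complex_eqI)
  show "Re (cinner x x) = Re (complex_of_real ((norm x)\<^sup>2))"
    by (simp add: inner_eq_Re_cinner[symmetric] power2_norm_eq_inner)
  have "Im (cinner x x) = - Im (cinner x x)"
    by (rule arg_cong[OF cinner_commute[of x x], of Im, unfolded cnj.sel])
  then have "Im (cinner x x) = 0" by linarith
  then show "Im (cinner x x) = Im (complex_of_real ((norm x)\<^sup>2))" by simp
qed

lemma norm_scaleC [simp]: "norm (c *\<^sub>C x) = cmod c * norm (x::'a::chilbert_space)"
proof -
  have "complex_of_real ((norm (c *\<^sub>C x))\<^sup>2) = (c * cnj c) * cinner x x"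
    by (simp only: cinner_self[of "c *\<^sub>C x", symmetric] cinner_scaleC_left cinner_scaleC_right mult_ac)
  also have "\<dots> = complex_of_real ((cmod c * norm x)\<^sup>2)"
    by (simp only: complex_norm_square[symmetric] cinner_self power_mult_distrib of_real_mult)
  finally have "(norm (c *\<^sub>C x))\<^sup>2 = (cmod c * norm x)\<^sup>2"
    using of_real_eq_iff by blast
  then show ?thesis by (simp add: power2_eq_iff_nonneg)
qed

lemma norm_cinner_le: "cmod (cinner x y) \<le> norm x * norm (y::'a::chilbert_space)"
proof (cases "cinner x y = 0")
  case False
  \<comment> \<open>A phase that makes the inner product real and nonnegative, so that the real
    Cauchy-Schwarz inequality applies.\<close>
  define c where "c = cnj (cinner x y) / cmod (cinner x y)"
  have c: "cmod c = 1" using False by (simp add: c_def norm_divide)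
  have "cinner (c *\<^sub>C x) y = cnj (cinner x y) * cinner x y / cmod (cinner x y)"
    by (simp add: cinner_scaleC_left c_def)
  also have "\<dots> = complex_of_real (cmod (cinner x y))"
    using False complex_norm_square[of "cinner x y"]
    by (simp add: field_simps power2_eq_square)
  finally have "cmod (cinner x y) = inner (c *\<^sub>C x) y"
    by (simp add: inner_eq_Re_cinner)
  also have "\<dots> \<le> norm (c *\<^sub>C x) * norm y" by (rule norm_cauchy_schwarz)
  finally show ?thesis using c by simp
qed simp

lemma cinner_right_eqI:
  assumes "\<And>z. cinner z x = cinner z (y::'a::chilbert_space)"
  shows "x = y"
proof -
  have "cinner (x - y) (x - y) = 0"
    using assms[of "x - y"] by (simp add: cinner_diff_right)
  then show ?thesis by (simp add: cinner_self)
qed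

lemma bounded_bilinear_cinner: "bounded_bilinear (cinner :: 'a::chilbert_space \<Rightarrow> _)"
proof (rule bounded_bilinear.intro)
  fix r :: real and a b :: 'a
  show "cinner (r *\<^sub>R a) b = r *\<^sub>R cinner a b"
    by (simp add: scaleC_of_real[of r a, symmetric] cinner_scaleC_left scaleR_conv_of_real)
  show "cinner a (r *\<^sub>R b) = r *\<^sub>R cinner a b"
    by (simp add: scaleC_of_real[of r b, symmetric] cinner_scaleC_right scaleR_conv_of_real)
  show "\<exists>K. \<forall>a b::'a. norm (cinner a b) \<le> norm a * norm b * K"
    using norm_cinner_le by (intro exI[of _ 1]) auto
qed (auto simp: cinner_add_left cinner_add_right)

section \<open>Bounded complex-linear maps and compact operators\<close>

definition bounded_clinear :: "('a::chilbert_space \<Rightarrow> 'b::chilbert_space) \<Rightarrow> bool" where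
  "bounded_clinear T \<longleftrightarrow> bounded_linear T \<and> (\<forall>c x. T (c *\<^sub>C x) = c *\<^sub>C T x)"

lemma bounded_clinear_bounded_linear: "bounded_clinear T \<Longrightarrow> bounded_linear T"
  by (simp add: bounded_clinear_def)

lemma bounded_clinear_scaleC: "bounded_clinear T \<Longrightarrow> T (c *\<^sub>C x) = c *\<^sub>C T x"
  by (simp add: bounded_clinear_def)

lemma bounded_clinear_add: "bounded_clinear T \<Longrightarrow> T (x + y) = T x + T y"
  by (simp add: bounded_clinear_def linear_simps)

lemma bounded_clinear_zero: "bounded_clinear T \<Longrightarrow> T 0 = 0"
  by (simp add: bounded_clinear_def linear_simps)

lemma bounded_clinear_sum: "bounded_clinear T \<Longrightarrow> T (\<Sum>i\<in>I. f i) = (\<Sum>i\<in>I. T (f i))"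
  by (induction I rule: infinite_finite_induct) (auto simp: bounded_clinear_zero bounded_clinear_add)

lemma bounded_clinear_linear: "bounded_clinear T \<Longrightarrow> Vector_Spaces.linear (*\<^sub>C) (*\<^sub>C) T"
  by unfold_locales (auto simp: bounded_clinear_add bounded_clinear_scaleC)

lemma bounded_clinear_plus:
  "bounded_clinear S \<Longrightarrow> bounded_clinear T \<Longrightarrow> bounded_clinear (\<lambda>x. S x + T x)"
  by (auto simp: bounded_clinear_def bounded_linear_add scaleC_add_right)

lemma bounded_linear_scaleC: "bounded_linear (\<lambda>x::'a::chilbert_space. c *\<^sub>C x)"
proof (rule bounded_linear_intro)
  fix r :: real and x :: 'a
  show "c *\<^sub>C (r *\<^sub>R x) = r *\<^sub>R (c *\<^sub>C x)"
    by (simp add: scaleC_of_real[symmetric] scaleC_scaleC mult.commute)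
  show "norm (c *\<^sub>C x) \<le> norm x * cmod c" by simp
qed (rule scaleC_add_right)

lemma bounded_clinear_scaled: "bounded_clinear T \<Longrightarrow> bounded_clinear (\<lambda>x. c *\<^sub>C T x)"
  unfolding bounded_clinear_def
  using bounded_linear_compose[OF bounded_linear_scaleC, of T c]
  by (simp add: scaleC_scaleC mult.commute)

text \<open>The image of the unit ball lies in a compact, hence bounded, set; homogeneity does the
  rest.\<close>

lemma compact_operator_bounded_clinear:
  assumes "compact_operator T"
  shows "bounded_clinear T"
proof -
  interpret T: Vector_Spaces.linear "(*\<^sub>C)" "(*\<^sub>C)" T
    using assms by (simp add: compact_operator_def)
  have "bounded (T ` cball 0 1)"
    using assms bounded_subset[OF compact_imp_bounded closure_subset]
    by (auto simp: compact_operator_def)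
  then obtain K where "\<forall>x\<in>cball 0 1. norm (T x) \<le> K"
    by (auto simp: bounded_iff)
  then have K: "\<And>x. norm x \<le> 1 \<Longrightarrow> norm (T x) \<le> K" by simp
  have R: "T (r *\<^sub>R x) = r *\<^sub>R T x" for r x
    by (simp add: scaleC_of_real[symmetric] T.scale)
  have "norm (T x) \<le> norm x * K" for x
  proof (cases "x = 0")
    case True
    then show ?thesis using T.zero by simp
  next
    case False
    have "norm (T (inverse (norm x) *\<^sub>R x)) \<le> K"
      using False by (intro K) simp
    then show ?thesis using False by (simp add: R field_simps)
  qed
  then have "bounded_linear T"
    by (intro bounded_linear_intro T.add R)
  then show ?thesis by (simp add: bounded_clinear_def T.scale)
qed

text \<open>Lets compactness of an operator be shown by exhibiting any compact superset of the image
  of the ball, without identifying the closure.\<close>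

lemma compact_closure_subset:
  fixes C :: "'a::t2_space set"
  assumes "compact C" "S \<subseteq> C"
  shows "compact (closure S)"
proof -
  have "closure S \<subseteq> C" using assms by (intro closure_minimal compact_imp_closed)
  then show ?thesis using compact_Int_closed[OF assms(1) closed_closure, of S] by (simp add: inf.absorb2)
qed

lemma compact_operator_plus:
  fixes S T :: "'a::chilbert_space \<Rightarrow> 'a"
  assumes "compact_operator S" "compact_operator T"
  shows "compact_operator (\<lambda>x. S x + T x)"
proof -
  let ?C = "{x + y | x y. x \<in> closure (S ` cball 0 1) \<and> y \<in> closure (T ` cball 0 1)}"
  have "compact ?C"
    using assms by (intro compact_sums) (auto simp: compact_operator_def)
  moreover have "(\<lambda>x. S x + T x) ` cball 0 1 \<subseteq> ?C"
  proof (rule image_subsetI)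
    fix x :: 'a assume "x \<in> cball 0 1"
    then have "S x \<in> closure (S ` cball 0 1)" "T x \<in> closure (T ` cball 0 1)"
      by (auto intro: subsetD[OF closure_subset])
    then show "S x + T x \<in> ?C" by blast
  qed
  ultimately have "compact (closure ((\<lambda>x. S x + T x) ` cball 0 1))"
    by (rule compact_closure_subset)
  then show ?thesis
    unfolding compact_operator_def
    using bounded_clinear_linear[OF bounded_clinear_plus[OF assms[THEN compact_operator_bounded_clinear]]]
    by simp
qed

lemma compact_operator_scaled:
  fixes T :: "'a::chilbert_space \<Rightarrow> 'a"
  assumes "compact_operator T"
  shows "compact_operator (\<lambda>x. c *\<^sub>C T x)"
proof -
  let ?C = "(\<lambda>x. c *\<^sub>C x) ` closure (T ` cball 0 1)"
  have "compact ?C"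
    using assms linear_continuous_on[OF bounded_linear_scaleC]
    by (intro compact_continuous_image) (auto simp: compact_operator_def)
  moreover have "(\<lambda>x. c *\<^sub>C T x) ` cball 0 1 \<subseteq> ?C"
    using image_mono[OF closure_subset[of "T ` cball 0 1"], of "\<lambda>x. c *\<^sub>C x"] by (simp add: image_image)
  ultimately have "compact (closure ((\<lambda>x. c *\<^sub>C T x) ` cball 0 1))"
    by (rule compact_closure_subset)
  then show ?thesis
    unfolding compact_operator_def
    using bounded_clinear_linear[OF bounded_clinear_scaled[OF assms[THEN compact_operator_bounded_clinear]]]
    by simp
qed

lemma compact_operator_rank_one:
  fixes a b :: "'a::chilbert_space"
  shows "compact_operator (\<lambda>x. cinner x a *\<^sub>C b)"
proof -
  have cont: "continuous_on S (\<lambda>c. c *\<^sub>C b)" for S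
  proof (rule linear_continuous_on, rule bounded_linear_intro)
    show "norm (c *\<^sub>C b) \<le> norm c * norm b" for c by simp
    show "(r *\<^sub>R c) *\<^sub>C b = r *\<^sub>R (c *\<^sub>C b)" for r c
      by (simp add: scaleC_of_real[of r "c *\<^sub>C b", symmetric] scaleC_scaleC scaleR_conv_of_real)
  qed (rule scaleC_add_left)
  let ?C = "(\<lambda>c. c *\<^sub>C b) ` cball 0 (norm a)"
  have "compact ?C" by (intro compact_continuous_image cont) auto
  moreover have "(\<lambda>x. cinner x a *\<^sub>C b) ` cball 0 1 \<subseteq> ?C"
  proof safe
    fix x :: 'a assume "x \<in> cball 0 1"
    then have "norm x * norm a \<le> norm a" by (simp add: mult_left_le_one_le)
    then have "cinner x a \<in> cball 0 (norm a)"
      using norm_cinner_le[of x a] by simp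
    then show "cinner x a *\<^sub>C b \<in> ?C" by blast
  qed
  ultimately have "compact (closure ((\<lambda>x. cinner x a *\<^sub>C b) ` cball 0 1))"
    by (rule compact_closure_subset)
  moreover have "Vector_Spaces.linear (*\<^sub>C) (*\<^sub>C) (\<lambda>x. cinner x a *\<^sub>C b)"
    by unfold_locales (auto simp: cinner_add_left scaleC_add_left cinner_scaleC_left scaleC_scaleC)
  ultimately show ?thesis by (simp add: compact_operator_def)
qed

lemma compact_operator_zero: "compact_operator (\<lambda>x::'a::chilbert_space. 0::'a)"
  using compact_operator_rank_one[of 0 0] by (simp add: complex_vector.scale_zero_right)

lemma compact_operator_sum:
  assumes "\<And>i. i \<in> I \<Longrightarrow> compact_operator (f i :: 'a::chilbert_space \<Rightarrow> 'a)"
  shows "compact_operator (\<lambda>x. \<Sum>i\<in>I. f i x)"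
  using assms
proof (induction I rule: infinite_finite_induct)
  case (insert i I)
  then show ?case using compact_operator_plus[of "f i" "\<lambda>x. \<Sum>i\<in>I. f i x"] by simp
qed (simp_all add: compact_operator_zero)

subsection \<open>Adjoints\<close>

text \<open>Direct method: a minimizing sequence of the functional \<open>J\<close> converges, and
  the vanishing first variation at the minimizer says that it represents f.\<close>

theorem riesz_representation_real:
  fixes f :: "'a::{real_inner,complete_space} \<Rightarrow> real"
  assumes "bounded_linear f"
  shows "\<exists>g. \<forall>x. f x = inner x g"
proof -
  interpret f: bounded_linear f by fact
  obtain K where K: "\<And>x. norm (f x) \<le> norm x * K" using f.bounded by blast
  \<comment> \<open>If g represents f, then J x = |x - g|^2 - |g|^2, so g must be the
    minimizer.\<close>
  define J where "J x = (norm x)\<^sup>2 - 2 * f x" for x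
  have J_lower: "J x \<ge> - K\<^sup>2" for x
  proof -
    have "f x \<le> norm x * K" using K[of x] by simp
    then have "J x \<ge> (norm x)\<^sup>2 - 2 * (norm x * K)" by (simp add: J_def)
    moreover have "(norm x)\<^sup>2 - 2 * (norm x * K) + K\<^sup>2 = (norm x - K)\<^sup>2"
      by (simp add: power2_eq_square algebra_simps)
    ultimately show ?thesis using zero_le_power2[of "norm x - K"] by linarith
  qed
  define m where "m = Inf (range J)"
  have bdd: "bdd_below (range J)" using J_lower by (auto intro!: bdd_belowI)
  have m_le: "m \<le> J x" for x unfolding m_def by (rule cInf_lower) (use bdd in auto)
  have "\<exists>x. J x < m + inverse (real (Suc n))" for n
    using cInf_lessD[of "range J" "m + inverse (real (Suc n))"] by (auto simp: m_def)
  then obtain X where X: "\<And>n. J (X n) < m + inverse (real (Suc n))" by metis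
  \<comment> \<open>By the parallelogram law two almost minimal points are close, since
    \<open>J\<close> at their midpoint cannot fall below m.\<close>
  have dist_bound: "(norm (X i - X k))\<^sup>2 \<le> 2 * inverse (real (Suc i)) + 2 * inverse (real (Suc k))" for i k
  proof -
    have par: "(norm (X i - X k))\<^sup>2 = 2 * J (X i) + 2 * J (X k) - 4 * J ((1/2) *\<^sub>R (X i + X k))"
    proof -
      have "(norm (X i - X k))\<^sup>2 + (norm (X i + X k))\<^sup>2 = 2 * (norm (X i))\<^sup>2 + 2 * (norm (X k))\<^sup>2"
        by (simp add: power2_norm_eq_inner inner_diff_left inner_diff_right inner_add_left inner_add_right)
      moreover have "(norm ((1/2) *\<^sub>R (X i + X k)))\<^sup>2 = (norm (X i + X k))\<^sup>2 / 4"
        by (simp add: power_divide)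
      moreover have "f ((1/2) *\<^sub>R (X i + X k)) = (f (X i) + f (X k)) / 2"
        by (simp only: f.scaleR f.add real_scaleR_def)
      ultimately show ?thesis unfolding J_def by simp
    qed
    show ?thesis using X[of i] X[of k] m_le[of "(1/2) *\<^sub>R (X i + X k)"] unfolding par by linarith
  qed
  have "Cauchy X"
  proof (rule metric_CauchyI)
    fix e :: real assume "e > 0"
    then obtain N where N: "inverse (real (Suc N)) < e\<^sup>2 / 4"
      using reals_Archimedean[of "e\<^sup>2/4"] by auto
    have "dist (X i) (X k) < e" if "i \<ge> N" "k \<ge> N" for i k
    proof -
      have "inverse (real (Suc i)) \<le> inverse (real (Suc N))" "inverse (real (Suc k)) \<le> inverse (real (Suc N))"
        using that by (auto intro!: le_imp_inverse_le)
      then have "(norm (X i - X k))\<^sup>2 < e\<^sup>2" using dist_bound[of i k] N by linarith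
      then show ?thesis using \<open>e > 0\<close> by (simp add: dist_norm power2_less_imp_less)
    qed
    then show "\<exists>M. \<forall>m\<ge>M. \<forall>n\<ge>M. dist (X m) (X n) < e" by blast
  qed
  then obtain g where g: "X \<longlonglongrightarrow> g" using Cauchy_convergent convergent_def by blast
  have "(\<lambda>n. J (X n)) \<longlonglongrightarrow> J g"
    unfolding J_def by (intro tendsto_intros g f.tendsto)
  moreover have "(\<lambda>n. m + inverse (real (Suc n))) \<longlonglongrightarrow> m + 0"
    by (intro tendsto_intros LIMSEQ_inverse_real_of_nat)
  ultimately have "J g \<le> m"
    using X by (intro LIMSEQ_le[of _ _ _ m]) (auto intro: less_imp_le)
  then have Jg: "J g \<le> J x" for x using m_le[of x] by linarith
  have "f h = inner h g" for h
  proof (rule ccontr)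
    assume ne: "f h \<noteq> inner h g"
    define d where "d = inner h g - f h"
    have q: "s\<^sup>2 * (norm h)\<^sup>2 + 2 * s * d \<ge> 0" for s
    proof -
      have "J (g + s *\<^sub>R h) = J g + s\<^sup>2 * (norm h)\<^sup>2 + 2 * s * d"
      proof -
        have "(norm (g + s *\<^sub>R h))\<^sup>2 = (norm g)\<^sup>2 + 2 * s * inner h g + s\<^sup>2 * (norm h)\<^sup>2"
          unfolding power2_norm_eq_inner inner_add_left inner_add_right
          by (simp add: inner_commute power2_eq_square)
        then show ?thesis
          by (simp add: J_def d_def f.scaleR f.add algebra_simps)
      qed
      then show ?thesis using Jg[of "g + s *\<^sub>R h"] by linarith
    qed
    have h: "h \<noteq> 0" using ne by (auto simp: f.zero)
    then have h2: "(norm h)\<^sup>2 > 0" by simp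
    \<comment> \<open>The value of s at which the quadratic in \<open>q\<close> is smallest; there
      it is negative unless d = 0.\<close>
    have "(- d / (norm h)\<^sup>2)\<^sup>2 * (norm h)\<^sup>2 + 2 * (- d / (norm h)\<^sup>2) * d = - d\<^sup>2 / (norm h)\<^sup>2"
      using h2 by (simp add: field_simps power2_eq_square)
    moreover have "d \<noteq> 0" using ne by (simp add: d_def)
    then have "- d\<^sup>2 / (norm h)\<^sup>2 < 0" using h2 by (simp add: divide_neg_pos)
    ultimately show False using q[of "- d / (norm h)\<^sup>2"] by linarith
  qed
  then show ?thesis by blast
qed

text \<open>Riesz represents the real part. The imaginary part follows from Im <u, v> = - Re <i u,
  v> and complex homogeneity of T.\<close>

lemma cadjoint_exists:
  assumes "bounded_clinear (T :: 'a::chilbert_space \<Rightarrow> 'a)"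
  shows "\<exists>G. \<forall>x y. cinner (T x) y = cinner x (G y)"
proof -
  interpret T: bounded_linear T using assms by (rule bounded_clinear_bounded_linear)
  have "\<exists>g. \<forall>x. cinner (T x) y = cinner x g" for y
  proof -
    have "bounded_linear (\<lambda>x. inner (T x) y)"
      by (intro bounded_linear_compose[OF bounded_linear_inner_left T.bounded_linear_axioms])
    then obtain g where g: "\<And>x. inner (T x) y = inner x g"
      using riesz_representation_real by blast
    have im: "Im (cinner u v) = - Re (cinner (\<i> *\<^sub>C u) v)" for u v :: 'a
      by (simp add: cinner_scaleC_left)
    have "cinner (T x) y = cinner x g" for x
      using g[of x] g[of "\<i> *\<^sub>C x"]
      by (intro complex_eqI)
        (simp_all add: inner_eq_Re_cinner im bounded_clinear_scaleC[OF assms])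
    then show ?thesis by blast
  qed
  then show ?thesis by metis
qed

lemma cadjoint: "bounded_clinear (T :: 'a::chilbert_space \<Rightarrow> 'a) \<Longrightarrow> cinner (T x) y = cinner x (cadjoint T y)"
  using someI_ex[OF cadjoint_exists, of T] unfolding cadjoint_def by blast

lemma cadjoint': "bounded_clinear (T :: 'a::chilbert_space \<Rightarrow> 'a) \<Longrightarrow> cinner (cadjoint T x) y = cinner x (T y)"
  by (metis cadjoint cinner_commute)

text \<open>\<open>cadjoint\<close> is a choice among maps with the adjoint identity; nondegeneracy
  of the inner product leaves only one.\<close>

lemma cadjoint_eqI:
  assumes "\<And>x y. cinner (T x) y = cinner (x::'a::chilbert_space) (G y)"
  shows "cadjoint T = G"
proof
  fix y
  have *: "\<forall>x y. cinner (T x) y = cinner x (cadjoint T y)"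
    unfolding cadjoint_def
    by (rule someI[of "\<lambda>G. \<forall>x y. cinner (T x) y = cinner x (G y)" G], intro allI, rule assms)
  show "cadjoint T y = G y"
  proof (rule cinner_right_eqI)
    fix z
    show "cinner z (cadjoint T y) = cinner z (G y)"
      using *[rule_format, of z y] assms[of z y] by (rule trans[OF sym])
  qed
qed

text \<open>Write T' for the adjoint. The bound comes from |T' y|^2 = <T T' y, y> \<le> K |T' y| |y|
  after cancelling |T' y|.\<close>

lemma bounded_clinear_cadjoint:
  fixes T :: "'a::chilbert_space \<Rightarrow> 'a"
  assumes T: "bounded_clinear T"
  shows "bounded_clinear (cadjoint T)"
proof -
  obtain K where K: "\<And>x. norm (T x) \<le> norm x * K" "K > 0"
    using bounded_linear.pos_bounded[OF bounded_clinear_bounded_linear[OF T]] by blast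
  have add: "cadjoint T (x + y) = cadjoint T x + cadjoint T y" for x y
    by (rule cinner_right_eqI) (simp add: cadjoint[OF T, symmetric] cinner_add_right)
  have sc: "cadjoint T (c *\<^sub>C x) = c *\<^sub>C cadjoint T x" for c x
    by (rule cinner_right_eqI) (simp add: cadjoint[OF T, symmetric] cinner_scaleC_right)
  have "norm (cadjoint T y) \<le> norm y * K" for y
  proof (cases "cadjoint T y = 0")
    case False
    have "(norm (cadjoint T y))\<^sup>2 = cmod (cinner (T (cadjoint T y)) y)"
      by (simp add: cadjoint[OF T] cinner_self norm_power)
    also have "\<dots> \<le> norm (T (cadjoint T y)) * norm y" by (rule norm_cinner_le)
    also have "\<dots> \<le> (norm (cadjoint T y) * K) * norm y" by (intro mult_right_mono K) auto
    finally have "norm (cadjoint T y) * norm (cadjoint T y) \<le> norm (cadjoint T y) * (norm y * K)"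
      by (simp add: power2_eq_square mult_ac)
    then show ?thesis using False by simp
  qed (use K in simp)
  then have "bounded_linear (cadjoint T)"
    using sc[of "complex_of_real r" for r] by (intro bounded_linear_intro add) (auto simp: scaleC_of_real)
  then show ?thesis by (simp add: bounded_clinear_def sc)
qed

subsection \<open>Orthonormal sets\<close>

definition orthonormal :: "'a::chilbert_space set \<Rightarrow> bool" where
  "orthonormal S \<longleftrightarrow> (\<forall>x\<in>S. norm x = 1) \<and> (\<forall>x\<in>S. \<forall>y\<in>S. x \<noteq> y \<longrightarrow> cinner x y = 0)"

text \<open>The ambient S is an arbitrary set, because it will be either a finite-dimensional span
  or the union of all eigenspaces for positive singular values, which is no subspace. Maximality is
  recorded as the absence of a further unit vector of S orthogonal to B.\<close>

lemma maximal_orthonormal_extension: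
  fixes S :: "'a::chilbert_space set"
  assumes "orthonormal O0" "O0 \<subseteq> S"
  shows "\<exists>B. O0 \<subseteq> B \<and> B \<subseteq> S \<and> orthonormal B \<and> (\<forall>x\<in>S. (\<forall>v\<in>B. cinner x v = 0) \<longrightarrow> norm x \<noteq> 1)"
proof -
  define \<A> where "\<A> = {B. O0 \<subseteq> B \<and> B \<subseteq> S \<and> orthonormal B}"
  have "\<exists>M\<in>\<A>. \<forall>X\<in>\<A>. M \<subseteq> X \<longrightarrow> X = M"
  proof (rule subset_Zorn_nonempty)
    show "\<A> \<noteq> {}" using assms by (auto simp: \<A>_def)
    fix C assume C: "C \<noteq> {}" "subset.chain \<A> C"
    note C' = C(2)[unfolded subset_chain_def]
    have CA: "B \<in> C \<Longrightarrow> B \<in> \<A>" for B using C' by (elim conjE) (erule subsetD)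
    have "cinner x y = 0" if xy: "x \<in> \<Union>C" "y \<in> \<Union>C" "x \<noteq> y" for x y
    proof -
      obtain X where X: "x \<in> X" "X \<in> C" using xy(1) by blast
      obtain Y where Y: "y \<in> Y" "Y \<in> C" using xy(2) by blast
      have orth: "\<And>Z u w. Z \<in> C \<Longrightarrow> u \<in> Z \<Longrightarrow> w \<in> Z \<Longrightarrow> u \<noteq> w \<Longrightarrow> cinner u w = 0"
        using CA by (simp add: \<A>_def orthonormal_def)
      have "X \<subseteq> Y \<or> Y \<subseteq> X" using conjunct2[OF C'] X(2) Y(2) by (elim ballE) auto
      then show ?thesis
      proof
        assume "X \<subseteq> Y"
        then show ?thesis using X Y xy orth[of Y x y] by (simp add: subset_iff)
      next
        assume "Y \<subseteq> X"
        then show ?thesis using X Y xy orth[of X x y] by (simp add: subset_iff)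
      qed
    qed
    moreover have "\<forall>x\<in>\<Union>C. norm x = 1"
      using CA by (force simp: \<A>_def orthonormal_def)
    ultimately have "orthonormal (\<Union>C)" unfolding orthonormal_def by (intro conjI ballI impI) auto
    moreover have "O0 \<subseteq> \<Union>C" using C(1) CA by (force simp: \<A>_def)
    moreover have "\<Union>C \<subseteq> S" using CA by (force simp: \<A>_def)
    ultimately show "\<Union>C \<in> \<A>" by (simp add: \<A>_def)
  qed
  then obtain M where M: "M \<in> \<A>" and max: "\<And>X. X \<in> \<A> \<Longrightarrow> M \<subseteq> X \<Longrightarrow> X = M" by blast
  have "norm x \<noteq> 1" if x: "x \<in> S" "\<forall>v\<in>M. cinner x v = 0" for x
  proof
    assume n: "norm x = 1"
    have "x \<notin> M"
    proof
      assume "x \<in> M"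
      then have "cinner x x = 0" using x by blast
      then show False using n by (simp add: cinner_self)
    qed
    moreover have "cinner v x = 0" if "v \<in> M" for v
      using x(2) that cinner_commute[of v x] by simp
    then have "orthonormal (insert x M)"
      using M x n by (auto simp: \<A>_def orthonormal_def)
    then have "insert x M \<in> \<A>" using M x by (auto simp: \<A>_def)
    then have "insert x M = M" using max[of "insert x M"] by blast
    ultimately show False by blast
  qed
  then show ?thesis using M by (auto simp: \<A>_def)
qed

lemma norm_sum_orthogonal:
  fixes v :: "'i \<Rightarrow> 'a::chilbert_space"
  assumes "finite J" "\<And>i j. i \<in> J \<Longrightarrow> j \<in> J \<Longrightarrow> i \<noteq> j \<Longrightarrow> cinner (v i) (v j) = 0"
  shows "(norm (\<Sum>j\<in>J. c j *\<^sub>C v j))\<^sup>2 = (\<Sum>j\<in>J. (cmod (c j))\<^sup>2 * (norm (v j))\<^sup>2)"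
proof -
  let ?x = "\<Sum>j\<in>J. c j *\<^sub>C v j"
  have "complex_of_real ((norm ?x)\<^sup>2) = (\<Sum>i\<in>J. \<Sum>j\<in>J. c i * cnj (c j) * cinner (v i) (v j))"
    unfolding cinner_self[symmetric]
    by (simp add: cinner_sum_left cinner_sum_right cinner_scaleC_left cinner_scaleC_right
        sum_distrib_left mult.assoc)
      (subst sum.swap, simp add: mult_ac)
  also have "\<dots> = (\<Sum>i\<in>J. \<Sum>j\<in>J. if j = i then c i * cnj (c i) * cinner (v i) (v i) else 0)"
    by (intro sum.cong refl) (use assms in auto)
  also have "\<dots> = (\<Sum>i\<in>J. complex_of_real ((cmod (c i))\<^sup>2 * (norm (v i))\<^sup>2))"
    using assms(1) by (simp add: complex_norm_square[symmetric] cinner_self)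
  finally have "complex_of_real ((norm ?x)\<^sup>2)
      = complex_of_real (\<Sum>i\<in>J. (cmod (c i))\<^sup>2 * (norm (v i))\<^sup>2)" by (simp only: of_real_sum)
  then show ?thesis using of_real_eq_iff by blast
qed

lemma cinner_sum_orthonormal:
  fixes v :: "'i \<Rightarrow> 'a::chilbert_space"
  assumes "finite J" "\<And>i j. i \<in> J \<Longrightarrow> j \<in> J \<Longrightarrow> i \<noteq> j \<Longrightarrow> cinner (v i) (v j) = 0"
    and "k \<in> J" "norm (v k) = 1"
  shows "cinner (\<Sum>j\<in>J. c j *\<^sub>C v j) (v k) = c k"
proof -
  have "cinner (\<Sum>j\<in>J. c j *\<^sub>C v j) (v k) = (\<Sum>j\<in>J. if j = k then c k else 0)"
    unfolding cinner_sum_left cinner_scaleC_left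
    by (intro sum.cong refl) (use assms in \<open>auto simp: cinner_self\<close>)
  then show ?thesis using assms by simp
qed

lemma orthonormal_expansion:
  assumes "finite B" "orthonormal B" "x \<in> complex_vector.span B"
  shows "x = (\<Sum>v\<in>B. cinner x v *\<^sub>C v)"
proof -
  obtain u where u: "x = (\<Sum>v\<in>B. u v *\<^sub>C v)"
    using assms(3) unfolding complex_vector.span_finite[OF assms(1)] by blast
  have "cinner x v = u v" if "v \<in> B" for v
    unfolding u using assms that cinner_sum_orthonormal[of B "\<lambda>v. v" v u]
    by (auto simp: orthonormal_def)
  then show ?thesis by (subst u) (auto intro!: sum.cong)
qed

lemma orthonormal_independent:
  assumes "finite B" "orthonormal B"
  shows "complex_vector.independent B"
proof (rule complex_vector.independent_if_scalars_zero[OF assms(1)])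
  fix f x assume "(\<Sum>x\<in>B. f x *\<^sub>C x) = 0" "x \<in> B"
  then show "f x = 0"
    using cinner_sum_orthonormal[of B "\<lambda>v. v" x f] assms by (auto simp: orthonormal_def)
qed

lemma bessel_residual_orthogonal:
  assumes "finite B" "orthonormal B" "w \<in> B"
  shows "cinner (x - (\<Sum>v\<in>B. cinner x v *\<^sub>C v)) w = 0"
  using cinner_sum_orthonormal[of B "\<lambda>v. v" w "\<lambda>v. cinner x v"] assms
  by (auto simp: orthonormal_def cinner_diff_left)

text \<open>If x were outside the span, its residual after projection onto B, normalised, would be a
  unit vector of S orthogonal to B.\<close>

lemma span_maximal_orthonormal:
  fixes S :: "'a::chilbert_space set"
  assumes S: "complex_vector.subspace S" and B: "finite B" "orthonormal B" "B \<subseteq> S"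
    and max: "\<And>x. x \<in> S \<Longrightarrow> \<forall>v\<in>B. cinner x v = 0 \<Longrightarrow> norm x \<noteq> 1"
  shows "complex_vector.span B = S"
proof
  show "complex_vector.span B \<subseteq> S" using S B by (intro complex_vector.span_minimal)
  show "S \<subseteq> complex_vector.span B"
  proof
    fix x assume x: "x \<in> S"
    let ?y = "\<Sum>v\<in>B. cinner x v *\<^sub>C v"
    have y: "?y \<in> complex_vector.span B"
      by (intro complex_vector.span_sum complex_vector.span_scale complex_vector.span_base)
    have "x - ?y \<in> S"
      using complex_vector.subspace_diff[OF S x] y \<open>complex_vector.span B \<subseteq> S\<close> by blast
    have "x - ?y = 0"
    proof (rule ccontr)
      assume ne: "x - ?y \<noteq> 0"
      let ?z = "complex_of_real (inverse (norm (x - ?y))) *\<^sub>C (x - ?y)"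
      have "?z \<in> S" using \<open>x - ?y \<in> S\<close> by (rule complex_vector.subspace_scale[OF S])
      moreover have "\<forall>v\<in>B. cinner ?z v = 0"
        using bessel_residual_orthogonal[OF B(1,2)] by (simp add: cinner_scaleC_left)
      moreover have "norm ?z = 1" using ne by (simp add: norm_inverse)
      ultimately show False using max by blast
    qed
    then show "x \<in> complex_vector.span B" using y by simp
  qed
qed

text \<open>Finite orthonormal sets are independent, so the exchange lemma bounds them. Finiteness
  has to be part of the conclusion: an infinite set has \<open>card\<close> 0 and would meet the
  bound vacuously.\<close>

lemma card_orthonormal_le:
  assumes "finite W" "orthonormal B" "B \<subseteq> complex_vector.span W"
  shows "finite B \<and> card B \<le> card W"
proof -
  have *: "finite F \<Longrightarrow> F \<subseteq> B \<Longrightarrow> card F \<le> card W" for F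
  proof -
    assume F: "finite F" "F \<subseteq> B"
    have "complex_vector.independent F"
      using F assms(2) by (intro orthonormal_independent) (auto simp: orthonormal_def)
    then show "card F \<le> card W"
      using complex_vector.independent_span_bound[of W F] assms F by blast
  qed
  have "finite B"
  proof (rule ccontr)
    assume "infinite B"
    then obtain F where "F \<subseteq> B" "finite F" "card F = Suc (card W)"
      using infinite_arbitrarily_large by blast
    then show False using * by fastforce
  qed
  then show ?thesis using * by blast
qed

subsection \<open>Counting singular values\<close>

text \<open>Gaussian elimination: an equation in which the unknown k has a nonzero coefficient is
  used to eliminate k from all other equations.\<close>

lemma homogeneous_system:
  fixes a :: "'j \<Rightarrow> 'g \<Rightarrow> 'f::field"
  assumes "finite G" "finite J" "card G < card J"
  shows "\<exists>c. (\<exists>j\<in>J. c j \<noteq> 0) \<and> (\<forall>g\<in>G. (\<Sum>j\<in>J. c j * a j g) = 0)"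
  using assms
proof (induction G arbitrary: J a rule: finite_induct)
  case empty
  then show ?case by (intro exI[of _ "\<lambda>_. 1"]) (auto simp: card_gt_0_iff)
next
  case (insert g G)
  show ?case
  proof (cases "\<forall>j\<in>J. a j g = 0")
    case True
    have "card G < card J" using insert.prems insert.hyps by simp
    from insert.IH[OF insert.prems(1) this] obtain c where
      "\<exists>j\<in>J. c j \<noteq> 0" "\<forall>g\<in>G. (\<Sum>j\<in>J. c j * a j g) = 0" by blast
    then show ?thesis using True by (intro exI[of _ c]) simp
  next
    case False
    then obtain k where k: "k \<in> J" "a k g \<noteq> 0" by blast
    let ?J = "J - {k}"
    have "finite ?J" "card G < card ?J" using insert.prems insert.hyps k by simp_all
    from insert.IH[OF this, of "\<lambda>j h. a j h - a j g / a k g * a k h"] obtain c where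
      c: "\<exists>j\<in>?J. c j \<noteq> 0" "\<And>h. h \<in> G \<Longrightarrow> (\<Sum>j\<in>?J. c j * (a j h - a j g / a k g * a k h)) = 0" by blast
    \<comment> \<open>Back substitution: equation g forces the value of the pivot unknown k.\<close>
    define d where "d = (\<lambda>j. if j = k then - (\<Sum>i\<in>?J. c i * a i g) / a k g else c j)"
    have split: "(\<Sum>j\<in>J. d j * a j h) = (\<Sum>j\<in>?J. c j * a j h) - (\<Sum>i\<in>?J. c i * a i g) / a k g * a k h" for h
    proof -
      have "(\<Sum>j\<in>J. d j * a j h) = d k * a k h + (\<Sum>j\<in>?J. d j * a j h)"
        using insert.prems k by (intro sum.remove)
      also have "(\<Sum>j\<in>?J. d j * a j h) = (\<Sum>j\<in>?J. c j * a j h)"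
        by (intro sum.cong) (auto simp: d_def)
      finally show ?thesis by (simp add: d_def)
    qed
    have "(\<Sum>j\<in>J. d j * a j h) = 0" if "h \<in> G" for h
    proof -
      have "(\<Sum>j\<in>?J. c j * (a j h - a j g / a k g * a k h))
        = (\<Sum>j\<in>?J. c j * a j h) - (\<Sum>i\<in>?J. c i * a i g) / a k g * a k h"
        by (simp add: algebra_simps sum_subtractf sum_divide_distrib sum_distrib_left)
      then show ?thesis using c(2)[OF that] split[of h] by simp
    qed
    moreover have "(\<Sum>j\<in>J. d j * a j g) = 0" using split[of g] k by simp
    moreover have "\<exists>j\<in>J. d j \<noteq> 0" using c(1) by (auto simp: d_def)
    ultimately show ?thesis by (intro exI[of _ d]) simp
  qed
qed

text \<open>The dimension count behind the min-max principle. With more than \<open>card G\<close>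
  such vectors, some nonzero combination x of them is orthogonal to G; orthogonality of the v i and
  of their images gives |T x| \<ge> \<epsilon> |x|, against the last assumption. Singular values are
  thus compared through their counting functions, with no ordered enumeration.\<close>

lemma card_large_singular_values_le:
  fixes T :: "'a::chilbert_space \<Rightarrow> 'a" and v :: "'i \<Rightarrow> 'a"
  assumes T: "bounded_clinear T" and "finite J" "finite G" and \<epsilon>: "0 \<le> \<epsilon>"
    and v: "\<And>i. i \<in> J \<Longrightarrow> norm (v i) = 1"
      "\<And>i j. i \<in> J \<Longrightarrow> j \<in> J \<Longrightarrow> i \<noteq> j \<Longrightarrow> cinner (v i) (v j) = 0"
      "\<And>i j. i \<in> J \<Longrightarrow> j \<in> J \<Longrightarrow> i \<noteq> j \<Longrightarrow> cinner (T (v i)) (T (v j)) = 0"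
    and G: "\<And>x. x \<noteq> 0 \<Longrightarrow> \<forall>g\<in>G. cinner x g = 0 \<Longrightarrow> norm (T x) < \<epsilon> * norm x"
  shows "card {j\<in>J. \<epsilon> \<le> norm (T (v j))} \<le> card G"
proof (rule ccontr)
  let ?K = "{j\<in>J. \<epsilon> \<le> norm (T (v j))}"
  assume "\<not> ?thesis"
  then have "card G < card ?K" by simp
  with assms(2,3) obtain c where c: "\<exists>j\<in>?K. c j \<noteq> 0" "\<And>g. g \<in> G \<Longrightarrow> (\<Sum>j\<in>?K. c j * cinner (v j) g) = 0"
    using homogeneous_system[of G ?K "\<lambda>j g. cinner (v j) g"] by auto
  define x where "x = (\<Sum>j\<in>?K. c j *\<^sub>C v j)"
  have fK: "finite ?K" using assms(2) by simp
  have nx: "(norm x)\<^sup>2 = (\<Sum>j\<in>?K. (cmod (c j))\<^sup>2)"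
    unfolding x_def by (subst norm_sum_orthogonal[OF fK]) (use v in auto)
  have Tx: "T x = (\<Sum>j\<in>?K. c j *\<^sub>C T (v j))"
    unfolding x_def by (simp add: bounded_clinear_sum[OF T] bounded_clinear_scaleC[OF T])
  have nTx: "(norm (T x))\<^sup>2 = (\<Sum>j\<in>?K. (cmod (c j))\<^sup>2 * (norm (T (v j)))\<^sup>2)"
    unfolding Tx by (subst norm_sum_orthogonal[OF fK]) (use v in auto)
  have "\<epsilon>\<^sup>2 * (norm x)\<^sup>2 \<le> (norm (T x))\<^sup>2"
    unfolding nx nTx sum_distrib_left
  proof (rule sum_mono)
    fix j assume "j \<in> ?K"
    then have "\<epsilon>\<^sup>2 \<le> (norm (T (v j)))\<^sup>2" using \<epsilon> by (intro power_mono) auto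
    then show "\<epsilon>\<^sup>2 * (cmod (c j))\<^sup>2 \<le> (cmod (c j))\<^sup>2 * (norm (T (v j)))\<^sup>2"
      by (subst mult.commute) (intro mult_left_mono, auto)
  qed
  then have "(\<epsilon> * norm x)\<^sup>2 \<le> (norm (T x))\<^sup>2" by (simp only: power_mult_distrib)
  then have "\<epsilon> * norm x \<le> norm (T x)" by (rule power2_le_imp_le) simp
  moreover have "x \<noteq> 0"
  proof -
    obtain j where j: "j \<in> ?K" "c j \<noteq> 0" using c(1) by blast
    have "0 < (cmod (c j))\<^sup>2" using j by simp
    also have "\<dots> \<le> (\<Sum>j\<in>?K. (cmod (c j))\<^sup>2)" using j fK by (intro member_le_sum) auto
    finally show ?thesis using nx by auto
  qed
  moreover have "\<forall>g\<in>G. cinner x g = 0"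
    using c(2) by (simp add: x_def cinner_sum_left cinner_scaleC_left)
  ultimately show False using G[of x] by simp
qed

text \<open>Greedy matching, by induction on removing an index with smallest s: it is matched last,
  when the count at its own level guarantees a free place.\<close>

lemma dominated_injection:
  fixes s :: "'j \<Rightarrow> real" and f :: "'v \<Rightarrow> real"
  assumes "finite J" "\<And>j. j \<in> J \<Longrightarrow> 0 < s j"
    and "\<And>\<epsilon>. 0 < \<epsilon> \<Longrightarrow> finite {v\<in>V. \<epsilon> \<le> f v}"
    and "\<And>\<epsilon>. 0 < \<epsilon> \<Longrightarrow> card {j\<in>J. \<epsilon> \<le> s j} \<le> card {v\<in>V. \<epsilon> \<le> f v}"
  shows "\<exists>h. inj_on h J \<and> h ` J \<subseteq> V \<and> (\<forall>j\<in>J. s j \<le> f (h j))"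
  using assms
proof (induction "card J" arbitrary: J)
  case 0
  then show ?case by auto
next
  case (Suc n)
  then have "J \<noteq> {}" by auto
  define k where "k = arg_min_on s J"
  have k: "k \<in> J" "\<And>j. j \<in> J \<Longrightarrow> s k \<le> s j"
    using arg_min_if_finite[OF Suc.prems(1) \<open>J \<noteq> {}\<close>, of s] arg_min_least[OF Suc.prems(1) \<open>J \<noteq> {}\<close>, of _ s]
    unfolding k_def by auto
  let ?J = "J - {k}"
  have "\<exists>h. inj_on h ?J \<and> h ` ?J \<subseteq> V \<and> (\<forall>j\<in>?J. s j \<le> f (h j))"
  proof (rule Suc.hyps(1))
    show "n = card ?J" using Suc.hyps(2) Suc.prems(1) k by simp
    fix \<epsilon> :: real assume "0 < \<epsilon>"
    have "card {j\<in>?J. \<epsilon> \<le> s j} \<le> card {j\<in>J. \<epsilon> \<le> s j}"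
      using Suc.prems(1) by (intro card_mono) auto
    then show "card {j\<in>?J. \<epsilon> \<le> s j} \<le> card {v\<in>V. \<epsilon> \<le> f v}"
      using Suc.prems(4)[OF \<open>0 < \<epsilon>\<close>] by linarith
  qed (use Suc.prems in auto)
  then obtain h where h: "inj_on h ?J" "h ` ?J \<subseteq> V" "\<And>j. j \<in> ?J \<Longrightarrow> s j \<le> f (h j)" by blast
  have "0 < s k" using Suc.prems k by blast
  \<comment> \<open>At the smallest value \<open>s k\<close> the level set is all of J, so at least
    \<open>card J\<close> elements of V qualify, while h occupies fewer.\<close>
  have "{j\<in>J. s k \<le> s j} = J" using k by auto
  then have "card J \<le> card {v\<in>V. s k \<le> f v}" using Suc.prems(4)[OF \<open>0 < s k\<close>] by simp
  moreover have "card (h ` ?J) < card J"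
    using card_image_le[of ?J h] Suc.hyps(2) Suc.prems(1) k by simp
  ultimately have lt: "card (h ` ?J) < card {v\<in>V. s k \<le> f v}" by linarith
  have "\<not> {v\<in>V. s k \<le> f v} \<subseteq> h ` ?J"
  proof
    assume "{v\<in>V. s k \<le> f v} \<subseteq> h ` ?J"
    then have "card {v\<in>V. s k \<le> f v} \<le> card (h ` ?J)"
      using Suc.prems(1) by (intro card_mono) auto
    then show False using lt by simp
  qed
  then obtain u where u: "u \<in> V" "s k \<le> f u" "u \<notin> h ` ?J" by blast
  have J: "J = insert k ?J" using k by blast
  have "inj_on (h(k := u)) J"
    using h(1) u(3) by (subst J) (auto simp: inj_on_def)
  moreover have "(h(k := u)) ` J \<subseteq> V" using h(2) u by auto
  moreover have "\<forall>j\<in>J. s j \<le> f ((h(k := u)) j)" using h(3) u by auto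
  ultimately show ?case by blast
qed

text \<open>Passes from counting functions to sums of an increasing \<phi>. Indices with s = 0 are
  set aside first, since the counts are known at positive levels only; they contribute \<phi> 0 =
  0.\<close>

lemma sum_le_infsum_of_card_le:
  fixes s :: "'j \<Rightarrow> real" and f :: "'v \<Rightarrow> real" and \<phi> :: "real \<Rightarrow> real"
  assumes "finite J" "\<And>j. j \<in> J \<Longrightarrow> 0 \<le> s j"
    and "\<And>\<epsilon>. 0 < \<epsilon> \<Longrightarrow> finite {v\<in>V. \<epsilon> \<le> f v}"
    and "\<And>\<epsilon>. 0 < \<epsilon> \<Longrightarrow> card {j\<in>J. \<epsilon> \<le> s j} \<le> card {v\<in>V. \<epsilon> \<le> f v}"
    and \<phi>: "\<phi> 0 = 0" "\<And>x. 0 \<le> x \<Longrightarrow> 0 \<le> \<phi> x" "\<And>x y. 0 \<le> x \<Longrightarrow> x \<le> y \<Longrightarrow> \<phi> x \<le> \<phi> y"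
    and f: "\<And>v. v \<in> V \<Longrightarrow> 0 \<le> f v" "(\<lambda>v. \<phi> (f v)) summable_on V"
  shows "(\<Sum>j\<in>J. \<phi> (s j)) \<le> (\<Sum>\<^sub>\<infinity>v\<in>V. \<phi> (f v))"
proof -
  let ?J = "{j\<in>J. 0 < s j}"
  have "\<exists>h. inj_on h ?J \<and> h ` ?J \<subseteq> V \<and> (\<forall>j\<in>?J. s j \<le> f (h j))"
  proof (rule dominated_injection)
    fix \<epsilon> :: real assume \<epsilon>: "0 < \<epsilon>"
    have "{j \<in> {j\<in>J. 0 < s j}. \<epsilon> \<le> s j} = {j\<in>J. \<epsilon> \<le> s j}" using \<epsilon> by auto
    then show "card {j \<in> {j\<in>J. 0 < s j}. \<epsilon> \<le> s j} \<le> card {v\<in>V. \<epsilon> \<le> f v}"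
      using assms(4)[OF \<epsilon>] by simp
  qed (use assms in auto)
  then obtain h where h: "inj_on h ?J" "h ` ?J \<subseteq> V" "\<And>j. j \<in> ?J \<Longrightarrow> s j \<le> f (h j)" by blast
  have "(\<Sum>j\<in>J. \<phi> (s j)) = (\<Sum>j\<in>?J. \<phi> (s j))"
  proof (rule sum.mono_neutral_right)
    show "\<forall>i\<in>J - ?J. \<phi> (s i) = 0" using assms(2) \<phi>(1) by (metis (no_types, lifting) DiffE mem_Collect_eq order_le_less)
  qed (use assms in auto)
  also have "\<dots> \<le> (\<Sum>j\<in>?J. \<phi> (f (h j)))" using h(3) by (intro sum_mono \<phi>(3)) auto
  also have "\<dots> = (\<Sum>v\<in>h ` ?J. \<phi> (f v))" using h(1) by (simp add: sum.reindex)
  also have "\<dots> \<le> (\<Sum>\<^sub>\<infinity>v\<in>V. \<phi> (f v))"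
    using h(2) assms(1) f \<phi>(2) by (intro finite_sum_le_infsum) auto
  finally show ?thesis .
qed

subsection \<open>Singular vectors of compact operators\<close>

lemma singular_eigenspace_cinner:
  assumes "bounded_clinear (T :: 'a::chilbert_space \<Rightarrow> 'a)" "x \<in> singular_eigenspace T \<sigma>"
  shows "cinner (T x) (T y) = complex_of_real (\<sigma>\<^sup>2) * cinner x y"
proof -
  have "cinner (T x) (T y) = cinner (cadjoint T (T x)) y"
    by (rule cadjoint'[OF assms(1), symmetric])
  also have "\<dots> = cinner (complex_of_real (\<sigma>\<^sup>2) *\<^sub>C x) y"
    using assms(2) by (simp only: singular_eigenspace_def mem_Collect_eq)
  finally show ?thesis by (simp only: cinner_scaleC_left)
qed

lemma singular_eigenspace_norm:
  assumes "bounded_clinear (T :: 'a::chilbert_space \<Rightarrow> 'a)" "x \<in> singular_eigenspace T \<sigma>" "0 \<le> \<sigma>"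
  shows "norm (T x) = \<sigma> * norm x"
proof -
  have "complex_of_real ((norm (T x))\<^sup>2) = complex_of_real ((\<sigma> * norm x)\<^sup>2)"
    using singular_eigenspace_cinner[OF assms(1,2), of x] by (simp add: cinner_self power_mult_distrib)
  then have "(norm (T x))\<^sup>2 = (\<sigma> * norm x)\<^sup>2" using of_real_eq_iff by blast
  then show ?thesis using assms(3) by (simp add: power2_eq_iff_nonneg)
qed

lemma subspace_singular_eigenspace:
  assumes T: "bounded_clinear (T :: 'a::chilbert_space \<Rightarrow> 'a)"
  shows "complex_vector.subspace (singular_eigenspace T \<sigma>)"
proof -
  note A = bounded_clinear_cadjoint[OF T]
  show ?thesis
    unfolding complex_vector.subspace_def singular_eigenspace_def mem_Collect_eq
    by (simp add: bounded_clinear_zero[OF T] bounded_clinear_zero[OF A] bounded_clinear_add[OF T]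
        bounded_clinear_add[OF A] bounded_clinear_scaleC[OF T] bounded_clinear_scaleC[OF A]
        scaleC_add_right scaleC_scaleC mult.commute)
qed

text \<open>By Pythagoras the images are at distance at least \<epsilon> from each other, so an
  infinite family would have no convergent subsequence of images.\<close>

lemma finite_large_orthogonal_image:
  fixes T :: "'a::chilbert_space \<Rightarrow> 'a"
  assumes T: "compact_operator T" and "0 < \<epsilon>"
    and W: "\<And>v. v \<in> W \<Longrightarrow> norm v = 1" "\<And>v. v \<in> W \<Longrightarrow> \<epsilon> \<le> norm (T v)"
      "\<And>v w. v \<in> W \<Longrightarrow> w \<in> W \<Longrightarrow> v \<noteq> w \<Longrightarrow> cinner (T v) (T w) = 0"
  shows "finite W"
proof (rule ccontr)
  assume "infinite W"
  then obtain f :: "nat \<Rightarrow> 'a" where f: "inj f" "range f \<subseteq> W"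
    using infinite_countable_subset by blast
  have fW: "f n \<in> W" for n using f by blast
  have "seq_compact (closure (T ` cball 0 1))"
    using T compact_eq_seq_compact_metric by (auto simp: compact_operator_def)
  moreover have "\<forall>n. T (f n) \<in> closure (T ` cball 0 1)"
    using W(1)[OF fW] by (intro allI subsetD[OF closure_subset] imageI) simp
  ultimately obtain l r where r: "strict_mono (r :: nat \<Rightarrow> nat)" "((\<lambda>n. T (f n)) \<circ> r) \<longlonglongrightarrow> l"
    by (rule seq_compactE)
  have "Cauchy ((\<lambda>n. T (f n)) \<circ> r)" using r(2) by (rule LIMSEQ_imp_Cauchy)
  then obtain N where N: "\<forall>m\<ge>N. \<forall>n\<ge>N. dist (((\<lambda>n. T (f n)) \<circ> r) m) (((\<lambda>n. T (f n)) \<circ> r) n) < \<epsilon>"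
    using \<open>0 < \<epsilon>\<close> unfolding Cauchy_def by blast
  let ?v = "f (r N)" and ?w = "f (r (Suc N))"
  have d: "dist (T ?v) (T ?w) < \<epsilon>" using N[rule_format, of N "Suc N"] by simp
  have "r N \<noteq> r (Suc N)" using r(1) by (metis lessI less_irrefl strict_mono_less)
  then have ne: "?v \<noteq> ?w" using f(1) by (simp add: inj_eq)
  have "inner (T ?v) (T ?w) = 0" using W(3)[OF fW fW ne] by (simp add: inner_eq_Re_cinner)
  then have "(norm (T ?v - T ?w))\<^sup>2 = (norm (T ?v))\<^sup>2 + (norm (T ?w))\<^sup>2"
    by (simp add: power2_norm_eq_inner inner_diff_left inner_diff_right inner_commute)
  moreover have "\<epsilon>\<^sup>2 \<le> (norm (T ?v))\<^sup>2" using W(2)[OF fW] \<open>0 < \<epsilon>\<close> by (intro power_mono) auto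
  ultimately have "\<epsilon>\<^sup>2 \<le> (norm (T ?v - T ?w))\<^sup>2" using zero_le_power2[of "norm (T ?w)"] by linarith
  then have "\<epsilon> \<le> norm (T ?v - T ?w)" by (rule power2_le_imp_le) simp
  then show False using d by (simp add: dist_norm)
qed

text \<open>A maximizing sequence for \<open>\<parallel>T x\<parallel>\<close> on the unit ball of an invariant subspace converges, along a
  subsequence, to an eigenvector of \<open>T\<^sup>* T\<close>.\<close>

lemma maximal_singular_vector:
  fixes T :: "'a::chilbert_space \<Rightarrow> 'a"
  assumes T: "compact_operator T" and N: "closed N" "\<And>x c. x \<in> N \<Longrightarrow> c *\<^sub>C x \<in> N"
    and inv: "\<And>x. x \<in> N \<Longrightarrow> cadjoint T (T x) \<in> N"
    and x0: "x0 \<in> N" "x0 \<noteq> 0" "\<epsilon> * norm x0 \<le> norm (T x0)" and "0 < \<epsilon>"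
  shows "\<exists>m\<ge>\<epsilon>. \<exists>z\<in>N. norm z = 1 \<and> z \<in> singular_eigenspace T m"
proof -
  note Tb = compact_operator_bounded_clinear[OF T]
  note Ab = bounded_clinear_cadjoint[OF Tb]
  note Tl = bounded_clinear_bounded_linear[OF Tb] and Al = bounded_clinear_bounded_linear[OF Ab]
  define V where "V = {norm (T x) | x. x \<in> N \<and> norm x \<le> 1}"
  define m where "m = Sup V"
  obtain K where K: "\<And>x. norm (T x) \<le> norm x * K" "K > 0"
    using bounded_linear.pos_bounded[OF Tl] by blast
  have bdd: "bdd_above V"
  proof (rule bdd_aboveI[of _ K])
    fix y assume "y \<in> V"
    then obtain x where x: "y = norm (T x)" "norm x \<le> 1" by (auto simp: V_def)
    have "norm x * K \<le> 1 * K" using x K by (intro mult_right_mono) auto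
    then show "y \<le> K" using K(1)[of x] x by simp
  qed
  have unit: "norm (T x) \<le> m" if "x \<in> N" "norm x \<le> 1" for x
    unfolding m_def using that bdd by (intro cSup_upper) (auto simp: V_def)
  have scaled: "complex_of_real (inverse (norm x)) *\<^sub>C x \<in> N"
    "norm (complex_of_real (inverse (norm x)) *\<^sub>C x) \<le> 1"
    "norm (T (complex_of_real (inverse (norm x)) *\<^sub>C x)) = norm (T x) / norm x"
    if "x \<in> N" for x
  proof -
    show "complex_of_real (inverse (norm x)) *\<^sub>C x \<in> N" by (rule N(2)[OF that])
    show "norm (complex_of_real (inverse (norm x)) *\<^sub>C x) \<le> 1"
      unfolding norm_scaleC norm_of_real by (cases "x = 0") simp_all
    show "norm (T (complex_of_real (inverse (norm x)) *\<^sub>C x)) = norm (T x) / norm x"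
      unfolding bounded_clinear_scaleC[OF Tb] norm_scaleC norm_of_real
      by (simp add: divide_inverse mult.commute)
  qed
  have le_m: "norm (T x) \<le> m * norm x" if "x \<in> N" for x
  proof (cases "x = 0")
    case True
    then show ?thesis by (simp add: bounded_clinear_zero[OF Tb])
  next
    case False
    have "norm (T x) / norm x \<le> m" using unit[OF scaled(1,2)[OF that]] scaled(3)[OF that] by simp
    then show ?thesis using False by (simp add: field_simps)
  qed
  have "\<epsilon> \<le> norm (T x0) / norm x0" using x0 by (simp add: field_simps)
  also have "\<dots> \<le> m" using unit[OF scaled(1,2)[OF x0(1)]] scaled(3)[OF x0(1)] by simp
  finally have m: "\<epsilon> \<le> m" .
  then have "0 < m" using \<open>0 < \<epsilon>\<close> by simp
  have "\<exists>x. x \<in> N \<and> norm x \<le> 1 \<and> m - inverse (real (Suc n)) < norm (T x)" for n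
  proof -
    have "V \<noteq> {}" using scaled(1,2)[OF x0(1)] by (auto simp: V_def)
    moreover have "m - inverse (real (Suc n)) < Sup V" by (simp add: m_def)
    ultimately obtain y where "y \<in> V" "m - inverse (real (Suc n)) < y" using less_cSupD by blast
    then show ?thesis by (auto simp: V_def)
  qed
  then obtain X where X: "\<And>n. X n \<in> N" "\<And>n. norm (X n) \<le> 1"
    "\<And>n. m - inverse (real (Suc n)) < norm (T (X n))" by metis
  have "(\<lambda>n. norm (T (X n))) \<longlonglongrightarrow> m"
  proof (rule tendsto_sandwich[OF _ _ _ tendsto_const])
    show "(\<lambda>n. m - inverse (real (Suc n))) \<longlonglongrightarrow> m"
      using tendsto_diff[OF tendsto_const LIMSEQ_inverse_real_of_nat, of m] by simp
  qed (use X unit in \<open>auto intro!: always_eventually less_imp_le\<close>)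
  have "seq_compact (closure (T ` cball 0 1))"
    using T compact_eq_seq_compact_metric by (auto simp: compact_operator_def)
  moreover have "\<forall>n. T (X n) \<in> closure (T ` cball 0 1)"
    using X(2) by (intro allI subsetD[OF closure_subset] imageI) simp
  ultimately obtain y r where r: "strict_mono (r :: nat \<Rightarrow> nat)" "((\<lambda>n. T (X n)) \<circ> r) \<longlonglongrightarrow> y"
    by (rule seq_compactE)
  define Z where "Z n = X (r n)" for n
  have TZ: "(\<lambda>n. T (Z n)) \<longlonglongrightarrow> y" using r(2) by (simp add: Z_def comp_def)
  have nTZ: "(\<lambda>n. norm (T (Z n))) \<longlonglongrightarrow> m"
    using LIMSEQ_subseq_LIMSEQ[OF \<open>(\<lambda>n. norm (T (X n))) \<longlonglongrightarrow> m\<close> r(1)] by (simp add: Z_def comp_def)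
  have ATZ: "(\<lambda>n. cadjoint T (T (Z n))) \<longlonglongrightarrow> cadjoint T y"
    by (rule bounded_linear.tendsto[OF Al TZ])
  \<comment> \<open>The defect in the eigenvalue equation for m^2. Expanding its square bounds it by
    m^4 - m^2 |T Z|^2, which tends to 0 because |T Z| tends to m.\<close>
  define D where "D n = cadjoint T (T (Z n)) - (m\<^sup>2) *\<^sub>R Z n" for n
  have D: "(norm (D n))\<^sup>2 \<le> m^4 - m\<^sup>2 * (norm (T (Z n)))\<^sup>2" for n
  proof -
    let ?w = "cadjoint T (T (Z n))"
    have ZN: "Z n \<in> N" "norm (Z n) \<le> 1" using X by (auto simp: Z_def)
    have wN: "?w \<in> N" using inv ZN by blast
    \<comment> \<open>Invariance of N enters here: \<open>?w\<close> lies in N, so |?w|^2 = <T Z, T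
      ?w> is at most |T Z| m |?w|.\<close>
    have "norm ?w \<le> m * norm (T (Z n))"
    proof (cases "?w = 0")
      case False
      have "complex_of_real ((norm ?w)\<^sup>2) = cinner (T (Z n)) (T ?w)"
        by (simp only: cinner_self[symmetric] cadjoint'[OF Tb])
      then have "(norm ?w)\<^sup>2 = cmod (cinner (T (Z n)) (T ?w))"
        by (metis norm_of_real abs_of_nonneg zero_le_power2)
      also have "\<dots> \<le> norm (T (Z n)) * norm (T ?w)" by (rule norm_cinner_le)
      also have "\<dots> \<le> norm (T (Z n)) * (m * norm ?w)" by (intro mult_left_mono le_m wN) simp
      finally have "norm ?w * norm ?w \<le> norm ?w * (m * norm (T (Z n)))"
        by (simp add: power2_eq_square mult_ac)
      then show ?thesis using False by simp
    qed (use \<open>0 < m\<close> in simp)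
    then have "(norm ?w)\<^sup>2 \<le> (m * norm (T (Z n)))\<^sup>2" by (intro power_mono) simp_all
    then have 1: "(norm ?w)\<^sup>2 \<le> m\<^sup>2 * (norm (T (Z n)))\<^sup>2" by (simp only: power_mult_distrib)
    have "cinner ?w (Z n) = complex_of_real ((norm (T (Z n)))\<^sup>2)"
      by (simp only: cadjoint'[OF Tb] cinner_self)
    then have 2: "inner ?w (Z n) = (norm (T (Z n)))\<^sup>2" by (simp add: inner_eq_Re_cinner)
    have "(norm (D n))\<^sup>2 = (norm ?w)\<^sup>2 - 2 * m\<^sup>2 * inner ?w (Z n) + (m\<^sup>2)\<^sup>2 * (norm (Z n))\<^sup>2"
      unfolding D_def power2_norm_eq_inner inner_diff_left inner_diff_right inner_scaleR_left inner_scaleR_right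
      by (simp add: inner_commute power2_eq_square algebra_simps)
    moreover have "(m\<^sup>2)\<^sup>2 * (norm (Z n))\<^sup>2 \<le> (m\<^sup>2)\<^sup>2 * 1"
      using ZN by (intro mult_left_mono power_le_one) auto
    moreover have "(m\<^sup>2)\<^sup>2 = m^4" by simp
    ultimately show ?thesis using 1 2 by simp
  qed
  have "(\<lambda>n. m^4 - m\<^sup>2 * (norm (T (Z n)))\<^sup>2) \<longlonglongrightarrow> m^4 - m\<^sup>2 * m\<^sup>2"
    by (intro tendsto_intros nTZ)
  then have lim0: "(\<lambda>n. m^4 - m\<^sup>2 * (norm (T (Z n)))\<^sup>2) \<longlonglongrightarrow> 0"
    by (simp add: power2_eq_square power4_eq_xxxx mult.assoc)
  have "(\<lambda>n. (norm (D n))\<^sup>2) \<longlonglongrightarrow> 0"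
    by (rule tendsto_sandwich[OF _ _ tendsto_const lim0]) (use D in \<open>auto intro!: always_eventually\<close>)
  then have "(\<lambda>n. norm (D n)) \<longlonglongrightarrow> 0"
    using tendsto_real_sqrt[of "\<lambda>n. (norm (D n))\<^sup>2" 0] by simp
  then have "D \<longlonglongrightarrow> 0" by (rule tendsto_norm_zero_cancel)
  \<comment> \<open>Compactness only makes the images \<open>T (Z n)\<close> converge. Solving the
    definition of \<open>D\<close> for \<open>Z n\<close> transfers convergence to the vectors
    themselves.\<close>
  then have "(\<lambda>n. (1 / m\<^sup>2) *\<^sub>R (cadjoint T (T (Z n)) - D n)) \<longlonglongrightarrow> (1 / m\<^sup>2) *\<^sub>R (cadjoint T y - 0)"
    by (intro tendsto_intros ATZ)
  moreover have "(1 / m\<^sup>2) *\<^sub>R (cadjoint T (T (Z n)) - D n) = Z n" for n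
    using \<open>0 < m\<close> by (simp add: D_def)
  ultimately have Z: "Z \<longlonglongrightarrow> (1 / m\<^sup>2) *\<^sub>R cadjoint T y" by simp
  define z where "z = (1 / m\<^sup>2) *\<^sub>R cadjoint T y"
  have Z: "Z \<longlonglongrightarrow> z" using Z by (simp add: z_def)
  have zN: "z \<in> N"
    by (rule closed_sequentially[OF N(1) _ Z]) (use X in \<open>simp add: Z_def\<close>)
  have Tz: "T z = y"
    using bounded_linear.tendsto[OF Tl Z] TZ by (rule LIMSEQ_unique)
  have "complex_of_real (m\<^sup>2) *\<^sub>C z = cadjoint T y"
    using \<open>0 < m\<close> by (simp only: scaleC_of_real z_def scaleR_scaleR) simp
  then have zE: "z \<in> singular_eigenspace T m"
    by (simp add: singular_eigenspace_def Tz)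
  have "norm (T z) = m" using LIMSEQ_unique[OF tendsto_norm[OF TZ] nTZ] Tz by simp
  then have "norm z = 1"
    using singular_eigenspace_norm[OF Tb zE] \<open>0 < m\<close> by simp
  then show ?thesis using m zN zE by blast
qed

text \<open>Indexed by the vectors themselves instead of a decreasing sequence. The smallness clause
  is completeness in the form consumed by \<open>card_large_singular_values_le\<close>; the
  bijection carries sums over \<open>singular_indices\<close>, with multiplicities, to sums over
  B.\<close>

definition singular_system :: "('a::chilbert_space \<Rightarrow> 'a) \<Rightarrow> 'a set \<Rightarrow> bool" where
  "singular_system T B \<longleftrightarrow> orthonormal B \<and>
     (\<forall>v\<in>B. T v \<noteq> 0 \<and> v \<in> singular_eigenspace T (norm (T v))) \<and>
     (\<forall>\<epsilon>>0. finite {v\<in>B. \<epsilon> \<le> norm (T v)}) \<and>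
     (\<forall>\<epsilon>>0. \<forall>x. x \<noteq> 0 \<longrightarrow> (\<forall>v\<in>B. \<epsilon> \<le> norm (T v) \<longrightarrow> cinner x v = 0) \<longrightarrow> norm (T x) < \<epsilon> * norm x) \<and>
     (\<exists>g. bij_betw g B (singular_indices T) \<and> (\<forall>v\<in>B. fst (g v) = norm (T v)))"

lemma singular_system_orthogonal:
  assumes "bounded_clinear T" "singular_system T B" "v \<in> B" "w \<in> B" "v \<noteq> w"
  shows "cinner v w = 0" "cinner (T v) (T w) = 0"
proof -
  show *: "cinner v w = 0" using assms(2-5) by (simp add: singular_system_def orthonormal_def)
  have "v \<in> singular_eigenspace T (norm (T v))" using assms(2,3) by (simp add: singular_system_def)
  from singular_eigenspace_cinner[OF assms(1) this, of w] show "cinner (T v) (T w) = 0" by (simp add: *)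
qed

text \<open>Evaluating <T x, T y> from either side gives both \<sigma>^2 <x, y> and \<tau>^2 <x,
  y>.\<close>

lemma singular_eigenspaces_orthogonal:
  assumes T: "bounded_clinear (T :: 'a::chilbert_space \<Rightarrow> 'a)"
    and x: "x \<in> singular_eigenspace T \<sigma>" and y: "y \<in> singular_eigenspace T \<tau>"
    and "0 \<le> \<sigma>" "0 \<le> \<tau>" "\<sigma> \<noteq> \<tau>"
  shows "cinner x y = 0"
proof -
  have "complex_of_real (\<tau>\<^sup>2) * cinner x y = cnj (complex_of_real (\<tau>\<^sup>2) * cinner y x)"
    by (simp add: cinner_commute[of y x])
  also have "\<dots> = cnj (cinner (T y) (T x))" by (simp only: singular_eigenspace_cinner[OF T y])
  also have "\<dots> = cinner (T x) (T y)" by (rule cinner_commute[symmetric])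
  also have "\<dots> = complex_of_real (\<sigma>\<^sup>2) * cinner x y" by (rule singular_eigenspace_cinner[OF T x])
  finally have "complex_of_real (\<tau>\<^sup>2) = complex_of_real (\<sigma>\<^sup>2) \<or> cinner x y = 0" by auto
  moreover have "\<tau>\<^sup>2 \<noteq> \<sigma>\<^sup>2" using assms(4-6) by (simp add: power2_eq_iff_nonneg)
  then have "complex_of_real (\<tau>\<^sup>2) \<noteq> complex_of_real (\<sigma>\<^sup>2)" using of_real_eq_iff by blast
  ultimately show ?thesis by blast
qed

text \<open>A maximal orthonormal set of singular vectors works: if the smallness clause failed,
  \<open>maximal_singular_vector\<close> on the orthogonal complement of the large vectors would
  produce a further one.\<close>

theorem singular_system_exists:
  fixes T :: "'a::chilbert_space \<Rightarrow> 'a"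
  assumes T: "compact_operator T"
  shows "\<exists>B. singular_system T B"
proof -
  note Tb = compact_operator_bounded_clinear[OF T]
  \<comment> \<open>Choosing B inside the union of the eigenspaces ensures that every member is an
    exact singular vector.\<close>
  define S where "S = {x. \<exists>\<sigma>>0. x \<in> singular_eigenspace T \<sigma>}"
  have "orthonormal ({} :: 'a set)" by (simp add: orthonormal_def)
  then obtain B where B: "B \<subseteq> S" "orthonormal B"
    and max: "\<And>x. x \<in> S \<Longrightarrow> \<forall>v\<in>B. cinner x v = 0 \<Longrightarrow> norm x \<noteq> 1"
    using maximal_orthonormal_extension[of "{}" S] by blast
  have n1: "norm v = 1" if "v \<in> B" for v using B(2) that by (simp add: orthonormal_def)
  have BE: "T v \<noteq> 0 \<and> v \<in> singular_eigenspace T (norm (T v))" if "v \<in> B" for v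
  proof -
    obtain \<sigma> where s: "\<sigma> > 0" "v \<in> singular_eigenspace T \<sigma>" using subsetD[OF B(1) \<open>v \<in> B\<close>] unfolding S_def by blast
    then have "norm (T v) = \<sigma>" using singular_eigenspace_norm[OF Tb s(2)] n1[OF that] by simp
    then show ?thesis using s by auto
  qed
  have orthT: "cinner (T v) (T w) = 0" if "v \<in> B" "w \<in> B" "v \<noteq> w" for v w
  proof -
    have "cinner v w = 0" using B(2) that by (simp add: orthonormal_def)
    then show ?thesis using singular_eigenspace_cinner[OF Tb conjunct2[OF BE[OF that(1)]], of w] by simp
  qed
  have fin: "finite {v\<in>B. \<epsilon> \<le> norm (T v)}" if "0 < \<epsilon>" for \<epsilon>
    using n1 orthT by (intro finite_large_orthogonal_image[OF T that]) auto
  have small: "norm (T x) < \<epsilon> * norm x"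
    if \<epsilon>: "0 < \<epsilon>" and x: "x \<noteq> 0" "\<forall>v\<in>B. \<epsilon> \<le> norm (T v) \<longrightarrow> cinner x v = 0" for \<epsilon> x
  proof (rule ccontr)
    assume "\<not> ?thesis"
    then have xe: "\<epsilon> * norm x \<le> norm (T x)" by simp
    \<comment> \<open>Orthogonal complement of the singular vectors at level \<epsilon>. It is
      invariant because these are eigenvectors of the self-adjoint composition of T with its
      adjoint.\<close>
    define N where "N = (\<Inter>v\<in>{v\<in>B. \<epsilon> \<le> norm (T v)}. {x. cinner x v = 0})"
    have "closed {x. cinner x v = 0}" for v :: 'a
      by (intro closed_Collect_eq continuous_intros
          linear_continuous_on bounded_bilinear.bounded_linear_left[OF bounded_bilinear_cinner])
    then have "closed N" unfolding N_def by (intro closed_INT) auto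
    moreover have "c *\<^sub>C u \<in> N" if "u \<in> N" for u c using that by (simp add: N_def cinner_scaleC_left)
    moreover have "cadjoint T (T u) \<in> N" if "u \<in> N" for u
    proof -
      have "cinner (cadjoint T (T u)) v = 0" if "v \<in> B" "\<epsilon> \<le> norm (T v)" for v
      proof -
        have "cinner u v = 0" using \<open>u \<in> N\<close> that by (simp add: N_def)
        then have "cinner v u = 0" by (subst cinner_commute) simp
        then have "cinner (T v) (T u) = 0"
          using singular_eigenspace_cinner[OF Tb conjunct2[OF BE[OF that(1)]], of u] by simp
        then have "cinner (T u) (T v) = 0" by (subst cinner_commute) simp
        then show ?thesis by (simp only: cadjoint'[OF Tb])
      qed
      then show ?thesis by (simp add: N_def)
    qed
    moreover have "x \<in> N" using x(2) by (simp add: N_def)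
    ultimately have "\<exists>m\<ge>\<epsilon>. \<exists>z\<in>N. norm z = 1 \<and> z \<in> singular_eigenspace T m"
      using maximal_singular_vector[OF T, of N x \<epsilon>] x(1) xe \<epsilon> by blast
    then obtain m z where m: "\<epsilon> \<le> m" and z: "z \<in> N" "norm z = 1" "z \<in> singular_eigenspace T m" by blast
    \<comment> \<open>Orthogonality to the large vectors holds by membership in N, and to the small
      ones because their eigenvalues differ from m^2 \<ge> \<epsilon>^2.\<close>
    have "cinner z v = 0" if "v \<in> B" for v
    proof (cases "\<epsilon> \<le> norm (T v)")
      case True
      then show ?thesis using z(1) that by (simp add: N_def)
    next
      case False
      then show ?thesis
        using singular_eigenspaces_orthogonal[OF Tb z(3) conjunct2[OF BE[OF that]]] m \<epsilon> by auto
    qed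
    moreover have "z \<in> S" using z(3) m \<epsilon> unfolding S_def by (intro CollectI exI[of _ m]) simp
    ultimately show False using max z(2) by blast
  qed
  have "\<exists>G. bij_betw G {v\<in>B. norm (T v) = \<sigma>} {..<complex_vector.dim (singular_eigenspace T \<sigma>)}"
    if \<sigma>: "0 < \<sigma>" for \<sigma>
  proof -
    let ?B = "{v\<in>B. norm (T v) = \<sigma>}"
    have f: "finite ?B" by (rule finite_subset[OF _ fin[OF \<sigma>]]) auto
    have o: "orthonormal ?B" using B(2) by (auto simp: orthonormal_def)
    \<comment> \<open>Members of B at other levels are automatically orthogonal to this eigenspace,
      so maximality of B restricts to maximality of \<open>?B\<close> in it.\<close>
    have "complex_vector.span ?B = singular_eigenspace T \<sigma>"
    proof (rule span_maximal_orthonormal[OF subspace_singular_eigenspace[OF Tb] f o])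
      show "?B \<subseteq> singular_eigenspace T \<sigma>" using BE by auto
      fix x assume x: "x \<in> singular_eigenspace T \<sigma>" "\<forall>v\<in>?B. cinner x v = 0"
      have "cinner x v = 0" if "v \<in> B" for v
      proof (cases "norm (T v) = \<sigma>")
        case True
        then show ?thesis using x(2) that by simp
      next
        case False
        then show ?thesis
          using singular_eigenspaces_orthogonal[OF Tb x(1) conjunct2[OF BE[OF that]]] \<sigma> by auto
      qed
      moreover have "x \<in> S" using x(1) \<sigma> by (auto simp: S_def)
      ultimately show "norm x \<noteq> 1" using max by blast
    qed
    then have "complex_vector.dim (singular_eigenspace T \<sigma>) = card ?B"
      using complex_vector.dim_span_eq_card_independent[OF orthonormal_independent[OF f o]] by simp
    then show ?thesis using finite_same_card_bij[OF f, of "{..<card ?B}"] by simp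
  qed
  then obtain G where G: "\<And>\<sigma>. 0 < \<sigma> \<Longrightarrow>
      bij_betw (G \<sigma>) {v\<in>B. norm (T v) = \<sigma>} {..<complex_vector.dim (singular_eigenspace T \<sigma>)}"
    by metis
  define g where "g v = (norm (T v), G (norm (T v)) v)" for v
  have "bij_betw g B (singular_indices T)"
    unfolding bij_betw_def
  proof
    show "inj_on g B"
    proof (rule inj_onI)
      fix v w assume vw: "v \<in> B" "w \<in> B" "g v = g w"
      then have "norm (T v) = norm (T w)" "G (norm (T v)) v = G (norm (T v)) w" by (auto simp: g_def)
      moreover have "0 < norm (T v)" using BE[OF vw(1)] by simp
      ultimately show "v = w"
        using vw inj_onD[OF bij_betw_imp_inj_on[OF G[of "norm (T v)"]], of v w] by simp
    qed
    show "g ` B = singular_indices T"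
    proof
      show "g ` B \<subseteq> singular_indices T"
      proof (rule image_subsetI)
        fix v assume v: "v \<in> B"
        then have "0 < norm (T v)" using BE by simp
        from bij_betwE[OF G[OF this]] v
        have "G (norm (T v)) v < complex_vector.dim (singular_eigenspace T (norm (T v)))" by simp
        then show "g v \<in> singular_indices T" using \<open>0 < norm (T v)\<close> by (simp add: g_def singular_indices_def)
      qed
      show "singular_indices T \<subseteq> g ` B"
      proof
        fix i assume "i \<in> singular_indices T"
        then obtain \<sigma> k where i: "i = (\<sigma>, k)" "0 < \<sigma>"
          "k \<in> {..<complex_vector.dim (singular_eigenspace T \<sigma>)}"
          by (auto simp: singular_indices_def)
        then have "k \<in> G \<sigma> ` {v\<in>B. norm (T v) = \<sigma>}"
          using bij_betw_imp_surj_on[OF G[OF i(2)]] by simp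
        then obtain v where "v \<in> B" "norm (T v) = \<sigma>" "G \<sigma> v = k" by blast
        then show "i \<in> g ` B" by (auto simp: i g_def)
      qed
    qed
  qed
  moreover have "\<forall>v\<in>B. fst (g v) = norm (T v)" by (simp add: g_def)
  ultimately have "\<exists>g. bij_betw g B (singular_indices T) \<and> (\<forall>v\<in>B. fst (g v) = norm (T v))"
    by blast
  then have "singular_system T B"
    unfolding singular_system_def using B(2) BE fin small by (intro conjI ballI allI impI) simp_all
  then show ?thesis by blast
qed

subsection \<open>Schatten sums\<close>

text \<open>The p-th power of \<open>schatten_norm p\<close>. Only such powers enter the inequality,
  so the root is stripped at once.\<close>

definition schatten_sum :: "real \<Rightarrow> ('a::chilbert_space \<Rightarrow> 'a) \<Rightarrow> real" where
  "schatten_sum p T = (\<Sum>\<^sub>\<infinity>(\<sigma>, k)\<in>singular_indices T. \<sigma> powr p)"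

lemma schatten_sum_nonneg: "0 \<le> schatten_sum p T"
  unfolding schatten_sum_def by (intro infsum_nonneg) auto

lemma schatten_norm_powr: "0 < p \<Longrightarrow> schatten_norm p T powr p = schatten_sum p T"
  using schatten_sum_nonneg[of p T]
  by (simp add: schatten_norm_def schatten_sum_def powr_powr)

lemma schatten_class_compact: "T \<in> schatten_class p \<Longrightarrow> compact_operator T"
  by (simp add: schatten_class_def)

lemma singular_system_summable_iff:
  assumes "singular_system T B"
  shows "(\<lambda>(\<sigma>, k). \<sigma> powr p) summable_on singular_indices T \<longleftrightarrow> (\<lambda>v. norm (T v) powr p) summable_on B"
    and "schatten_sum p T = (\<Sum>\<^sub>\<infinity>v\<in>B. norm (T v) powr p)"
proof -
  obtain g where g: "bij_betw g B (singular_indices T)" "\<And>v. v \<in> B \<Longrightarrow> fst (g v) = norm (T v)"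
    using assms by (auto simp: singular_system_def)
  have eq: "(case g v of (\<sigma>, k) \<Rightarrow> \<sigma> powr p) = norm (T v) powr p" if "v \<in> B" for v
    using g(2)[OF that] by (simp add: case_prod_beta)
  show "(\<lambda>(\<sigma>, k). \<sigma> powr p) summable_on singular_indices T \<longleftrightarrow> (\<lambda>v. norm (T v) powr p) summable_on B"
    using summable_on_reindex_bij_betw[OF g(1), of "\<lambda>(\<sigma>, k). \<sigma> powr p"]
      summable_on_cong[of B "\<lambda>v. case g v of (\<sigma>, k) \<Rightarrow> \<sigma> powr p" "\<lambda>v. norm (T v) powr p"] eq by simp
  show "schatten_sum p T = (\<Sum>\<^sub>\<infinity>v\<in>B. norm (T v) powr p)"
    unfolding schatten_sum_def
    using infsum_reindex_bij_betw[OF g(1), of "\<lambda>(\<sigma>, k). \<sigma> powr p"]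
      infsum_cong[of B "\<lambda>v. case g v of (\<sigma>, k) \<Rightarrow> \<sigma> powr p" "\<lambda>v. norm (T v) powr p"] eq by simp
qed

lemma schatten_class_singular_system:
  assumes "T \<in> schatten_class p"
  obtains B where "singular_system T B" "(\<lambda>v. norm (T v) powr p) summable_on B"
    "schatten_sum p T = (\<Sum>\<^sub>\<infinity>v\<in>B. norm (T v) powr p)"
proof -
  obtain B where B: "singular_system T B"
    using singular_system_exists[OF schatten_class_compact[OF assms]] by blast
  then show ?thesis
    using that[OF B] assms singular_system_summable_iff[OF B, of p] by (simp add: schatten_class_def)
qed

lemma singular_system_finite: "singular_system T B \<Longrightarrow> 0 < \<epsilon> \<Longrightarrow> finite {v\<in>B. \<epsilon> \<le> norm (T v)}"
  by (simp add: singular_system_def)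

lemma singular_system_small:
  assumes "singular_system T B" "0 < \<epsilon>" "x \<noteq> 0" "\<And>v. v \<in> B \<Longrightarrow> \<epsilon> \<le> norm (T v) \<Longrightarrow> cinner x v = 0"
  shows "norm (T x) < \<epsilon> * norm x"
  using assms unfolding singular_system_def by blast

text \<open>If x is orthogonal to the vectors Q v for the finitely many v with |T v| \<ge>
  \<epsilon>, then P x is orthogonal to these v, hence |R x| < (\<epsilon> + \<delta>) |x|. So R has
  at level \<epsilon> + \<delta> at most as many singular values as T at level \<epsilon>. P is the
  frame projection for compressions and the identity elsewhere; a positive \<delta> occurs in the
  semicontinuity proof.\<close>

lemma sum_le_schatten_sum:
  fixes T R :: "'a::chilbert_space \<Rightarrow> 'a" and v :: "'i \<Rightarrow> 'a"
  assumes T: "T \<in> schatten_class p" and p: "0 < p" and R: "bounded_clinear R" and J: "finite J"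
    and v: "\<And>i. i \<in> J \<Longrightarrow> norm (v i) = 1"
      "\<And>i j. i \<in> J \<Longrightarrow> j \<in> J \<Longrightarrow> i \<noteq> j \<Longrightarrow> cinner (v i) (v j) = 0"
      "\<And>i j. i \<in> J \<Longrightarrow> j \<in> J \<Longrightarrow> i \<noteq> j \<Longrightarrow> cinner (R (v i)) (R (v j)) = 0"
    and P: "\<And>x y. cinner (P x) y = cinner x (Q y)" "\<And>x. norm (P x) \<le> norm x"
    and RT: "\<And>x. norm (R x) \<le> norm (T (P x)) + \<delta> * norm x" and \<delta>: "0 \<le> \<delta>"
  shows "(\<Sum>i\<in>J. max 0 (norm (R (v i)) - \<delta>) powr p) \<le> schatten_sum p T"
proof -
  note Tb = compact_operator_bounded_clinear[OF schatten_class_compact[OF T]]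
  obtain B where B: "singular_system T B" "(\<lambda>v. norm (T v) powr p) summable_on B"
    "schatten_sum p T = (\<Sum>\<^sub>\<infinity>v\<in>B. norm (T v) powr p)"
    by (rule schatten_class_singular_system[OF T])
  show ?thesis unfolding B(3)
  proof (rule sum_le_infsum_of_card_le[where \<phi> = "\<lambda>x. x powr p" and f = "\<lambda>v. norm (T v)"
        and s = "\<lambda>i. max 0 (norm (R (v i)) - \<delta>)"])
    fix \<epsilon> :: real assume \<epsilon>: "0 < \<epsilon>"
    let ?G = "{v\<in>B. \<epsilon> \<le> norm (T v)}"
    show fin: "finite ?G" by (rule singular_system_finite[OF B(1) \<epsilon>])
    have "{i\<in>J. \<epsilon> \<le> max 0 (norm (R (v i)) - \<delta>)} = {i\<in>J. \<epsilon> + \<delta> \<le> norm (R (v i))}"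
      using \<epsilon> by auto
    also have "card \<dots> \<le> card (Q ` ?G)"
    proof (rule card_large_singular_values_le[OF R J])
      fix x assume x: "x \<noteq> 0" "\<forall>g\<in>Q ` ?G. cinner x g = 0"
      have "norm (T (P x)) < \<epsilon> * norm x"
      proof (cases "P x = 0")
        case True
        then show ?thesis using x \<epsilon> by (simp add: bounded_clinear_zero[OF Tb])
      next
        case False
        have "norm (T (P x)) < \<epsilon> * norm (P x)"
          by (rule singular_system_small[OF B(1) \<epsilon> False]) (use x(2) in \<open>simp add: P(1)\<close>)
        also have "\<dots> \<le> \<epsilon> * norm x" using \<epsilon> P(2) by (intro mult_left_mono) auto
        finally show ?thesis .
      qed
      then show "norm (R x) < (\<epsilon> + \<delta>) * norm x" using RT[of x] by (simp add: distrib_right)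
    qed (use \<epsilon> \<delta> fin v in auto)
    also have "\<dots> \<le> card ?G" by (rule card_image_le[OF fin])
    finally show "card {i\<in>J. \<epsilon> \<le> max 0 (norm (R (v i)) - \<delta>)} \<le> card ?G" .
  qed (use J B p in \<open>auto intro: powr_mono2\<close>)
qed

text \<open>A vector orthogonal to the singular vectors of S and of c T at level \<epsilon>
  satisfies |R x| < 2 \<epsilon> |x|, so the count of R at level 2 \<epsilon> is at most the sum of
  the two counts. Halving the singular values of R costs the factor 2^p; this crude bound only has
  to dominate the circle integrand.\<close>

lemma schatten_class_add_scaled:
  fixes S T :: "'a::chilbert_space \<Rightarrow> 'a"
  assumes S: "S \<in> schatten_class p" and T: "T \<in> schatten_class p" and p: "0 < p"
  shows "(\<lambda>x. S x + c *\<^sub>C T x) \<in> schatten_class p"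
    and "schatten_sum p (\<lambda>x. S x + c *\<^sub>C T x) \<le> 2 powr p * (schatten_sum p S + cmod c powr p * schatten_sum p T)"
proof -
  define R where "R = (\<lambda>x. S x + c *\<^sub>C T x)"
  have Rc: "compact_operator R"
    unfolding R_def using S T
    by (intro compact_operator_plus compact_operator_scaled) (auto simp: schatten_class_def)
  note Rb = compact_operator_bounded_clinear[OF Rc]
  obtain B where B: "singular_system S B" "(\<lambda>v. norm (S v) powr p) summable_on B"
    "schatten_sum p S = (\<Sum>\<^sub>\<infinity>v\<in>B. norm (S v) powr p)"
    by (rule schatten_class_singular_system[OF S])
  obtain C where C: "singular_system T C" "(\<lambda>v. norm (T v) powr p) summable_on C"
    "schatten_sum p T = (\<Sum>\<^sub>\<infinity>v\<in>C. norm (T v) powr p)"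
    by (rule schatten_class_singular_system[OF T])
  obtain D where D: "singular_system R D" using singular_system_exists[OF Rc] by blast
  \<comment> \<open>A disjoint sum, since a vector belonging to both B and C has to be counted
    twice.\<close>
  define V where "V = Inl ` B \<union> Inr ` C"
  define f :: "'a + 'a \<Rightarrow> real" where "f = case_sum (\<lambda>v. norm (S v)) (\<lambda>v. cmod c * norm (T v))"
  have f1: "(\<lambda>v. f v powr p) summable_on Inl ` B" "(\<Sum>\<^sub>\<infinity>v\<in>Inl ` B. f v powr p) = schatten_sum p S"
    using B(2,3) by (simp_all add: summable_on_reindex infsum_reindex comp_def f_def)
  have scaled: "(\<lambda>v. (cmod c * norm (T v)) powr p) = (\<lambda>v. cmod c powr p * norm (T v) powr p)"
    by (intro ext powr_mult)
  have f2: "(\<lambda>v. f v powr p) summable_on Inr ` C" "(\<Sum>\<^sub>\<infinity>v\<in>Inr ` C. f v powr p) = cmod c powr p * schatten_sum p T"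
    using C(2,3)
    by (simp_all add: summable_on_reindex infsum_reindex comp_def f_def scaled summable_on_cmult_right
        infsum_cmult_right)
  have fV: "(\<lambda>v. f v powr p) summable_on V"
    unfolding V_def by (rule summable_on_Un_disjoint[OF f1(1) f2(1)]) auto
  have fV': "(\<Sum>\<^sub>\<infinity>v\<in>V. f v powr p) = schatten_sum p S + cmod c powr p * schatten_sum p T"
    unfolding V_def by (subst infsum_Un_disjoint[OF f1(1) f2(1)]) (auto simp: f1(2) f2(2))
  have fin: "(\<Sum>v\<in>J. norm (R v) powr p) \<le> 2 powr p * (schatten_sum p S + cmod c powr p * schatten_sum p T)"
    if J: "finite J" "J \<subseteq> D" for J
  proof -
    have "(\<Sum>v\<in>J. (norm (R v) / 2) powr p) \<le> (\<Sum>\<^sub>\<infinity>v\<in>V. f v powr p)"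
    proof (rule sum_le_infsum_of_card_le[where \<phi> = "\<lambda>x. x powr p"])
      fix \<epsilon> :: real assume \<epsilon>: "0 < \<epsilon>"
      let ?B = "{v\<in>B. \<epsilon> \<le> norm (S v)}" and ?C = "{v\<in>C. \<epsilon> \<le> cmod c * norm (T v)}"
      have Vs: "{v\<in>V. \<epsilon> \<le> f v} = Inl ` ?B \<union> Inr ` ?C" by (auto simp: V_def f_def)
      have fB: "finite ?B" by (rule singular_system_finite[OF B(1) \<epsilon>])
      have fC: "finite ?C"
      proof (cases "c = 0")
        case False
        then have "?C = {v\<in>C. \<epsilon> / cmod c \<le> norm (T v)}" by (auto simp: field_simps)
        then show ?thesis using singular_system_finite[OF C(1), of "\<epsilon> / cmod c"] False \<epsilon> by simp
      qed (use \<epsilon> in simp)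
      show "finite {v\<in>V. \<epsilon> \<le> f v}" unfolding Vs using fB fC by simp
      have "{v\<in>J. \<epsilon> \<le> norm (R v) / 2} = {v\<in>J. 2 * \<epsilon> \<le> norm (R v)}" by auto
      also have "card \<dots> \<le> card (?B \<union> ?C)"
      proof (rule card_large_singular_values_le[OF Rb J(1)])
        fix x assume x: "x \<noteq> 0" "\<forall>g\<in>?B \<union> ?C. cinner x g = 0"
        have 1: "norm (S x) < \<epsilon> * norm x"
          by (rule singular_system_small[OF B(1) \<epsilon> x(1)]) (use x(2) in simp)
        have 2: "cmod c * norm (T x) \<le> \<epsilon> * norm x"
        proof (cases "c = 0")
          case False
          have "norm (T x) < \<epsilon> / cmod c * norm x"
          proof (rule singular_system_small[OF C(1) _ x(1)])
            fix v assume "v \<in> C" "\<epsilon> / cmod c \<le> norm (T v)"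
            then have "v \<in> ?C" using False by (simp add: field_simps)
            then show "cinner x v = 0" using x(2) by blast
          qed (use False \<epsilon> in simp)
          then show ?thesis using False by (simp add: field_simps)
        qed (use \<epsilon> in simp)
        have "norm (R x) \<le> norm (S x) + cmod c * norm (T x)"
          unfolding R_def using norm_triangle_ineq[of "S x" "c *\<^sub>C T x"] by simp
        then show "norm (R x) < 2 * \<epsilon> * norm x" using 1 2 by simp
      next
        show "norm v = 1" if "v \<in> J" for v using that J D by (auto simp: singular_system_def orthonormal_def)
        show "cinner v w = 0" "cinner (R v) (R w) = 0" if "v \<in> J" "w \<in> J" "v \<noteq> w" for v w
          using singular_system_orthogonal[OF Rb D, of v w] that J by auto
      qed (use fB fC \<epsilon> in auto)
      also have "\<dots> \<le> card ?B + card ?C" by (rule card_Un_le)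
      also have "\<dots> = card {v\<in>V. \<epsilon> \<le> f v}"
        unfolding Vs using fB fC by (subst card_Un_disjoint) (auto simp: card_image)
      finally show "card {v\<in>J. \<epsilon> \<le> norm (R v) / 2} \<le> card {v\<in>V. \<epsilon> \<le> f v}" .
    qed (use J fV p in \<open>auto intro: powr_mono2 simp: V_def f_def\<close>)
    moreover have "(norm (R v) / 2) powr p = norm (R v) powr p / 2 powr p" for v
      by (simp add: powr_divide)
    ultimately show ?thesis
      unfolding fV' by (simp add: sum_divide_distrib[symmetric] divide_le_eq mult.commute)
  qed
  have sum: "(\<lambda>v. norm (R v) powr p) summable_on D"
    by (rule nonneg_bdd_above_summable_on) (use fin in \<open>auto intro!: bdd_aboveI\<close>)
  then show "(\<lambda>x. S x + c *\<^sub>C T x) \<in> schatten_class p"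
    using Rc singular_system_summable_iff(1)[OF D, of p] by (simp add: schatten_class_def R_def)
  show "schatten_sum p (\<lambda>x. S x + c *\<^sub>C T x) \<le> 2 powr p * (schatten_sum p S + cmod c powr p * schatten_sum p T)"
    unfolding R_def[symmetric] singular_system_summable_iff(2)[OF D]
    by (rule infsum_le_finite_sums[OF sum fin])
qed

text \<open>Of the singular system only a finite orthonormal family with orthogonal images is kept;
  this much persists under compression to a subspace containing the family and its images.\<close>

lemma schatten_sum_lower_approx:
  fixes T :: "'a::chilbert_space \<Rightarrow> 'a"
  assumes T: "T \<in> schatten_class p" and "c < schatten_sum p T"
  obtains F where "finite F" "orthonormal F" "\<And>v w. v \<in> F \<Longrightarrow> w \<in> F \<Longrightarrow> v \<noteq> w \<Longrightarrow> cinner (T v) (T w) = 0"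
    "c < (\<Sum>v\<in>F. norm (T v) powr p)"
proof -
  obtain B where B: "singular_system T B" "(\<lambda>v. norm (T v) powr p) summable_on B"
    "schatten_sum p T = (\<Sum>\<^sub>\<infinity>v\<in>B. norm (T v) powr p)"
    by (rule schatten_class_singular_system[OF T])
  have "\<exists>F. finite F \<and> F \<subseteq> B \<and> c < (\<Sum>v\<in>F. norm (T v) powr p)"
  proof (rule ccontr)
    assume "\<not> ?thesis"
    then have "(\<Sum>\<^sub>\<infinity>v\<in>B. norm (T v) powr p) \<le> c"
      by (intro infsum_le_finite_sums[OF B(2)]) (auto simp: not_less)
    then show False using assms(2) B(3) by simp
  qed
  then obtain F where F: "finite F" "F \<subseteq> B" "c < (\<Sum>v\<in>F. norm (T v) powr p)" by blast
  show ?thesis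
  proof (rule that[OF F(1) _ _ F(3)])
    have "orthonormal B" using B(1) by (simp add: singular_system_def)
    then show "orthonormal F" using F(2) by (simp add: orthonormal_def subset_iff)
    fix v w assume "v \<in> F" "w \<in> F" "v \<noteq> w"
    then show "cinner (T v) (T w) = 0"
      using singular_system_orthogonal(2)[OF compact_operator_bounded_clinear[OF schatten_class_compact[OF T]] B(1)]
        F(2) by blast
  qed
qed

text \<open>Provides measurability of the circle integrand. A finite family that witnesses the bound
  at z0 still does so at nearby z after every singular value is lowered by \<delta>, because the
  operators differ by at most \<delta> in norm.\<close>

lemma schatten_sum_lower_semicontinuous:
  fixes S T :: "'a::chilbert_space \<Rightarrow> 'a"
  assumes S: "S \<in> schatten_class p" and T: "T \<in> schatten_class p" and p: "0 < p"
  shows "open {z. c < schatten_sum p (\<lambda>x. S x + z *\<^sub>C T x)}"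
proof (rule openI)
  fix z0 assume "z0 \<in> {z. c < schatten_sum p (\<lambda>x. S x + z *\<^sub>C T x)}"
  define R where "R = (\<lambda>z x. S x + z *\<^sub>C T x)"
  have R: "R z \<in> schatten_class p" for z unfolding R_def by (rule schatten_class_add_scaled[OF S T p])
  note Rb = compact_operator_bounded_clinear[OF schatten_class_compact[OF R]]
  have Tb: "bounded_linear T"
    by (intro bounded_clinear_bounded_linear compact_operator_bounded_clinear schatten_class_compact[OF T])
  have "c < schatten_sum p (R z0)"
    using \<open>z0 \<in> _\<close> by (simp add: R_def)
  then obtain F where F: "finite F" "orthonormal F"
    "\<And>v w. v \<in> F \<Longrightarrow> w \<in> F \<Longrightarrow> v \<noteq> w \<Longrightarrow> cinner (R z0 v) (R z0 w) = 0"
    "c < (\<Sum>v\<in>F. norm (R z0 v) powr p)"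
    using schatten_sum_lower_approx[OF R] by metis
  \<comment> \<open>The witnessing sum with singular values lowered by \<delta>; its continuity at 0
    supplies a positive \<delta> for which it still exceeds c.\<close>
  define h where "h \<delta> = (\<Sum>v\<in>F. max 0 (norm (R z0 v) - \<delta>) powr p)" for \<delta> :: real
  have "isCont h 0"
    unfolding h_def using p by (intro continuous_intros) auto
  then have "(h \<longlongrightarrow> h 0) (at 0)" by (simp add: isCont_def)
  moreover have "c < h 0" using F(4) by (simp add: h_def max_def)
  ultimately have "\<forall>\<^sub>F \<delta> in at 0. c < h \<delta>" by (rule order_tendstoD)
  then obtain d where d: "0 < d" "\<And>\<delta>. \<delta> \<noteq> 0 \<Longrightarrow> dist \<delta> 0 < d \<Longrightarrow> c < h \<delta>"
    unfolding eventually_at by blast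
  define \<delta> where "\<delta> = d / 2"
  have \<delta>: "0 < \<delta>" "c < h \<delta>" using d by (auto simp: \<delta>_def)
  define K where "K = onorm T + 1"
  have K: "0 < K" using onorm_pos_le[OF Tb] by (simp add: K_def)
  have "ball z0 (\<delta> / K) \<subseteq> {z. c < schatten_sum p (\<lambda>x. S x + z *\<^sub>C T x)}"
  proof
    fix z assume "z \<in> ball z0 (\<delta> / K)"
    then have z: "cmod (z0 - z) * K \<le> \<delta>" using K by (simp add: dist_norm field_simps)
    have "norm (R z0 x) \<le> norm (R z x) + \<delta> * norm x" for x
    proof -
      have "R z0 x = R z x + (z0 - z) *\<^sub>C T x"
        by (simp add: R_def complex_vector.scale_left_diff_distrib)
      then have "norm (R z0 x) \<le> norm (R z x) + cmod (z0 - z) * norm (T x)"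
        using norm_triangle_ineq[of "R z x" "(z0 - z) *\<^sub>C T x"] by simp
      also have "cmod (z0 - z) * norm (T x) \<le> cmod (z0 - z) * (K * norm x)"
      proof (rule mult_left_mono)
        have "norm (T x) \<le> onorm T * norm x + 1 * norm x"
          using onorm[OF Tb, of x] norm_ge_zero[of x] by linarith
        then show "norm (T x) \<le> K * norm x" by (simp only: K_def distrib_right)
      qed simp
      also have "\<dots> \<le> \<delta> * norm x" using mult_right_mono[OF z, of "norm x"] by (simp add: mult.assoc)
      finally show ?thesis by simp
    qed
    then have "h \<delta> \<le> schatten_sum p (R z)"
      unfolding h_def using \<delta> F
      by (intro sum_le_schatten_sum[OF R p Rb, where P = "\<lambda>x. x" and Q = "\<lambda>x. x"])
        (auto simp: orthonormal_def)
    then show "z \<in> {z. c < schatten_sum p (\<lambda>x. S x + z *\<^sub>C T x)}" using \<delta> by (simp add: R_def)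
  qed
  then show "\<exists>e>0. ball z0 e \<subseteq> {z. c < schatten_sum p (\<lambda>x. S x + z *\<^sub>C T x)}"
    using \<delta> K by (intro exI[of _ "\<delta> / K"]) auto
qed

subsection \<open>Complex matrices\<close>

definition adj :: "complex Matrix.mat \<Rightarrow> complex Matrix.mat" where
  "adj A = Matrix.mat (dim_col A) (dim_row A) (\<lambda>(i, j). cnj (A $$ (j, i)))"

definition unitary_mat :: "nat \<Rightarrow> complex Matrix.mat \<Rightarrow> bool" where
  "unitary_mat n U \<longleftrightarrow> U \<in> carrier_mat n n \<and> adj U * U = 1\<^sub>m n"

definition diagm :: "nat \<Rightarrow> (nat \<Rightarrow> real) \<Rightarrow> complex Matrix.mat" where
  "diagm n s = Matrix.mat n n (\<lambda>(i, j). if i = j then complex_of_real (s i) else 0)"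

definition gram :: "nat \<Rightarrow> real \<Rightarrow> complex Matrix.mat \<Rightarrow> complex Matrix.mat" where
  "gram n l T = complex_of_real l \<cdot>\<^sub>m 1\<^sub>m n + adj T * T"

definition frob2 :: "nat \<Rightarrow> complex Matrix.mat \<Rightarrow> real" where
  "frob2 n A = (\<Sum>i<n. \<Sum>j<n. (cmod (A $$ (i, j)))\<^sup>2)"

lemma adj_carrier [simp]: "A \<in> carrier_mat m n \<Longrightarrow> adj A \<in> carrier_mat n m"
  by (auto simp: adj_def)

lemma adj_index [simp]: "A \<in> carrier_mat m n \<Longrightarrow> i < n \<Longrightarrow> j < m \<Longrightarrow> adj A $$ (i, j) = cnj (A $$ (j, i))"
  by (auto simp: adj_def)

lemma diagm_carrier [simp]: "diagm n s \<in> carrier_mat n n"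
  by (simp add: diagm_def)

lemma diagm_index [simp]: "i < n \<Longrightarrow> j < n \<Longrightarrow> diagm n s $$ (i, j) = (if i = j then complex_of_real (s i) else 0)"
  by (simp add: diagm_def)

lemma gram_carrier [simp]: "T \<in> carrier_mat n n \<Longrightarrow> gram n l T \<in> carrier_mat n n"
  unfolding gram_def by (intro add_carrier_mat mult_carrier_mat[of _ n n] adj_carrier)

lemma mult_mat_index:
  "A \<in> carrier_mat n n \<Longrightarrow> B \<in> carrier_mat n n \<Longrightarrow> i < n \<Longrightarrow> j < n \<Longrightarrow>
    (A * B) $$ (i, j) = (\<Sum>k<n. A $$ (i, k) * B $$ (k, j))"
  by (auto simp: scalar_prod_def atLeast0LessThan intro!: sum.cong)

lemma mat_eqI:
  assumes "A \<in> carrier_mat n n" "B \<in> carrier_mat n n" "\<And>i j. i < n \<Longrightarrow> j < n \<Longrightarrow> A $$ (i, j) = B $$ (i, j)"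
  shows "A = B"
  using assms by (intro eq_matI) auto

lemma adj_adj: "A \<in> carrier_mat n n \<Longrightarrow> adj (adj A) = A"
  by (rule mat_eqI[of _ n]) (auto simp: adj_index[of _ n n])

lemma adj_mult:
  assumes A: "A \<in> carrier_mat n n" and B: "B \<in> carrier_mat n n"
  shows "adj (A * B) = adj B * adj A"
proof (rule mat_eqI[of _ n])
  note c = mult_carrier_mat[OF A B] mult_carrier_mat[OF adj_carrier[OF B] adj_carrier[OF A]]
  show "adj (A * B) \<in> carrier_mat n n" "adj B * adj A \<in> carrier_mat n n" using c by simp_all
  fix i j assume ij: "i < n" "j < n"
  show "adj (A * B) $$ (i, j) = (adj B * adj A) $$ (i, j)"
    unfolding adj_index[OF c(1) ij] mult_mat_index[OF A B ij(2,1)]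
      mult_mat_index[OF adj_carrier[OF B] adj_carrier[OF A] ij] cnj_sum complex_cnj_mult
    using A B ij by (intro sum.cong refl) (simp add: adj_index[of _ n n])
qed

lemma det_adj:
  assumes A: "A \<in> carrier_mat n n"
  shows "Determinant.det (adj A) = cnj (Determinant.det A)"
proof -
  have "Determinant.det (adj A) = (\<Sum>p | p permutes {0..<n}. of_int (sign p) * (\<Prod>i = 0..<n. adj A $$ (i, p i)))"
    by (rule det_def'[OF adj_carrier[OF A]])
  also have "\<dots> = (\<Sum>p | p permutes {0..<n}. of_int (sign p) * (\<Prod>i = 0..<n. cnj (transpose_mat A $$ (i, p i))))"
  proof (intro sum.cong refl arg_cong2[where f = "(*)"] prod.cong)
    fix p i assume "p \<in> {p. p permutes {0..<n}}" "i \<in> {0..<n}"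
    then have "i < n" "p i < n" using permutes_in_image[of p "{0..<n}" i] by auto
    then show "adj A $$ (i, p i) = cnj (transpose_mat A $$ (i, p i))" using A by (simp add: adj_index[of _ n n])
  qed
  also have "\<dots> = cnj (Determinant.det (transpose_mat A))"
    using A by (subst det_def'[of _ n]) simp_all
  finally show ?thesis by (simp add: det_transpose[OF A])
qed

lemma det_diagm: "Determinant.det (diagm n s) = (\<Prod>i<n. complex_of_real (s i))"
proof -
  have "upper_triangular (diagm n s)" by (auto simp: diagm_def)
  from det_upper_triangular[OF this diagm_carrier] show ?thesis
    by (auto simp: diag_mat_def prod.list_conv_set_nth diagm_def atLeast0LessThan intro!: prod.cong)
qed

lemma gram_index:
  assumes T: "T \<in> carrier_mat n n" and ij: "i < n" "j < n"
  shows "gram n l T $$ (i, j) = (if i = j then complex_of_real l else 0) + (\<Sum>k<n. cnj (T $$ (k, i)) * T $$ (k, j))"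
proof -
  have "(adj T * T) $$ (i, j) = (\<Sum>k<n. cnj (T $$ (k, i)) * T $$ (k, j))"
    unfolding mult_mat_index[OF adj_carrier[OF T] T ij] using T ij by (intro sum.cong refl) (simp add: adj_index[of _ n n])
  then show ?thesis
    using ij carrier_matD[OF mult_carrier_mat[OF adj_carrier[OF T] T]]
    by (simp add: gram_def del: index_mult_mat)
qed

lemma gram_diagm: "gram n l (diagm n s) = diagm n (\<lambda>i. l + (s i)\<^sup>2)"
proof (rule mat_eqI[of _ n])
  fix i j assume ij: "i < n" "j < n"
  have "(\<Sum>k<n. cnj (diagm n s $$ (k, i)) * diagm n s $$ (k, j))
      = (\<Sum>k<n. if k = i then (if i = j then complex_of_real ((s i)\<^sup>2) else 0) else 0)"
    using ij by (intro sum.cong refl) (auto simp: power2_eq_square)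
  then show "gram n l (diagm n s) $$ (i, j) = diagm n (\<lambda>i. l + (s i)\<^sup>2) $$ (i, j)"
    using ij by (simp add: gram_index[OF diagm_carrier ij])
qed simp_all

section \<open>Unitary invariance of gram determinants and of the Frobenius norm\<close>

lemma unitary_mat_right: "unitary_mat n U \<Longrightarrow> U * adj U = 1\<^sub>m n"
  using mat_mult_left_right_inverse[of "adj U" n U] by (auto simp: unitary_mat_def)

lemma det_unitary: "unitary_mat n U \<Longrightarrow> Determinant.det (adj U) * Determinant.det U = 1"
  using det_mult[of "adj U" n U] by (auto simp: unitary_mat_def)

lemma gram_unitary_left:
  assumes U: "unitary_mat n U" and M: "M \<in> carrier_mat n n"
  shows "gram n l (U * M) = gram n l M"
proof -
  have Uc: "U \<in> carrier_mat n n" and UU: "adj U * U = 1\<^sub>m n" using U by (simp_all add: unitary_mat_def)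
  have "adj (U * M) * (U * M) = adj M * adj U * (U * M)" by (simp add: adj_mult[OF Uc M])
  also have "\<dots> = adj M * (adj U * (U * M))"
    using Uc M by (intro assoc_mult_mat[of _ n n _ n _ n]) simp_all
  also have "adj U * (U * M) = adj U * U * M"
    using Uc M by (intro assoc_mult_mat[of _ n n _ n _ n, symmetric]) simp_all
  finally show ?thesis using M by (simp add: gram_def UU)
qed

text \<open>A unitary factor on the left cancels inside the gram matrix; one on the right conjugates
  the gram matrix, which leaves the determinant unchanged.\<close>

lemma det_gram_unitary_right:
  assumes V: "unitary_mat n V" and M: "M \<in> carrier_mat n n"
  shows "Determinant.det (gram n l (M * adj V)) = Determinant.det (gram n l M)"
proof -
  have Vc: "V \<in> carrier_mat n n" using V by (simp add: unitary_mat_def)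
  note Va = adj_carrier[OF Vc] and Ma = adj_carrier[OF M]
  have 1: "adj (M * adj V) * (M * adj V) = V * (adj M * M) * adj V"
  proof -
    have "adj (M * adj V) * (M * adj V) = V * adj M * (M * adj V)"
      by (simp add: adj_mult[OF M Va] adj_adj[OF Vc])
    also have "\<dots> = V * (adj M * (M * adj V))"
      by (rule assoc_mult_mat[OF Vc Ma mult_carrier_mat[OF M Va]])
    also have "adj M * (M * adj V) = adj M * M * adj V" by (rule assoc_mult_mat[OF Ma M Va, symmetric])
    also have "V * (adj M * M * adj V) = V * (adj M * M) * adj V"
      by (rule assoc_mult_mat[OF Vc mult_carrier_mat[OF Ma M] Va, symmetric])
    finally show ?thesis .
  qed
  have 2: "complex_of_real l \<cdot>\<^sub>m 1\<^sub>m n = V * (complex_of_real l \<cdot>\<^sub>m 1\<^sub>m n) * adj V"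
  proof -
    have "V * (complex_of_real l \<cdot>\<^sub>m 1\<^sub>m n) = complex_of_real l \<cdot>\<^sub>m V"
      using mult_smult_distrib[OF Vc one_carrier_mat] Vc by simp
    then show ?thesis
      using mult_smult_assoc_mat[OF Vc Va] unitary_mat_right[OF V] by simp
  qed
  have "gram n l (M * adj V) = V * gram n l M * adj V"
  proof -
    let ?I = "complex_of_real l \<cdot>\<^sub>m 1\<^sub>m n :: complex Matrix.mat" and ?K = "adj M * M"
    have I: "?I \<in> carrier_mat n n" by simp
    have K: "?K \<in> carrier_mat n n" by (rule mult_carrier_mat[OF Ma M])
    have "V * (?I + ?K) * adj V = (V * ?I + V * ?K) * adj V"
      by (simp only: mult_add_distrib_mat[OF Vc I K])
    also have "\<dots> = V * ?I * adj V + V * ?K * adj V"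
      by (rule add_mult_distrib_mat[OF mult_carrier_mat[OF Vc I] mult_carrier_mat[OF Vc K] Va])
    finally show ?thesis unfolding gram_def 1 by (simp only: 2[symmetric])
  qed
  moreover have "V * gram n l M \<in> carrier_mat n n" using Vc M by (intro mult_carrier_mat[of _ n n]) simp_all
  ultimately have "Determinant.det (gram n l (M * adj V))
      = Determinant.det V * Determinant.det (gram n l M) * Determinant.det (adj V)"
    using det_mult[of "V * gram n l M" n "adj V"] det_mult[of V n "gram n l M"] Vc Va M by simp
  also have "\<dots> = (Determinant.det (adj V) * Determinant.det V) * Determinant.det (gram n l M)"
    by (simp only: mult_ac)
  finally show ?thesis by (simp add: det_unitary[OF V])
qed

lemma det_gram_unitary:
  assumes "unitary_mat n U" "unitary_mat n V" "M \<in> carrier_mat n n"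
  shows "Determinant.det (gram n l (U * M * adj V)) = Determinant.det (gram n l M)"
proof -
  have "U \<in> carrier_mat n n" "V \<in> carrier_mat n n" using assms by (simp_all add: unitary_mat_def)
  then have "U * M \<in> carrier_mat n n" using assms by (intro mult_carrier_mat[of _ n n])
  from det_gram_unitary_right[OF assms(2) this] show ?thesis by (simp add: gram_unitary_left[OF assms(1,3)])
qed

text \<open>The trace form of the Frobenius norm. It reduces left unitary invariance to
  \<open>gram_unitary_left\<close>; the right one follows by taking adjoints.\<close>

lemma frob2_gram:
  assumes "A \<in> carrier_mat n n"
  shows "complex_of_real (frob2 n A) = (\<Sum>j<n. gram n 0 A $$ (j, j))"
proof -
  have "(\<Sum>j<n. gram n 0 A $$ (j, j)) = (\<Sum>j<n. \<Sum>k<n. cnj (A $$ (k, j)) * A $$ (k, j))"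
    using gram_index[OF assms, of _ _ 0] by (intro sum.cong refl) simp
  also have "\<dots> = (\<Sum>j<n. \<Sum>k<n. complex_of_real ((cmod (A $$ (k, j)))\<^sup>2))"
    by (intro sum.cong refl) (simp add: complex_norm_square mult.commute del: of_real_power)
  also have "\<dots> = complex_of_real (frob2 n A)"
    unfolding frob2_def by (subst sum.swap) simp
  finally show ?thesis by simp
qed

lemma frob2_adj:
  assumes "A \<in> carrier_mat n n"
  shows "frob2 n (adj A) = frob2 n A"
  unfolding frob2_def by (subst sum.swap, intro sum.cong refl) (use assms in \<open>simp add: adj_index[of _ n n]\<close>)

lemma frob2_unitary_left:
  assumes "unitary_mat n U" "A \<in> carrier_mat n n"
  shows "frob2 n (U * A) = frob2 n A"
proof -
  have "U * A \<in> carrier_mat n n" using assms by (intro mult_carrier_mat[of _ n n]) (simp_all add: unitary_mat_def)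
  then have "complex_of_real (frob2 n (U * A)) = complex_of_real (frob2 n A)"
    using assms by (simp only: frob2_gram gram_unitary_left)
  then show ?thesis using of_real_eq_iff by blast
qed

lemma frob2_unitary:
  assumes U: "unitary_mat n U" and V: "unitary_mat n V" and A: "A \<in> carrier_mat n n"
  shows "frob2 n (U * A * adj V) = frob2 n A"
proof -
  have c: "U * A \<in> carrier_mat n n" "V \<in> carrier_mat n n"
    using assms mult_carrier_mat[of U n n A n] by (simp_all add: unitary_mat_def)
  have "frob2 n (U * A * adj V) = frob2 n (adj (U * A * adj V))"
    by (intro frob2_adj[symmetric] mult_carrier_mat[OF c(1) adj_carrier[OF c(2)]])
  also have "adj (U * A * adj V) = V * adj (U * A)"
    by (simp only: adj_mult[OF c(1) adj_carrier[OF c(2)]] adj_adj[OF c(2)])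
  also have "frob2 n \<dots> = frob2 n (U * A)"
    by (simp only: frob2_unitary_left[OF V adj_carrier[OF c(1)]] frob2_adj[OF c(1)])
  finally show ?thesis using frob2_unitary_left[OF U A] by simp
qed

lemma frob2_diagm: "frob2 n (diagm n s) = (\<Sum>i<n. (s i)\<^sup>2)"
proof -
  have "frob2 n (diagm n s) = (\<Sum>i<n. \<Sum>j<n. if j = i then (s i)\<^sup>2 else 0)"
    unfolding frob2_def by (intro sum.cong refl) auto
  then show ?thesis by simp
qed

lemma frob2_nonneg: "0 \<le> frob2 n A"
  unfolding frob2_def by (intro sum_nonneg) simp

text \<open>No order is imposed on s, which enters only through sums, products and bounds on single
  entries.\<close>

definition is_svd :: "nat \<Rightarrow> complex Matrix.mat \<Rightarrow> complex Matrix.mat \<Rightarrow> (nat \<Rightarrow> real) \<Rightarrow> complex Matrix.mat \<Rightarrow> bool" where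
  "is_svd n A U s V \<longleftrightarrow> unitary_mat n U \<and> unitary_mat n V \<and> (\<forall>i<n. 0 \<le> s i) \<and> A = U * diagm n s * adj V"

lemma is_svd_det_gram:
  assumes "is_svd n A U s V"
  shows "Determinant.det (gram n l A) = complex_of_real (\<Prod>i<n. l + (s i)\<^sup>2)"
  using assms det_gram_unitary[of n U V "diagm n s" l]
  by (simp add: is_svd_def gram_diagm det_diagm)

lemma is_svd_frob2: "is_svd n A U s V \<Longrightarrow> frob2 n A = (\<Sum>i<n. (s i)\<^sup>2)"
  using frob2_unitary[of n U V "diagm n s"] by (simp add: is_svd_def frob2_diagm)

text \<open>Cauchy-Schwarz in each row: the Hilbert-Schmidt norm dominates the operator
  norm.\<close>

lemma norm_mult_vec_le:
  fixes a :: "nat \<Rightarrow> nat \<Rightarrow> complex"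
  shows "(\<Sum>i<n. (cmod (\<Sum>k<n. a i k * v k))\<^sup>2) \<le> (\<Sum>i<n. \<Sum>k<n. (cmod (a i k))\<^sup>2) * (\<Sum>k<n. (cmod (v k))\<^sup>2)"
  unfolding sum_distrib_right
proof (rule sum_mono)
  fix i
  have "(cmod (\<Sum>k<n. a i k * v k))\<^sup>2 \<le> (\<Sum>k<n. cmod (a i k) * cmod (v k))\<^sup>2"
    by (intro power_mono order.trans[OF norm_sum]) (simp_all add: norm_mult)
  also have "\<dots> \<le> (\<Sum>k<n. (cmod (a i k))\<^sup>2) * (\<Sum>k<n. (cmod (v k))\<^sup>2)"
    by (rule Cauchy_Schwarz_ineq_sum)
  finally show "(cmod (\<Sum>k<n. a i k * v k))\<^sup>2 \<le> (\<Sum>k<n. (cmod (a i k))\<^sup>2 * (\<Sum>k<n. (cmod (v k))\<^sup>2))"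
    by (simp only: sum_distrib_right)
qed

section \<open>Perturbations of the identity matrix\<close>

definition one_plus :: "nat \<Rightarrow> complex \<Rightarrow> complex Matrix.mat \<Rightarrow> complex Matrix.mat" where
  "one_plus n w L = Matrix.mat n n (\<lambda>(i, j). (if i = j then 1 else 0) + w * L $$ (i, j))"

lemma one_plus_carrier [simp]: "one_plus n w L \<in> carrier_mat n n"
  by (simp add: one_plus_def)

text \<open>A kernel vector satisfies v = - w L v, and L is bounded by its Frobenius norm, so |v| <
  |v| unless v = 0.\<close>

lemma det_one_plus_nonzero:
  assumes L: "L \<in> carrier_mat n n" and small: "cmod w * sqrt (frob2 n L) < 1"
  shows "Determinant.det (one_plus n w L) \<noteq> 0"
proof
  assume "Determinant.det (one_plus n w L) = 0"
  then obtain v where v: "v \<in> carrier_vec n" "v \<noteq> 0\<^sub>v n" "one_plus n w L *\<^sub>v v = 0\<^sub>v n"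
    using det_0_iff_vec_prod_zero_field[OF one_plus_carrier] by blast
  have eq: "v $ i = - w * (\<Sum>k<n. L $$ (i, k) * v $ k)" if i: "i < n" for i
  proof -
    have "(one_plus n w L *\<^sub>v v) $ i = (\<Sum>k<n. ((if i = k then 1 else 0) + w * L $$ (i, k)) * v $ k)"
      using v(1) i by (auto simp: scalar_prod_def one_plus_def atLeast0LessThan intro!: sum.cong)
    also have "\<dots> = (\<Sum>k<n. (if k = i then v $ i else 0) + w * (L $$ (i, k) * v $ k))"
      by (intro sum.cong refl) (auto simp: algebra_simps)
    also have "\<dots> = v $ i + w * (\<Sum>k<n. L $$ (i, k) * v $ k)"
      using i by (simp add: sum.distrib sum_distrib_left)
    finally have "v $ i + w * (\<Sum>k<n. L $$ (i, k) * v $ k) = 0" using v(3) i by simp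
    then show ?thesis by (simp add: add_eq_0_iff2)
  qed
  define N where "N = (\<Sum>i<n. (cmod (v $ i))\<^sup>2)"
  have "N = (cmod w)\<^sup>2 * (\<Sum>i<n. (cmod (\<Sum>k<n. L $$ (i, k) * v $ k))\<^sup>2)"
    unfolding N_def sum_distrib_left
    by (intro sum.cong refl, subst eq) (simp_all add: norm_mult power_mult_distrib)
  also have "\<dots> \<le> (cmod w)\<^sup>2 * (frob2 n L * N)"
    unfolding frob2_def N_def by (intro mult_left_mono norm_mult_vec_le) simp
  also have "\<dots> = (cmod w * sqrt (frob2 n L))\<^sup>2 * N"
    by (simp add: power_mult_distrib frob2_nonneg)
  finally have le: "N \<le> (cmod w * sqrt (frob2 n L))\<^sup>2 * N" .
  have "\<exists>i<n. v $ i \<noteq> 0"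
  proof (rule ccontr)
    assume "\<not> ?thesis"
    then have "v = 0\<^sub>v n" using v(1) by (intro eq_vecI) auto
    then show False using v(2) by simp
  qed
  then obtain i where i: "i < n" "v $ i \<noteq> 0" by blast
  have "0 < (cmod (v $ i))\<^sup>2" using i by simp
  also have "\<dots> \<le> N" unfolding N_def using i by (intro member_le_sum) auto
  finally have "0 < N" .
  moreover have "(cmod w * sqrt (frob2 n L))\<^sup>2 < 1"
    using small by (intro power_less_one_iff[THEN iffD2]) (auto simp: frob2_nonneg)
  ultimately have "(cmod w * sqrt (frob2 n L))\<^sup>2 * N < 1 * N" by (intro mult_strict_right_mono)
  then show False using le by simp
qed

text \<open>Triangle inequality and submultiplicativity of the Frobenius norm. Applied to a product
  Z (1 + w L) = Y it bounds Z from below by Y, so no estimate of the inverse of 1 + w L is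
  required.\<close>

lemma sqrt_frob2_mult_one_plus_le:
  assumes Z: "Z \<in> carrier_mat n n" and L: "L \<in> carrier_mat n n"
  shows "sqrt (frob2 n (Z * one_plus n w L)) \<le> sqrt (frob2 n Z) * (1 + cmod w * sqrt (frob2 n L))"
proof -
  let ?P = "{..<n} \<times> {..<n}"
  \<comment> \<open>The Frobenius norm as an l^2 norm over index pairs, which makes Minkowski's
    inequality applicable.\<close>
  have L2: "sqrt (frob2 n A) = L2_set (\<lambda>(i, j). cmod (A $$ (i, j))) ?P" for A
    unfolding frob2_def L2_set_def by (simp add: sum.cartesian_product case_prod_beta)
  define K where "K i j = (\<Sum>k<n. Z $$ (i, k) * L $$ (k, j))" for i j
  have ent: "(Z * one_plus n w L) $$ (i, j) = Z $$ (i, j) + w * K i j" if ij: "i < n" "j < n" for i j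
  proof -
    have "(Z * one_plus n w L) $$ (i, j) = (\<Sum>k<n. Z $$ (i, k) * ((if k = j then 1 else 0) + w * L $$ (k, j)))"
      unfolding mult_mat_index[OF Z one_plus_carrier ij] using ij by (intro sum.cong refl) (simp add: one_plus_def)
    also have "\<dots> = (\<Sum>k<n. (if k = j then Z $$ (i, j) else 0) + w * (Z $$ (i, k) * L $$ (k, j)))"
      by (intro sum.cong refl) (auto simp: algebra_simps)
    finally show ?thesis using ij by (simp add: sum.distrib sum_distrib_left K_def)
  qed
  have "sqrt (frob2 n (Z * one_plus n w L)) = L2_set (\<lambda>(i, j). cmod (Z $$ (i, j) + w * K i j)) ?P"
    unfolding L2 by (intro L2_set_cong refl) (auto simp: ent)
  also have "\<dots> \<le> L2_set (\<lambda>x. (case x of (i, j) \<Rightarrow> cmod (Z $$ (i, j))) + (case x of (i, j) \<Rightarrow> cmod w * cmod (K i j))) ?P"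
    by (intro L2_set_mono) (auto intro: order.trans[OF norm_triangle_ineq] simp: norm_mult)
  also have "\<dots> \<le> sqrt (frob2 n Z) + L2_set (\<lambda>(i, j). cmod w * cmod (K i j)) ?P"
    unfolding L2 by (rule L2_set_triangle_ineq)
  also have "L2_set (\<lambda>(i, j). cmod w * cmod (K i j)) ?P = cmod w * L2_set (\<lambda>(i, j). cmod (K i j)) ?P"
    by (subst L2_set_right_distrib) (auto intro!: L2_set_cong)
  finally have "sqrt (frob2 n (Z * one_plus n w L))
    \<le> sqrt (frob2 n Z) + cmod w * L2_set (\<lambda>(i, j). cmod (K i j)) ?P" .
  moreover
  have "L2_set (\<lambda>(i, j). cmod (K i j)) ?P \<le> sqrt (frob2 n Z) * sqrt (frob2 n L)"
  proof -
    have "(\<Sum>i<n. \<Sum>j<n. (cmod (K i j))\<^sup>2) = (\<Sum>i<n. \<Sum>j<n. (cmod (\<Sum>k<n. L $$ (k, j) * Z $$ (i, k)))\<^sup>2)"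
      by (simp add: K_def mult.commute)
    also have "\<dots> \<le> (\<Sum>i<n. (\<Sum>j<n. \<Sum>k<n. (cmod (L $$ (k, j)))\<^sup>2) * (\<Sum>k<n. (cmod (Z $$ (i, k)))\<^sup>2))"
      by (intro sum_mono norm_mult_vec_le)
    also have "\<dots> = (\<Sum>j<n. \<Sum>k<n. (cmod (L $$ (k, j)))\<^sup>2) * frob2 n Z"
      by (simp add: frob2_def sum_distrib_left)
    also have "(\<Sum>j<n. \<Sum>k<n. (cmod (L $$ (k, j)))\<^sup>2) = frob2 n L"
      unfolding frob2_def by (rule sum.swap)
    finally have "sqrt (\<Sum>i<n. \<Sum>j<n. (cmod (K i j))\<^sup>2) \<le> sqrt (frob2 n L * frob2 n Z)" by simp
    then show ?thesis
      by (simp add: L2_set_def sum.cartesian_product case_prod_beta real_sqrt_mult mult.commute)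
  qed
  from mult_left_mono[OF this norm_ge_zero[of w]]
  have "cmod w * L2_set (\<lambda>(i, j). cmod (K i j)) ?P \<le> cmod w * (sqrt (frob2 n Z) * sqrt (frob2 n L))" .
  ultimately show ?thesis by (simp add: algebra_simps)
qed

subsection \<open>Singular value decomposition\<close>

definition frame :: "nat \<Rightarrow> (nat \<Rightarrow> 'a::chilbert_space) \<Rightarrow> bool" where
  "frame n e \<longleftrightarrow> (\<forall>i<n. \<forall>j<n. cinner (e i) (e j) = (if i = j then 1 else 0))"

text \<open>The matrix acts on the span of e and vanishes on its orthogonal complement. Matrices of
  every size thus act on the one space and inherit the spectral theory of compact operators.\<close>

definition op_mat :: "nat \<Rightarrow> (nat \<Rightarrow> 'a::chilbert_space) \<Rightarrow> complex Matrix.mat \<Rightarrow> 'a \<Rightarrow> 'a" where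
  "op_mat n e A x = (\<Sum>i<n. \<Sum>j<n. (A $$ (i, j) * cinner x (e j)) *\<^sub>C e i)"

lemma frame_norm: "frame n e \<Longrightarrow> i < n \<Longrightarrow> norm (e i) = 1"
proof -
  assume "frame n e" "i < n"
  then have "cinner (e i) (e i) = 1" by (simp add: frame_def)
  then have "complex_of_real ((norm (e i))\<^sup>2) = complex_of_real 1" by (simp add: cinner_self)
  then have "(norm (e i))\<^sup>2 = 1" using of_real_eq_iff by blast
  then show ?thesis by (simp add: power2_eq_1_iff) (use norm_ge_zero[of "e i"] in linarith)
qed

lemma frame_inj: "frame n e \<Longrightarrow> inj_on e {..<n}"
proof (rule inj_onI)
  fix i j assume *: "frame n e" "i \<in> {..<n}" "j \<in> {..<n}" "e i = e j"
  have "cinner (e j) (e j) = 1" using *(1,3) by (simp add: frame_def)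
  then have "cinner (e i) (e j) = 1" using *(4) by simp
  moreover have "cinner (e i) (e j) = (if i = j then 1 else 0)" using *(1-3) by (simp add: frame_def)
  ultimately show "i = j" by (metis zero_neq_one)
qed

lemma frame_orthonormal: "frame n e \<Longrightarrow> orthonormal (e ` {..<n})"
  unfolding orthonormal_def by (auto simp: frame_norm) (auto simp: frame_def)

lemma frame_of_bij:
  assumes "orthonormal B" "bij_betw b {..<n} B"
  shows "frame n b"
  unfolding frame_def
proof (intro allI impI)
  fix i j assume ij: "i < n" "j < n"
  then have B: "b i \<in> B" "b j \<in> B" using assms(2) by (auto simp: bij_betw_def)
  have n: "norm (b i) = 1" using assms(1) B by (simp add: orthonormal_def)
  have "b i = b j \<longleftrightarrow> i = j" using assms(2) ij by (auto simp: bij_betw_def inj_on_def)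
  then show "cinner (b i) (b j) = (if i = j then 1 else 0)"
    using assms(1) B n by (auto simp: orthonormal_def cinner_self)
qed

lemma frame_expansion:
  assumes "frame n e" "x \<in> complex_vector.span (e ` {..<n})"
  shows "x = (\<Sum>i<n. cinner x (e i) *\<^sub>C e i)"
proof -
  have "x = (\<Sum>v\<in>e ` {..<n}. cinner x v *\<^sub>C v)"
    by (rule orthonormal_expansion[OF _ frame_orthonormal[OF assms(1)] assms(2)]) simp
  then show ?thesis by (simp add: sum.reindex[OF frame_inj[OF assms(1)]])
qed

lemma frame_parseval:
  assumes "frame n e" "x \<in> complex_vector.span (e ` {..<n})"
  shows "(\<Sum>i<n. cinner y (e i) * cnj (cinner x (e i))) = cinner y x"
  using arg_cong[OF frame_expansion[OF assms], of "cinner y"]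
  by (simp add: cinner_sum_right cinner_scaleC_right mult.commute)

text \<open>A maximal orthonormal extension within the span is a basis of it, and comparing
  dimensions gives it n elements.\<close>

lemma frame_extension:
  fixes e :: "nat \<Rightarrow> 'a::chilbert_space"
  assumes e: "frame n e" and B: "orthonormal B" "B \<subseteq> complex_vector.span (e ` {..<n})"
  obtains C where "B \<subseteq> C" "C \<subseteq> complex_vector.span (e ` {..<n})" "orthonormal C" "finite C" "card C = n"
    "complex_vector.span C = complex_vector.span (e ` {..<n})"
proof -
  let ?E = "complex_vector.span (e ` {..<n})"
  obtain C where C: "B \<subseteq> C" "C \<subseteq> ?E" "orthonormal C" "\<And>x. x \<in> ?E \<Longrightarrow> \<forall>v\<in>C. cinner x v = 0 \<Longrightarrow> norm x \<noteq> 1"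
    using maximal_orthonormal_extension[OF B] by blast
  have fin: "finite C" using card_orthonormal_le[OF _ C(3,2)] by simp
  have span: "complex_vector.span C = ?E"
    by (rule span_maximal_orthonormal[OF complex_vector.subspace_span fin C(3,2,4)])
  have "card C = complex_vector.dim (complex_vector.span C)"
    by (rule complex_vector.dim_span_eq_card_independent[OF orthonormal_independent[OF fin C(3)], symmetric])
  also have "\<dots> = card (e ` {..<n})"
    unfolding span
    by (intro complex_vector.dim_span_eq_card_independent orthonormal_independent frame_orthonormal[OF e]) simp
  also have "\<dots> = n" by (simp add: card_image[OF frame_inj[OF e]])
  finally show ?thesis using that C fin span by blast
qed

lemma op_mat_alt: "op_mat n e A x = (\<Sum>i<n. (\<Sum>j<n. A $$ (i, j) * cinner x (e j)) *\<^sub>C e i)"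
  unfolding op_mat_def by (simp add: complex_vector.scale_sum_left)

lemma op_mat_span: "op_mat n e A x \<in> complex_vector.span (e ` {..<n})"
  unfolding op_mat_alt
  by (intro complex_vector.span_sum complex_vector.span_scale complex_vector.span_base) auto

lemma compact_operator_op_mat: "compact_operator (op_mat n e A)"
proof -
  have "compact_operator (\<lambda>x. \<Sum>i<n. \<Sum>j<n. A $$ (i, j) *\<^sub>C (cinner x (e j) *\<^sub>C e i))"
    by (intro compact_operator_sum compact_operator_scaled compact_operator_rank_one)
  then show ?thesis by (simp add: op_mat_def[abs_def] scaleC_scaleC)
qed

lemma cinner_op_mat:
  "cinner (op_mat n e A x) y = (\<Sum>i<n. \<Sum>j<n. A $$ (i, j) * cinner x (e j) * cinner (e i) y)"
  by (simp add: op_mat_def cinner_sum_left cinner_scaleC_left)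

lemma op_mat_entry:
  assumes "frame n e" "i < n" "j < n"
  shows "cinner (op_mat n e A (e j)) (e i) = A $$ (i, j)"
proof -
  have "cinner (op_mat n e A (e j)) (e i)
    = (\<Sum>k<n. \<Sum>l<n. if l = j then (if k = i then A $$ (i, j) else 0) else 0)"
    unfolding cinner_op_mat by (intro sum.cong refl) (use assms in \<open>auto simp: frame_def\<close>)
  then show ?thesis using assms by simp
qed

lemma cadjoint_op_mat:
  assumes "A \<in> carrier_mat n n"
  shows "cadjoint (op_mat n e A) = op_mat n e (adj A)"
proof (rule cadjoint_eqI)
  fix x y
  have "cinner (op_mat n e A x) y = (\<Sum>i<n. \<Sum>j<n. A $$ (i, j) * cinner x (e j) * cinner (e i) y)"
    by (rule cinner_op_mat)
  also have "\<dots> = (\<Sum>j<n. \<Sum>i<n. A $$ (i, j) * cinner x (e j) * cinner (e i) y)"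
    by (rule sum.swap)
  also have "\<dots> = (\<Sum>j<n. \<Sum>i<n. cnj (adj A $$ (j, i) * cinner y (e i)) * cinner x (e j))"
    using assms by (intro sum.cong refl)
      (simp add: adj_index[of _ n n] cinner_commute[of _ y] mult_ac)
  also have "\<dots> = cinner x (op_mat n e (adj A) y)"
    by (simp add: op_mat_def cinner_sum_right cinner_scaleC_right)
  finally show "cinner (op_mat n e A x) y = cinner x (op_mat n e (adj A) y)" .
qed

lemma unitary_mat_of_frames:
  assumes e: "frame n e" and v: "frame n v" "\<And>k. k < n \<Longrightarrow> v k \<in> complex_vector.span (e ` {..<n})"
  shows "unitary_mat n (Matrix.mat n n (\<lambda>(i, k). cinner (v k) (e i)))"
proof -
  let ?V = "Matrix.mat n n (\<lambda>(i, k). cinner (v k) (e i))"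
  have c: "?V \<in> carrier_mat n n" by simp
  have "adj ?V * ?V = 1\<^sub>m n"
  proof (rule mat_eqI[of _ n])
    show "adj ?V * ?V \<in> carrier_mat n n" by (rule mult_carrier_mat[OF adj_carrier[OF c] c])
    fix i j assume ij: "i < n" "j < n"
    have "(adj ?V * ?V) $$ (i, j) = (\<Sum>k<n. cinner (v j) (e k) * cnj (cinner (v i) (e k)))"
      unfolding mult_mat_index[OF adj_carrier[OF c] c ij]
      using ij by (intro sum.cong refl) (simp add: adj_index[OF c] mult.commute)
    also have "\<dots> = cinner (v j) (v i)" by (rule frame_parseval[OF e v(2)[OF ij(1)]])
    finally show "(adj ?V * ?V) $$ (i, j) = 1\<^sub>m n $$ (i, j)" using v(1) ij by (simp add: frame_def)
  qed simp
  then show ?thesis by (simp add: unitary_mat_def)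
qed

text \<open>Finite rank: the normalised images of a singular system are orthonormal in the span of
  the frame, so the system is finite.\<close>

lemma schatten_class_op_mat:
  assumes "frame n e"
  shows "op_mat n e A \<in> schatten_class p"
proof -
  note Tc = compact_operator_op_mat[of n e A]
  obtain B where B: "singular_system (op_mat n e A) B" using singular_system_exists[OF Tc] by blast
  note Tb = compact_operator_bounded_clinear[OF Tc]
  let ?u = "\<lambda>v. complex_of_real (inverse (norm (op_mat n e A v))) *\<^sub>C op_mat n e A v"
  have nz: "op_mat n e A v \<noteq> 0" if "v \<in> B" for v using B that by (simp add: singular_system_def)
  have orth: "cinner (?u v) (?u w) = 0" if "v \<in> B" "w \<in> B" "v \<noteq> w" for v w
    using singular_system_orthogonal(2)[OF Tb B that] by (simp add: cinner_scaleC_left cinner_scaleC_right)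
  have n1: "norm (?u v) = 1" if "v \<in> B" for v
    using nz[OF that] by (simp add: norm_scaleC norm_inverse del: of_real_inverse)
  have inj: "inj_on ?u B"
  proof (rule inj_onI, rule ccontr)
    fix v w assume vw: "v \<in> B" "w \<in> B" "?u v = ?u w" "v \<noteq> w"
    then have "cinner (?u v) (?u v) = 0" using orth[of v w] by simp
    then show False using n1[OF vw(1)] by (simp add: cinner_self)
  qed
  have "orthonormal (?u ` B)"
    unfolding orthonormal_def
  proof (intro conjI ballI impI)
    fix x y assume "x \<in> ?u ` B" "y \<in> ?u ` B" "x \<noteq> y"
    then show "cinner x y = 0" using orth by blast
  qed (use n1 in blast)
  moreover have "?u ` B \<subseteq> complex_vector.span (e ` {..<n})"
    by (intro image_subsetI complex_vector.span_scale op_mat_span)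
  ultimately have "finite (?u ` B)" using card_orthonormal_le[of "e ` {..<n}"] by blast
  then have "finite B" using inj by (simp add: finite_image_iff)
  then show ?thesis
    using Tc singular_system_summable_iff(1)[OF B, of p] by (simp add: schatten_class_def)
qed

text \<open>A singular system of the operator is completed to a basis C of the span and its
  normalised images to a basis D; in these bases the matrix is diagonal. The point is that one
  family s yields both the gram determinants, through \<open>is_svd\<close>, and the Schatten sums
  of the operator.\<close>

theorem svd_exists:
  fixes e :: "nat \<Rightarrow> 'a::chilbert_space"
  assumes e: "frame n e" and A: "A \<in> carrier_mat n n"
  shows "\<exists>U s V. is_svd n A U s V \<and> (\<forall>p>0. schatten_sum p (op_mat n e A) = (\<Sum>i<n. s i powr p))
    \<and> (\<forall>i<n. s i \<le> onorm (op_mat n e A))"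
proof -
  let ?E = "complex_vector.span (e ` {..<n})"
  define T where "T = op_mat n e A"
  have Tc: "compact_operator T" unfolding T_def by (rule compact_operator_op_mat)
  note Tb = compact_operator_bounded_clinear[OF Tc]
  have TE: "T x \<in> ?E" for x unfolding T_def by (rule op_mat_span)
  obtain B where B: "singular_system T B" using singular_system_exists[OF Tc] by blast
  have Bo: "orthonormal B" using B by (simp add: singular_system_def)
  have nz: "T v \<noteq> 0" if "v \<in> B" for v using B that by (simp add: singular_system_def)
  \<comment> \<open>An eigenvector for a nonzero eigenvalue lies in the range of the adjoint, which
    is contained in the span.\<close>
  have BE: "B \<subseteq> ?E"
  proof
    fix v assume v: "v \<in> B"
    then have "v \<in> singular_eigenspace T (norm (T v))" using B by (simp add: singular_system_def)
    then have eq: "cadjoint T (T v) = complex_of_real ((norm (T v))\<^sup>2) *\<^sub>C v"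
      by (simp only: singular_eigenspace_def mem_Collect_eq)
    have "cadjoint T (T v) \<in> ?E" unfolding T_def cadjoint_op_mat[OF A] by (rule op_mat_span)
    then have "complex_of_real (inverse ((norm (T v))\<^sup>2)) *\<^sub>C cadjoint T (T v) \<in> ?E"
      by (rule complex_vector.span_scale)
    moreover have "complex_of_real (inverse ((norm (T v))\<^sup>2)) * complex_of_real ((norm (T v))\<^sup>2) = 1"
      using nz[OF v] by (simp only: of_real_mult[symmetric]) simp
    ultimately show "v \<in> ?E" by (simp only: eq scaleC_scaleC) simp
  qed
  obtain C where C: "B \<subseteq> C" "C \<subseteq> ?E" "orthonormal C" "finite C" "card C = n" "complex_vector.span C = ?E"
    by (rule frame_extension[OF e Bo BE])
  have fB: "finite B" using C(1,4) by (rule finite_subset)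
  \<comment> \<open>The smallness clause of \<open>singular_system\<close> at level |T v| would give
    |T v| < |T v|.\<close>
  have zero: "T v = 0" if "v \<in> C" "v \<notin> B" for v
  proof (rule ccontr)
    assume "T v \<noteq> 0"
    have v1: "norm v = 1" using C(3) that by (simp add: orthonormal_def)
    have "norm (T v) < norm (T v) * norm v"
    proof (rule singular_system_small[OF B])
      show "0 < norm (T v)" using \<open>T v \<noteq> 0\<close> by simp
      show "v \<noteq> 0" using v1 by auto
      fix w assume "w \<in> B"
      then have "w \<in> C" "v \<noteq> w" using C(1) that by auto
      then show "cinner v w = 0" using C(3) that by (simp add: orthonormal_def)
    qed
    then show False using v1 by simp
  qed
  define u where "u v = complex_of_real (inverse (norm (T v))) *\<^sub>C T v" for v
  have u_orth: "cinner (u v) (u w) = 0" if "v \<in> B" "w \<in> B" "v \<noteq> w" for v w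
    using singular_system_orthogonal(2)[OF Tb B that] by (simp add: u_def cinner_scaleC_left cinner_scaleC_right)
  have u1: "norm (u v) = 1" if "v \<in> B" for v
    using nz[OF that] unfolding u_def norm_scaleC norm_of_real by simp
  have u_inj: "inj_on u B"
  proof (rule inj_onI, rule ccontr)
    fix v w assume vw: "v \<in> B" "w \<in> B" "u v = u w" "v \<noteq> w"
    then have "cinner (u v) (u v) = 0" using u_orth[of v w] by simp
    then show False using u1[OF vw(1)] by (simp add: cinner_self)
  qed
  have uo: "orthonormal (u ` B)"
    unfolding orthonormal_def
  proof (intro conjI ballI impI)
    fix x y assume "x \<in> u ` B" "y \<in> u ` B" "x \<noteq> y"
    then show "cinner x y = 0" using u_orth by blast
  qed (use u1 in blast)
  have uE: "u ` B \<subseteq> ?E" unfolding u_def by (intro image_subsetI complex_vector.span_scale TE)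
  obtain D where D: "u ` B \<subseteq> D" "D \<subseteq> ?E" "orthonormal D" "finite D" "card D = n" "complex_vector.span D = ?E"
    by (rule frame_extension[OF e uo uE])
  have "card (C - B) = card (D - u ` B)"
    using C D fB by (simp add: card_Diff_subset card_image[OF u_inj])
  then obtain h where h: "bij_betw h (C - B) (D - u ` B)"
    using finite_same_card_bij[of "C - B" "D - u ` B"] C(4) D(4) by auto
  \<comment> \<open>Sends right to left singular vectors; where T vanishes, any bijection of the
    remaining basis vectors will do.\<close>
  define g where "g v = (if v \<in> B then u v else h v)" for v
  have "bij_betw g (B \<union> (C - B)) (u ` B \<union> (D - u ` B))"
  proof (rule bij_betw_combine)
    show "bij_betw g B (u ` B)"
      using u_inj by (subst bij_betw_cong[of B g u]) (auto simp: g_def bij_betw_def)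
    show "bij_betw g (C - B) (D - u ` B)"
      using h by (subst bij_betw_cong[of "C - B" g h]) (auto simp: g_def)
  qed auto
  moreover have "B \<union> (C - B) = C" "u ` B \<union> (D - u ` B) = D" using C(1) D(1) by auto
  ultimately have g: "bij_betw g C D" by simp
  obtain b where b: "bij_betw b {..<n} C"
    using finite_same_card_bij[of "{..<n}" C] C(4,5) by auto
  define s where "s k = norm (T (b k))" for k
  have bC: "b k \<in> C" if "k < n" for k using b that by (auto simp: bij_betw_def)
  have b1: "norm (b k) = 1" if "k < n" for k using C(3) bC[OF that] by (simp add: orthonormal_def)
  have Tb_eq: "T (b k) = complex_of_real (s k) *\<^sub>C g (b k)" if "k < n" for k
  proof (cases "b k \<in> B")
    case True
    have "complex_of_real (s k) * complex_of_real (inverse (norm (T (b k)))) = 1"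
      using nz[OF True] by (simp only: of_real_mult[symmetric] s_def) simp
    then show ?thesis using True by (simp only: g_def u_def scaleC_scaleC if_True) simp
  next
    case False
    then show ?thesis using zero[OF bC[OF that]] by (simp add: s_def)
  qed
  have fb: "frame n b" by (rule frame_of_bij[OF C(3) b])
  have fg: "frame n (\<lambda>k. g (b k))"
    using frame_of_bij[OF D(3) bij_betw_trans[OF b g]] by (simp add: comp_def)
  have gD: "g (b k) \<in> D" if "k < n" for k using g bC[OF that] by (auto simp: bij_betw_def)
  define V where "V = Matrix.mat n n (\<lambda>(i, k). cinner (b k) (e i))"
  define U where "U = Matrix.mat n n (\<lambda>(i, k). cinner (g (b k)) (e i))"
  have V: "unitary_mat n V" unfolding V_def by (rule unitary_mat_of_frames[OF e fb]) (use bC C(2) in blast)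
  have U: "unitary_mat n U" unfolding U_def by (rule unitary_mat_of_frames[OF e fg]) (use gD D(2) in blast)
  have Vc: "V \<in> carrier_mat n n" and Uc: "U \<in> carrier_mat n n" by (simp_all add: V_def U_def)
  have "A = U * diagm n s * adj V"
  proof (rule mat_eqI[OF A])
    have UD: "U * diagm n s \<in> carrier_mat n n" by (rule mult_carrier_mat[OF Uc diagm_carrier])
    show "U * diagm n s * adj V \<in> carrier_mat n n" by (rule mult_carrier_mat[OF UD adj_carrier[OF Vc]])
    fix i j assume ij: "i < n" "j < n"
    have img: "b ` {..<n} = C" using b by (simp add: bij_betw_def)
    have "e j \<in> complex_vector.span (b ` {..<n})"
      unfolding img C(6) using ij by (intro complex_vector.span_base) auto
    from frame_expansion[OF fb this]
    have "T (e j) = T (\<Sum>k<n. cinner (e j) (b k) *\<^sub>C b k)" by simp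
    also have "\<dots> = (\<Sum>k<n. cinner (e j) (b k) *\<^sub>C T (b k))"
      by (simp add: bounded_clinear_sum[OF Tb] bounded_clinear_scaleC[OF Tb])
    also have "\<dots> = (\<Sum>k<n. (cinner (e j) (b k) * complex_of_real (s k)) *\<^sub>C g (b k))"
      by (intro sum.cong refl) (simp add: Tb_eq scaleC_scaleC)
    finally have "A $$ (i, j) = (\<Sum>k<n. cinner (e j) (b k) * complex_of_real (s k) * cinner (g (b k)) (e i))"
      using op_mat_entry[OF e ij, of A] by (simp add: T_def cinner_sum_left cinner_scaleC_left)
    also have "\<dots> = (\<Sum>k<n. (U * diagm n s) $$ (i, k) * adj V $$ (k, j))"
    proof (intro sum.cong refl)
      fix k assume "k \<in> {..<n}"
      then have k: "k < n" by simp
      have "(U * diagm n s) $$ (i, k) = (\<Sum>l<n. if l = k then U $$ (i, k) * complex_of_real (s k) else 0)"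
        unfolding mult_mat_index[OF Uc diagm_carrier ij(1) k] using k by (intro sum.cong refl) auto
      also have "\<dots> = cinner (g (b k)) (e i) * complex_of_real (s k)" using k ij by (simp add: U_def)
      finally have "(U * diagm n s) $$ (i, k) = cinner (g (b k)) (e i) * complex_of_real (s k)" .
      moreover have "adj V $$ (k, j) = cinner (e j) (b k)"
        unfolding adj_index[OF Vc k ij(2)] using k ij by (simp add: V_def cinner_commute[of "e j"])
      ultimately show "cinner (e j) (b k) * complex_of_real (s k) * cinner (g (b k)) (e i)
          = (U * diagm n s) $$ (i, k) * adj V $$ (k, j)" by (simp only: mult_ac)
    qed
    also have "\<dots> = (U * diagm n s * adj V) $$ (i, j)"
      by (rule mult_mat_index[OF UD adj_carrier[OF Vc] ij, symmetric])
    finally show "A $$ (i, j) = (U * diagm n s * adj V) $$ (i, j)" .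
  qed
  then have svd: "is_svd n A U s V" using U V by (simp add: is_svd_def s_def)
  have "schatten_sum p T = (\<Sum>i<n. s i powr p)" if "0 < p" for p
  proof -
    have "schatten_sum p T = (\<Sum>v\<in>B. norm (T v) powr p)"
      using singular_system_summable_iff(2)[OF B, of p] fB by simp
    also have "\<dots> = (\<Sum>v\<in>C. norm (T v) powr p)"
      by (rule sum.mono_neutral_left[OF C(4,1)]) (use zero in auto)
    also have "\<dots> = (\<Sum>i<n. norm (T (b i)) powr p)"
      by (rule sum.reindex_bij_betw[OF b, symmetric])
    finally show ?thesis by (simp add: s_def)
  qed
  moreover have "s i \<le> onorm T" if "i < n" for i
    using onorm[OF bounded_clinear_bounded_linear[OF Tb], of "b i"] b1[OF that] by (simp add: s_def)
  ultimately show ?thesis using svd unfolding T_def by blast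
qed

subsection \<open>Local subharmonicity of the logarithmic determinant\<close>

lemma one_plus_sum_le_prod:
  fixes f :: "nat \<Rightarrow> real"
  assumes "\<And>i. i < n \<Longrightarrow> 0 \<le> f i"
  shows "1 + (\<Sum>i<n. f i) \<le> (\<Prod>i<n. 1 + f i)"
  using assms
proof (induction n)
  case (Suc n)
  have "1 + (\<Sum>i<Suc n. f i) \<le> (1 + (\<Sum>i<n. f i)) * (1 + f n)"
    using mult_nonneg_nonneg[OF sum_nonneg, of "{..<n}" f "f n"] Suc.prems by (simp add: algebra_simps)
  also have "\<dots> \<le> (\<Prod>i<n. 1 + f i) * (1 + f n)"
    using Suc by (intro mult_right_mono) (auto intro: add_nonneg_nonneg)
  finally show ?case by simp
qed simp

text \<open>In terms of the singular values of r Z the determinant is the product of the 1 + s_i^2,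
  and \<open>frob2\<close> is the sum of squares.\<close>

lemma det_one_plus_square_ge:
  assumes "\<exists>U s V. is_svd n (complex_of_real r \<cdot>\<^sub>m Z) U s V" and Z: "Z \<in> carrier_mat n n"
  shows "1 + r\<^sup>2 * frob2 n Z \<le> Re (Determinant.det (gram n 1 (complex_of_real r \<cdot>\<^sub>m Z)))"
proof -
  obtain U s V where svd: "is_svd n (complex_of_real r \<cdot>\<^sub>m Z) U s V" using assms by blast
  have "r\<^sup>2 * frob2 n Z = frob2 n (complex_of_real r \<cdot>\<^sub>m Z)"
    using Z by (simp add: frob2_def norm_mult power_mult_distrib sum_distrib_left)
  also have "\<dots> = (\<Sum>i<n. (s i)\<^sup>2)" by (rule is_svd_frob2[OF svd])
  also have "1 + \<dots> \<le> (\<Prod>i<n. 1 + (s i)\<^sup>2)" by (rule one_plus_sum_le_prod) simp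
  also have "\<dots> = Re (Determinant.det (gram n 1 (complex_of_real r \<cdot>\<^sub>m Z)))"
    by (simp only: is_svd_det_gram[OF svd] Re_complex_of_real)
  finally show ?thesis by simp
qed

text \<open>Conjugating by the square root of \<open>X = l + diag (s\<^sub>i\<^sup>2)\<close> completes the square:
  \<open>l + T\<^sup>* T\<close> becomes \<open>(1 + w L)\<^sup>* (1 + w L) + |w|\<^sup>2 Y\<^sup>* Y\<close>.\<close>

lemma gram_perturbed_diagonal:
  fixes s :: "nat \<Rightarrow> real"
  assumes B: "B \<in> carrier_mat n n" and l: "0 < l"
  defines "x \<equiv> \<lambda>i. sqrt (l + (s i)\<^sup>2)"
  defines "L \<equiv> Matrix.mat n n (\<lambda>(i, j). complex_of_real (s i / (x i * x j)) * B $$ (i, j))"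
  defines "Y \<equiv> Matrix.mat n n (\<lambda>(i, j). complex_of_real (sqrt l / (x i * x j)) * B $$ (i, j))"
  assumes det: "Determinant.det (one_plus n w L) \<noteq> 0"
    and svd: "\<And>A. A \<in> carrier_mat n n \<Longrightarrow> \<exists>U s V. is_svd n A U s V"
  shows "(\<Prod>i<n. l + (s i)\<^sup>2) * ((cmod (Determinant.det (one_plus n w L)))\<^sup>2 *
      (1 + (cmod w)\<^sup>2 * (frob2 n Y / (1 + cmod w * sqrt (frob2 n L))\<^sup>2)))
    \<le> Re (Determinant.det (gram n l (diagm n s + w \<cdot>\<^sub>m B)))"
proof -
  let ?C = "one_plus n w L" and ?r = "complex_of_real (cmod w)"
  have Cc: "?C \<in> carrier_mat n n" by simp
  have Lc: "L \<in> carrier_mat n n" and Yc: "Y \<in> carrier_mat n n" by (simp_all add: L_def Y_def)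
  have x: "0 < x i" "(x i)\<^sup>2 = l + (s i)\<^sup>2" for i
    using l by (auto simp: x_def intro: add_pos_nonneg)
  obtain D where D: "D \<in> carrier_mat n n" "?C * D = 1\<^sub>m n" "D * ?C = 1\<^sub>m n"
    using det_non_zero_imp_unit[OF Cc det] unfolding Units_def ring_mat_def by auto
  \<comment> \<open>With C = 1 + w L and Y = Z C, the sum C^* C + |w|^2 Y^* Y factors as C^* (1 +
    |w|^2 Z^* Z) C, so |det C|^2 splits off from the determinant.\<close>
  define Z where "Z = Y * D"
  have Zc: "Z \<in> carrier_mat n n" unfolding Z_def by (rule mult_carrier_mat[OF Yc D(1)])
  have ZC: "Z * ?C = Y"
    unfolding Z_def assoc_mult_mat[OF Yc D(1) Cc] D(3) using Yc by simp
  have wZc: "?r \<cdot>\<^sub>m Z \<in> carrier_mat n n" using Zc by simp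
  let ?G = "gram n 1 (?r \<cdot>\<^sub>m Z)"
  have Gc: "?G \<in> carrier_mat n n" by (rule gram_carrier[OF wZc])
  have CGC: "adj ?C * ?G * ?C = adj ?C * ?C + adj (?r \<cdot>\<^sub>m Y) * (?r \<cdot>\<^sub>m Y)"
  proof -
    let ?W = "?r \<cdot>\<^sub>m Z"
    note Ca = adj_carrier[OF Cc] and Wa = adj_carrier[OF wZc]
    have one1: "(1::complex) \<cdot>\<^sub>m 1\<^sub>m n = 1\<^sub>m n" by (intro eq_matI) simp_all
    have WC: "?W * ?C = ?r \<cdot>\<^sub>m Y" using mult_smult_assoc_mat[OF Zc Cc] ZC by simp
    have "adj ?C * ?G = adj ?C * 1\<^sub>m n + adj ?C * (adj ?W * ?W)"
      unfolding gram_def of_real_1 one1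
      by (rule mult_add_distrib_mat[OF Ca one_carrier_mat mult_carrier_mat[OF Wa wZc]])
    then have "adj ?C * ?G = adj ?C + adj ?C * (adj ?W * ?W)" using Ca by simp
    then have "adj ?C * ?G * ?C = adj ?C * ?C + adj ?C * (adj ?W * ?W) * ?C"
      using add_mult_distrib_mat[OF Ca mult_carrier_mat[OF Ca mult_carrier_mat[OF Wa wZc]] Cc] by simp
    also have "adj ?C * (adj ?W * ?W) = adj ?C * adj ?W * ?W"
      by (rule assoc_mult_mat[OF Ca Wa wZc, symmetric])
    also have "adj ?C * adj ?W = adj (?r \<cdot>\<^sub>m Y)" by (simp only: adj_mult[OF wZc Cc, symmetric] WC)
    also have "adj (?r \<cdot>\<^sub>m Y) * ?W * ?C = adj (?r \<cdot>\<^sub>m Y) * (?W * ?C)"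
      by (rule assoc_mult_mat[OF adj_carrier[OF smult_carrier_mat[OF Yc]] wZc Cc])
    finally show ?thesis by (simp only: WC)
  qed
  have key: "gram n l (diagm n s + w \<cdot>\<^sub>m B) = diagm n x * (adj ?C * ?G * ?C) * diagm n x"
  proof (rule mat_eqI[of _ n])
    have Tc: "diagm n s + w \<cdot>\<^sub>m B \<in> carrier_mat n n" using B by simp
    show "gram n l (diagm n s + w \<cdot>\<^sub>m B) \<in> carrier_mat n n" by (rule gram_carrier[OF Tc])
    let ?H = "adj ?C * ?G * ?C"
    have Hc: "?H \<in> carrier_mat n n"
      by (intro mult_carrier_mat[OF mult_carrier_mat[OF adj_carrier[OF Cc] Gc] Cc])
    have XH: "diagm n x * ?H \<in> carrier_mat n n" by (rule mult_carrier_mat[OF diagm_carrier Hc])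
    show "diagm n x * ?H * diagm n x \<in> carrier_mat n n" by (rule mult_carrier_mat[OF XH diagm_carrier])
    fix i j assume ij: "i < n" "j < n"
    let ?y = "\<lambda>i. complex_of_real (x i)"
    have ynz: "?y i \<noteq> 0" for i using x(1)[of i] by simp
    have ysq: "?y i * ?y i = complex_of_real l + complex_of_real (s i) * complex_of_real (s i)" for i
      using x(2)[of i] by (simp only: of_real_mult[symmetric] of_real_add[symmetric] power2_eq_square)
    have lsq: "complex_of_real (sqrt l) * complex_of_real (sqrt l) = complex_of_real l"
      using l by (simp only: of_real_mult[symmetric]) simp
    have rr: "?r * ?r = w * cnj w" by (simp only: complex_norm_square[symmetric] power2_eq_square of_real_mult)
    have "(diagm n x * ?H) $$ (i, k) = ?y i * ?H $$ (i, k)" if k: "k < n" for k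
    proof -
      have "(diagm n x * ?H) $$ (i, k) = (\<Sum>m<n. if m = i then ?y i * ?H $$ (i, k) else 0)"
        unfolding mult_mat_index[OF diagm_carrier Hc ij(1) k] using ij by (intro sum.cong refl) auto
      then show ?thesis using ij by simp
    qed
    note row = this
    have "(diagm n x * ?H * diagm n x) $$ (i, j) = (\<Sum>m<n. if m = j then ?y i * ?H $$ (i, j) * ?y j else 0)"
      unfolding mult_mat_index[OF XH diagm_carrier ij] using ij row by (intro sum.cong refl) auto
    then have rhs: "(diagm n x * ?H * diagm n x) $$ (i, j) = ?y i * ?H $$ (i, j) * ?y j" using ij by simp
    have CC: "(adj ?C * ?C) $$ (i, j) = (\<Sum>k<n. cnj (?C $$ (k, i)) * ?C $$ (k, j))"
      unfolding mult_mat_index[OF adj_carrier[OF Cc] Cc ij]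
      using ij by (intro sum.cong refl) (simp add: adj_index[OF Cc])
    have rYc: "?r \<cdot>\<^sub>m Y \<in> carrier_mat n n" using Yc by simp
    have YY: "(adj (?r \<cdot>\<^sub>m Y) * (?r \<cdot>\<^sub>m Y)) $$ (i, j) = (\<Sum>k<n. ?r * ?r * (cnj (Y $$ (k, i)) * Y $$ (k, j)))"
      unfolding mult_mat_index[OF adj_carrier[OF rYc] rYc ij]
      using ij Yc by (intro sum.cong refl) (simp add: adj_index[OF rYc])
    have H: "?H $$ (i, j) = (\<Sum>k<n. cnj (?C $$ (k, i)) * ?C $$ (k, j) + ?r * ?r * (cnj (Y $$ (k, i)) * Y $$ (k, j)))"
      unfolding CGC
      using ij CC YY carrier_matD[OF mult_carrier_mat[OF adj_carrier[OF rYc] rYc]]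
      by (simp add: sum.distrib del: index_mult_mat)
    \<comment> \<open>Quadratic terms in w carry weight s_k^2 / x_k^2 from L and l / x_k^2 from Y,
      which add up to 1 because x_k^2 = l + s_k^2; this dictates the choice of Y. The scalar l of
      the gram matrix is booked in the summand k = i.\<close>
    have entry: "?y i * (cnj (?C $$ (k, i)) * ?C $$ (k, j) + ?r * ?r * (cnj (Y $$ (k, i)) * Y $$ (k, j))) * ?y j
      = (if k = i then (if i = j then complex_of_real l else 0) else 0)
        + cnj ((diagm n s + w \<cdot>\<^sub>m B) $$ (k, i)) * (diagm n s + w \<cdot>\<^sub>m B) $$ (k, j)" if k: "k < n" for k
    proof -
      define b where "b = B $$ (k, i)"
      define c where "c = B $$ (k, j)"
      define sk where "sk = complex_of_real (s k)"
      have C1: "?C $$ (k, i) = (if k = i then 1 else 0) + w * (sk / (?y k * ?y i) * b)"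
        using k ij by (simp add: one_plus_def L_def b_def sk_def)
      have C2: "?C $$ (k, j) = (if k = j then 1 else 0) + w * (sk / (?y k * ?y j) * c)"
        using k ij by (simp add: one_plus_def L_def c_def sk_def)
      have Y1: "Y $$ (k, i) = complex_of_real (sqrt l) / (?y k * ?y i) * b"
        using k ij by (simp add: Y_def b_def)
      have Y2: "Y $$ (k, j) = complex_of_real (sqrt l) / (?y k * ?y j) * c"
        using k ij by (simp add: Y_def c_def)
      have T1: "(diagm n s + w \<cdot>\<^sub>m B) $$ (k, i) = (if k = i then sk else 0) + w * b"
        using k ij B by (simp add: b_def sk_def)
      have T2: "(diagm n s + w \<cdot>\<^sub>m B) $$ (k, j) = (if k = j then sk else 0) + w * c"
        using k ij B by (simp add: c_def sk_def)
      have yk: "?y k * ?y k = complex_of_real l + sk * sk" using ysq[of k] by (simp add: sk_def)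
      have csk: "cnj sk = sk" by (simp add: sk_def)
      \<comment> \<open>Kronecker deltas as factors: on their support x_i or x_j equals x_k, so no
        case distinction on the indices is made.\<close>
      define d1 where "d1 = (if k = i then 1 else 0 :: complex)"
      define d2 where "d2 = (if k = j then 1 else 0 :: complex)"
      have d1: "d1 * ?y i = d1 * ?y k" "cnj d1 = d1" and d2: "d2 * ?y j = d2 * ?y k"
        by (auto simp: d1_def d2_def)
      have d12: "(if k = i then (if i = j then complex_of_real l else 0) else 0) = d1 * d2 * complex_of_real l"
        by (auto simp: d1_def d2_def)
      have P1: "?y i * cnj (d1 + w * (sk / (?y k * ?y i) * b)) = d1 * ?y k + cnj w * (sk / ?y k * cnj b)"
        using ynz[of i] ynz[of k] d1 csk by (simp add: distrib_left mult.commute[of "?y i"])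
      have P2: "(d2 + w * (sk / (?y k * ?y j) * c)) * ?y j = d2 * ?y k + w * (sk / ?y k * c)"
        using ynz[of j] ynz[of k] d2 by (simp add: distrib_right)
      have Q1: "?y i * cnj (complex_of_real (sqrt l) / (?y k * ?y i) * b) = complex_of_real (sqrt l) / ?y k * cnj b"
        using ynz[of i] by simp
      have Q2: "complex_of_real (sqrt l) / (?y k * ?y j) * c * ?y j = complex_of_real (sqrt l) / ?y k * c"
        using ynz[of j] by simp
      have "?y i * (cnj (?C $$ (k, i)) * ?C $$ (k, j) + ?r * ?r * (cnj (Y $$ (k, i)) * Y $$ (k, j))) * ?y j
        = (?y i * cnj (?C $$ (k, i))) * (?C $$ (k, j) * ?y j)
          + ?r * ?r * ((?y i * cnj (Y $$ (k, i))) * (Y $$ (k, j) * ?y j))"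
        by (simp only: distrib_left distrib_right mult_ac)
      also have "\<dots> = (d1 * ?y k + cnj w * (sk / ?y k * cnj b)) * (d2 * ?y k + w * (sk / ?y k * c))
          + ?r * ?r * ((complex_of_real (sqrt l) / ?y k * cnj b) * (complex_of_real (sqrt l) / ?y k * c))"
        unfolding C1 C2 Y1 Y2 d1_def[symmetric] d2_def[symmetric] P1 P2 Q1 Q2 ..
      also have "\<dots> = d1 * d2 * (?y k * ?y k) + d1 * w * sk * c + d2 * cnj w * sk * cnj b
          + w * cnj w * (sk * sk / (?y k * ?y k)) * cnj b * c
          + ?r * ?r * ((complex_of_real (sqrt l) * complex_of_real (sqrt l)) / (?y k * ?y k) * cnj b * c)"
        using ynz[of k] by (simp add: field_simps)
      also have "\<dots> = d1 * d2 * (?y k * ?y k) + d1 * w * sk * c + d2 * cnj w * sk * cnj b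
          + w * cnj w * ((complex_of_real l + sk * sk) / (?y k * ?y k)) * cnj b * c"
        unfolding lsq rr by (simp add: add_divide_distrib distrib_left distrib_right)
      also have "(complex_of_real l + sk * sk) / (?y k * ?y k) = 1"
        using ynz[of k] by (simp only: yk[symmetric]) simp
      finally have lhs: "?y i * (cnj (?C $$ (k, i)) * ?C $$ (k, j) + ?r * ?r * (cnj (Y $$ (k, i)) * Y $$ (k, j))) * ?y j
        = d1 * d2 * (complex_of_real l + sk * sk) + d1 * w * sk * c + d2 * cnj w * sk * cnj b + w * cnj w * cnj b * c"
        by (simp only: yk mult_1_right)
      have "(if k = i then sk else 0) = d1 * sk" "(if k = j then sk else 0) = d2 * sk"
        by (auto simp: d1_def d2_def)
      then show ?thesis
        unfolding lhs T1 T2 d12 by (simp add: d1 csk algebra_simps)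
    qed
    have "(diagm n x * ?H * diagm n x) $$ (i, j)
      = (\<Sum>k<n. ?y i * (cnj (?C $$ (k, i)) * ?C $$ (k, j) + ?r * ?r * (cnj (Y $$ (k, i)) * Y $$ (k, j))) * ?y j)"
      unfolding rhs H by (simp only: sum_distrib_left sum_distrib_right)
    also have "\<dots> = (\<Sum>k<n. (if k = i then (if i = j then complex_of_real l else 0) else 0)
        + cnj ((diagm n s + w \<cdot>\<^sub>m B) $$ (k, i)) * (diagm n s + w \<cdot>\<^sub>m B) $$ (k, j))"
      by (intro sum.cong refl entry) simp
    also have "\<dots> = (if i = j then complex_of_real l else 0)
        + (\<Sum>k<n. cnj ((diagm n s + w \<cdot>\<^sub>m B) $$ (k, i)) * (diagm n s + w \<cdot>\<^sub>m B) $$ (k, j))"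
      unfolding sum.distrib using ij by simp
    also have "\<dots> = gram n l (diagm n s + w \<cdot>\<^sub>m B) $$ (i, j)" by (rule gram_index[OF Tc ij, symmetric])
    finally show "gram n l (diagm n s + w \<cdot>\<^sub>m B) $$ (i, j) = (diagm n x * ?H * diagm n x) $$ (i, j)" by (rule sym)
  qed
  let ?d = "Determinant.det ?C"
  have "Determinant.det (gram n l (diagm n s + w \<cdot>\<^sub>m B))
      = Determinant.det (diagm n x) * (cnj ?d * Determinant.det ?G * ?d) * Determinant.det (diagm n x)"
  proof -
    note Ca = adj_carrier[OF Cc]
    have 1: "adj ?C * ?G \<in> carrier_mat n n" by (rule mult_carrier_mat[OF Ca Gc])
    have 2: "adj ?C * ?G * ?C \<in> carrier_mat n n" by (rule mult_carrier_mat[OF 1 Cc])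
    have 3: "diagm n x * (adj ?C * ?G * ?C) \<in> carrier_mat n n" by (rule mult_carrier_mat[OF diagm_carrier 2])
    show ?thesis
      unfolding key det_mult[OF 3 diagm_carrier] det_mult[OF diagm_carrier 2] det_mult[OF 1 Cc]
        det_mult[OF Ca Gc] det_adj[OF Cc] ..
  qed
  also have "\<dots> = complex_of_real ((\<Prod>i<n. x i)\<^sup>2 * (cmod ?d)\<^sup>2) * Determinant.det ?G"
  proof -
    have "complex_of_real ((\<Prod>i<n. x i)\<^sup>2)
        = (\<Prod>i<n. complex_of_real (x i)) * (\<Prod>i<n. complex_of_real (x i))"
      by (simp add: power2_eq_square)
    then show ?thesis
      unfolding det_diagm of_real_mult complex_norm_square by (simp only: mult_ac)
  qed
  also have "(\<Prod>i<n. x i)\<^sup>2 = (\<Prod>i<n. l + (s i)\<^sup>2)" by (simp add: prod_power_distrib x)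
  finally have det_eq: "Re (Determinant.det (gram n l (diagm n s + w \<cdot>\<^sub>m B)))
      = (\<Prod>i<n. l + (s i)\<^sup>2) * (cmod ?d)\<^sup>2 * Re (Determinant.det ?G)"
    by (simp only: Re_complex_of_real times_complex.sel complex_of_real_def complex.sel)
  have "frob2 n Y / (1 + cmod w * sqrt (frob2 n L))\<^sup>2 \<le> frob2 n Z"
  proof -
    let ?k = "1 + cmod w * sqrt (frob2 n L)"
    have k: "0 < ?k" by (intro add_pos_nonneg mult_nonneg_nonneg) (simp_all add: frob2_nonneg)
    have "sqrt (frob2 n Y) \<le> sqrt (frob2 n Z) * ?k"
      using sqrt_frob2_mult_one_plus_le[OF Zc Lc, of w] by (simp only: ZC)
    then have "(sqrt (frob2 n Y))\<^sup>2 \<le> (sqrt (frob2 n Z) * ?k)\<^sup>2" by (intro power_mono) (simp_all add: frob2_nonneg)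
    then have "frob2 n Y \<le> frob2 n Z * ?k\<^sup>2" by (simp add: frob2_nonneg power_mult_distrib)
    then show ?thesis using k by (simp add: divide_le_eq)
  qed
  then have "1 + (cmod w)\<^sup>2 * (frob2 n Y / (1 + cmod w * sqrt (frob2 n L))\<^sup>2) \<le> 1 + (cmod w)\<^sup>2 * frob2 n Z"
    by (intro add_left_mono mult_left_mono) simp_all
  also have "\<dots> \<le> Re (Determinant.det ?G)" by (rule det_one_plus_square_ge[OF svd[OF wZc] Zc])
  finally have "(\<Prod>i<n. l + (s i)\<^sup>2) * (cmod ?d)\<^sup>2 * (1 + (cmod w)\<^sup>2 * (frob2 n Y / (1 + cmod w * sqrt (frob2 n L))\<^sup>2))
      \<le> (\<Prod>i<n. l + (s i)\<^sup>2) * (cmod ?d)\<^sup>2 * Re (Determinant.det ?G)"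
    using l by (intro mult_left_mono mult_nonneg_nonneg prod_nonneg) auto
  then show ?thesis unfolding det_eq by (simp only: mult.assoc)
qed

subsection \<open>Circular means\<close>

lemma has_integral_circle_holomorphic:
  assumes h: "h holomorphic_on ball 0 R" and \<rho>: "cmod \<rho> < R"
  shows "((\<lambda>\<theta>. h (\<rho> * cis \<theta>)) has_integral (2 * pi) *\<^sub>R h 0) {0..2 * pi}"
proof -
  \<comment> \<open>Absorbs the complex radius \<rho>, possibly 0, so that Cauchy's formula is used
    on the unit circle only.\<close>
  define k where "k u = h (\<rho> * u)" for u
  have sub: "(\<lambda>u. \<rho> * u) ` cball 0 1 \<subseteq> ball 0 R"
  proof (rule image_subsetI)
    fix u :: complex assume "u \<in> cball 0 1"
    then have "cmod \<rho> * cmod u \<le> cmod \<rho>" by (simp add: mult_left_le)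
    then show "\<rho> * u \<in> ball 0 R" using \<rho> by (simp add: norm_mult)
  qed
  have "k holomorphic_on cball 0 1"
    unfolding k_def
    by (rule holomorphic_on_compose_gen[OF _ h sub, unfolded comp_def]) (intro holomorphic_intros)
  from Cauchy_integral_circlepath_simple[OF this, of 0]
  have "((\<lambda>u. k u / u) has_contour_integral 2 * of_real pi * \<i> * k 0) (part_circlepath 0 1 0 (2 * pi))"
    by (simp add: circlepath_def)
  then have "((\<lambda>t. k (cis t) / cis t * \<i> * cis t) has_integral 2 * of_real pi * \<i> * k 0) {0..2 * pi}"
    by (subst (asm) has_contour_integral_part_circlepath_iff) simp_all
  then have "((\<lambda>t. \<i> * k (cis t)) has_integral 2 * of_real pi * \<i> * k 0) {0..2 * pi}"
    by (rule has_integral_eq[rotated]) (simp add: cis_neq_zero)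
  from has_integral_mult_right[OF this, of "- \<i>"]
  have "((\<lambda>t. - \<i> * (\<i> * k (cis t))) has_integral - \<i> * (2 * of_real pi * \<i> * k 0)) {0..2 * pi}" .
  moreover have "- \<i> * (\<i> * x) = x" for x by (simp only: mult.assoc[symmetric]) simp
  moreover have "- \<i> * (2 * of_real pi * \<i> * x) = 2 * of_real pi * x" for x
    by (simp add: algebra_simps)
  ultimately have "((\<lambda>t. k (cis t)) has_integral (2 * of_real pi * k 0)) {0..2 * pi}" by (simp only:)
  then show ?thesis by (simp add: k_def scaleR_conv_of_real)
qed

text \<open>A zero-free holomorphic function on a disc has a holomorphic logarithm h, and ln |f| =
  Re h inherits the mean value property.\<close>

lemma has_integral_ln_norm_circle:
  assumes f: "f holomorphic_on ball 0 R" "\<And>z. z \<in> ball 0 R \<Longrightarrow> f z \<noteq> 0" and \<rho>: "cmod \<rho> < R"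
  shows "((\<lambda>\<theta>. ln (cmod (f (\<rho> * cis \<theta>)))) has_integral 2 * pi * ln (cmod (f 0))) {0..2 * pi}"
proof -
  have "0 < R" using \<rho> norm_ge_zero[of \<rho>] by linarith
  then have "0 \<in> ball (0::complex) R" by simp
  from holomorphic_logarithm_exists[OF convex_ball open_ball f(1) f(2) this]
  obtain h where h: "h holomorphic_on ball 0 R" "\<And>z. z \<in> ball 0 R \<Longrightarrow> exp (h z) = f z" by blast
  have re: "Re (h z) = ln (cmod (f z))" if "z \<in> ball 0 R" for z
    by (simp only: h(2)[OF that, symmetric] norm_exp_eq_Re ln_exp)
  have "((\<lambda>\<theta>. Re (h (\<rho> * cis \<theta>))) has_integral Re ((2 * pi) *\<^sub>R h 0)) {0..2 * pi}"
    by (rule has_integral_linear[OF has_integral_circle_holomorphic[OF h(1) \<rho>] bounded_linear_Re, unfolded comp_def])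
  moreover have "\<rho> * cis \<theta> \<in> ball 0 R" for \<theta> using \<rho> by (simp add: norm_mult)
  ultimately show ?thesis using re \<open>0 < R\<close> by simp
qed

text \<open>The cross term 2 Re (cnj z \<rho> cis \<theta>) has mean zero. This measures the
  subtracted quadratic in the maximum argument, settles p = 2 entrywise, and gives the main term in
  the sharpness proof.\<close>

lemma integral_circle_norm_square:
  "integral {0..2 * pi} (\<lambda>\<theta>. (cmod (z + \<rho> * cis \<theta>))\<^sup>2) = 2 * pi * ((cmod z)\<^sup>2 + (cmod \<rho>)\<^sup>2)"
proof -
  have "((\<lambda>\<theta>. 2 * (cnj z * (\<rho> * cis \<theta>))) has_integral (2 * pi) *\<^sub>R (2 * (cnj z * 0))) {0..2 * pi}"
    by (rule has_integral_circle_holomorphic[of "\<lambda>u. 2 * (cnj z * u)" "cmod \<rho> + 1"])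
      (auto intro!: holomorphic_intros)
  from has_integral_linear[OF this bounded_linear_Re]
  have 1: "((\<lambda>\<theta>. Re (2 * (cnj z * (\<rho> * cis \<theta>)))) has_integral 0) {0..2 * pi}" by (simp add: comp_def)
  have 2: "((\<lambda>\<theta>::real. (cmod z)\<^sup>2 + (cmod \<rho>)\<^sup>2) has_integral 2 * pi * ((cmod z)\<^sup>2 + (cmod \<rho>)\<^sup>2)) {0..2 * pi}"
    using has_integral_const_real[of "(cmod z)\<^sup>2 + (cmod \<rho>)\<^sup>2" 0 "2 * pi"] by simp
  have "(cmod (z + \<rho> * cis \<theta>))\<^sup>2 = Re (2 * (cnj z * (\<rho> * cis \<theta>))) + ((cmod z)\<^sup>2 + (cmod \<rho>)\<^sup>2)" for \<theta>
  proof -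
    have "(cmod (z + \<rho> * cis \<theta>))\<^sup>2 = (cmod z)\<^sup>2 + (cmod (\<rho> * cis \<theta>))\<^sup>2 + 2 * Re (cnj z * (\<rho> * cis \<theta>))"
      unfolding cmod_power2 by (simp add: power2_eq_square algebra_simps)
    then show ?thesis by (simp add: norm_mult)
  qed
  then show ?thesis using has_integral_add[OF 1 2] by (simp add: integral_unique)
qed

lemma integral_periodic_shift:
  fixes f :: "real \<Rightarrow> real"
  assumes f: "continuous_on UNIV f" and per: "\<And>x. f (x + P) = f x" and a: "0 \<le> a" "a \<le> P"
  shows "integral {0..P} (\<lambda>x. f (x + a)) = integral {0..P} f"
proof -
  have int: "f integrable_on {x..y}" for x y
    by (rule integrable_continuous_real[OF continuous_on_subset[OF f]]) simp
  have "integral {0..P} (\<lambda>x. f (x + a)) = integral {a..P + a} f"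
    using integral_shift_real_ivl[of a a "P + a" f] by simp
  also have "\<dots> = integral {a..P} f + integral {P..P + a} f"
    using a by (intro Henstock_Kurzweil_Integration.integral_combine[symmetric] int) auto
  also have "integral {P..P + a} f = integral {0..a} (\<lambda>x. f (x + P))"
    using integral_shift_real_ivl[of P P "P + a" f] by simp
  also have "(\<lambda>x. f (x + P)) = f" by (simp add: per)
  also have "integral {a..P} f + integral {0..a} f = integral {0..P} f"
    using Henstock_Kurzweil_Integration.integral_combine[OF a int] by simp
  finally show ?thesis .
qed

text \<open>The argument of z is only a shift of the periodic variable, so a rotational mean depends
  on |z| alone.\<close>

lemma integral_circle_rotate:
  fixes G :: "complex \<Rightarrow> real"
  assumes G: "continuous_on UNIV G"
  shows "integral {0..2 * pi} (\<lambda>\<theta>. G (z * cis \<theta>)) = integral {0..2 * pi} (\<lambda>\<theta>. G (complex_of_real (cmod z) * cis \<theta>))"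
proof -
  obtain a where a: "0 \<le> a" "a < 2 * pi" "z = complex_of_real (cmod z) * cis a"
    using Arg2pi[of z] by (auto simp: is_Arg_def cis_conv_exp)
  have "integral {0..2 * pi} (\<lambda>x. G (complex_of_real (cmod z) * cis (x + a)))
      = integral {0..2 * pi} (\<lambda>x. G (complex_of_real (cmod z) * cis x))"
  proof (rule integral_periodic_shift)
    show "continuous_on UNIV (\<lambda>x. G (complex_of_real (cmod z) * cis x))"
      by (rule continuous_on_compose2[OF G]) (auto intro!: continuous_intros continuous_on_cis)
    show "G (complex_of_real (cmod z) * cis (x + 2 * pi)) = G (complex_of_real (cmod z) * cis x)" for x
      by (simp add: cis_mult[symmetric])
  qed (use a in auto)
  moreover have "complex_of_real (cmod z) * cis (x + a) = z * cis x" for x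
    by (subst (2) a(3)) (simp add: cis_mult mult.assoc add.commute)
  ultimately show ?thesis by simp
qed

text \<open>The rotational mean of \<open>G - c' |z|\<^sup>2\<close> depends on \<open>|z|\<close> only and satisfies a strict local
  mean value inequality, so its maximum over the disc is attained on the boundary circle.\<close>

theorem local_to_global_mean:
  fixes G :: "complex \<Rightarrow> real"
  assumes G: "continuous_on UNIV G" and t: "0 < t"
    and loc: "\<And>c'. c' < c \<Longrightarrow> \<exists>r0>0. \<forall>z \<rho>. cmod z \<le> t \<longrightarrow> 0 < cmod \<rho> \<longrightarrow> cmod \<rho> \<le> r0 \<longrightarrow>
        2 * pi * (G z + c' * (cmod \<rho>)\<^sup>2) \<le> integral {0..2 * pi} (\<lambda>\<theta>. G (z + \<rho> * cis \<theta>))"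
  shows "2 * pi * (G 0 + c * t\<^sup>2) \<le> integral {0..2 * pi} (\<lambda>\<theta>. G (complex_of_real t * cis \<theta>))"
proof -
  let ?I = "{0..2 * pi}"
  define m where "m = integral ?I (\<lambda>\<theta>. G (complex_of_real t * cis \<theta>))"
  have main: "2 * pi * (G 0 + d * t\<^sup>2) \<le> m" if "d < c" for d
  proof -
    \<comment> \<open>The room between d and c' turns the mean value inequality into a strict one,
      which excludes an interior maximum of \<open>H\<close>.\<close>
    define c' where "c' = (c + d) / 2"
    have c': "d < c'" "c' < c" using that by (auto simp: c'_def)
    from loc[OF c'(2)] obtain r0 where r0: "0 < r0" and
      loc': "\<And>z \<rho>. cmod z \<le> t \<Longrightarrow> 0 < cmod \<rho> \<Longrightarrow> cmod \<rho> \<le> r0 \<Longrightarrow>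
        2 * pi * (G z + c' * (cmod \<rho>)\<^sup>2) \<le> integral ?I (\<lambda>\<theta>. G (z + \<rho> * cis \<theta>))" by blast
    define A where "A z = integral ?I (\<lambda>\<phi>. G (z * cis \<phi>))" for z
    define H where "H z = A z - 2 * pi * d * (cmod z)\<^sup>2" for z
    have contG: "continuous_on S (\<lambda>x. G (f x))" if "continuous_on S f" for S :: "'z::topological_space set" and f
      by (rule continuous_on_compose2[OF G that]) simp
    have "continuous_on UNIV A"
    proof -
      have "continuous_on UNIV (\<lambda>z. integral (cbox 0 (2 * pi)) (\<lambda>\<phi>. G (z * cis \<phi>)))"
        by (rule integral_continuous_on_param)
          (auto simp: case_prod_beta intro!: contG continuous_intros continuous_on_cis)
      then show ?thesis by (simp add: A_def[abs_def])
    qed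
    then have contH: "continuous_on S H" for S
      unfolding H_def by (intro continuous_intros) (auto intro: continuous_on_subset)
    have contHc: "continuous_on S (\<lambda>x. H (f x))" if "continuous_on S f" for S :: "real set" and f
      by (rule continuous_on_compose2[OF contH[of UNIV] that]) simp
    have contAc: "continuous_on S (\<lambda>x. A (f x))" if "continuous_on S f" for S :: "real set" and f
      by (rule continuous_on_compose2[OF \<open>continuous_on UNIV A\<close> that]) simp
    obtain z where z: "z \<in> cball 0 t" "\<And>y. y \<in> cball 0 t \<Longrightarrow> H y \<le> H z"
      using continuous_attains_sup[OF compact_cball, of 0 t H] contH t by auto
    have H0: "H 0 = 2 * pi * G 0" by (simp add: H_def A_def)
    have "cmod z = t"
    proof (rule ccontr)
      assume "cmod z \<noteq> t"
      then have zt: "cmod z < t" using z(1) by simp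
      define r where "r = min r0 (t - cmod z)"
      have r: "0 < r" "r \<le> r0" "cmod z + r \<le> t" using r0 zt by (auto simp: r_def)
      let ?r = "complex_of_real r"
      have int_const: "integral ?I (\<lambda>_::real. y) = 2 * pi * y" for y :: real by simp
      have le: "integral ?I (\<lambda>\<psi>. H (z + ?r * cis \<psi>)) \<le> 2 * pi * H z"
      proof -
        have "integral ?I (\<lambda>\<psi>. H (z + ?r * cis \<psi>)) \<le> integral ?I (\<lambda>_. H z)"
        proof (rule integral_le)
          show "(\<lambda>\<psi>. H (z + ?r * cis \<psi>)) integrable_on ?I"
            by (intro integrable_continuous_real contHc continuous_intros continuous_on_cis)
          fix \<psi> assume "\<psi> \<in> ?I"
          have "cmod (z + ?r * cis \<psi>) \<le> cmod z + r"
            using norm_triangle_ineq[of z "?r * cis \<psi>"] r by (simp add: norm_mult)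
          then show "H (z + ?r * cis \<psi>) \<le> H z" using r by (intro z(2)) simp
        qed (rule integrable_const_ivl)
        then show ?thesis by (simp only: int_const)
      qed
      \<comment> \<open>The rotation \<phi> is moved outside, so that the local inequality can be
        applied at each rotated centre.\<close>
      have swap: "integral ?I (\<lambda>\<psi>. A (z + ?r * cis \<psi>))
          = integral ?I (\<lambda>\<phi>. integral ?I (\<lambda>\<psi>. G ((z + ?r * cis \<psi>) * cis \<phi>)))"
        unfolding A_def
        using integral_swap_continuous[of 0 0 "2 * pi" "2 * pi" "\<lambda>\<psi> \<phi>. G ((z + ?r * cis \<psi>) * cis \<phi>)"]
        by (simp add: case_prod_beta contG continuous_intros continuous_on_cis)
      have "2 * pi * (A z + 2 * pi * (c' * r\<^sup>2)) = integral ?I (\<lambda>\<phi>. 2 * pi * (G (z * cis \<phi>) + c' * r\<^sup>2))"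
      proof -
        have "(\<lambda>\<phi>. G (z * cis \<phi>)) integrable_on ?I"
          by (intro integrable_continuous_real contG continuous_intros continuous_on_cis)
        then have "integral ?I (\<lambda>\<phi>. G (z * cis \<phi>) + c' * r\<^sup>2) = A z + 2 * pi * (c' * r\<^sup>2)"
          by (subst integral_add) (simp_all add: A_def integrable_const_ivl)
        then show ?thesis by simp
      qed
      also have "\<dots> \<le> integral ?I (\<lambda>\<phi>. integral ?I (\<lambda>\<psi>. G ((z + ?r * cis \<psi>) * cis \<phi>)))"
      proof (rule integral_le)
        show "(\<lambda>\<phi>. 2 * pi * (G (z * cis \<phi>) + c' * r\<^sup>2)) integrable_on ?I"
          by (intro integrable_continuous_real continuous_intros contG continuous_on_cis)
        have "continuous_on UNIV (\<lambda>\<phi>. integral (cbox 0 (2 * pi)) (\<lambda>\<psi>. G ((z + ?r * cis \<psi>) * cis \<phi>)))"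
          by (rule integral_continuous_on_param)
            (auto simp: case_prod_beta intro!: contG continuous_intros continuous_on_cis)
        then show "(\<lambda>\<phi>. integral ?I (\<lambda>\<psi>. G ((z + ?r * cis \<psi>) * cis \<phi>))) integrable_on ?I"
          by (intro integrable_continuous_real) (auto intro: continuous_on_subset)
        fix \<phi> assume "\<phi> \<in> ?I"
        \<comment> \<open>The radius is rotated together with the centre: this circle is the image
          under the rotation \<phi> of the circle of radius r about z.\<close>
        have "2 * pi * (G (z * cis \<phi>) + c' * (cmod (?r * cis \<phi>))\<^sup>2)
            \<le> integral ?I (\<lambda>\<theta>. G (z * cis \<phi> + ?r * cis \<phi> * cis \<theta>))"
          using r zt by (intro loc') (simp_all add: norm_mult)
        moreover have "z * cis \<phi> + ?r * cis \<phi> * cis \<theta> = (z + ?r * cis \<theta>) * cis \<phi>" for \<theta>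
          by (simp add: algebra_simps)
        ultimately show "2 * pi * (G (z * cis \<phi>) + c' * r\<^sup>2)
            \<le> integral ?I (\<lambda>\<psi>. G ((z + ?r * cis \<psi>) * cis \<phi>))"
          using r by (simp add: norm_mult)
      qed
      finally have A_ge: "2 * pi * (A z + 2 * pi * (c' * r\<^sup>2)) \<le> integral ?I (\<lambda>\<psi>. A (z + ?r * cis \<psi>))"
        by (simp only: swap)
      have H_int: "integral ?I (\<lambda>\<psi>. H (z + ?r * cis \<psi>))
          = integral ?I (\<lambda>\<psi>. A (z + ?r * cis \<psi>)) - 2 * pi * d * (2 * pi * ((cmod z)\<^sup>2 + r\<^sup>2))"
      proof -
        have "(\<lambda>\<psi>. A (z + ?r * cis \<psi>)) integrable_on ?I"
          by (intro integrable_continuous_real contAc continuous_intros continuous_on_cis)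
        moreover have "(\<lambda>\<psi>. 2 * pi * d * (cmod (z + ?r * cis \<psi>))\<^sup>2) integrable_on ?I"
          by (intro integrable_continuous_real continuous_intros continuous_on_cis)
        ultimately have "integral ?I (\<lambda>\<psi>. H (z + ?r * cis \<psi>)) = integral ?I (\<lambda>\<psi>. A (z + ?r * cis \<psi>))
            - integral ?I (\<lambda>\<psi>. 2 * pi * d * (cmod (z + ?r * cis \<psi>))\<^sup>2)"
          unfolding H_def by (rule integral_diff)
        then show ?thesis
          using integral_circle_norm_square[of z ?r] by simp
      qed
      have "2 * pi * (A z + 2 * pi * (c' * r\<^sup>2)) - 2 * pi * d * (2 * pi * ((cmod z)\<^sup>2 + r\<^sup>2)) \<le> 2 * pi * H z"
        using A_ge le H_int by linarith
      then have "2 * pi * (2 * pi * ((c' - d) * r\<^sup>2)) \<le> 0"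
        by (simp add: H_def algebra_simps)
      moreover have "0 < 2 * pi * (2 * pi * ((c' - d) * r\<^sup>2))" using c' r by simp
      ultimately show False by linarith
    qed
    then have "H z = m - 2 * pi * d * t\<^sup>2"
      using integral_circle_rotate[OF G, of z] by (simp add: H_def A_def m_def)
    moreover have "H 0 \<le> H z" using t by (intro z(2)) simp
    ultimately show ?thesis using H0 by (simp add: algebra_simps)
  qed
  have "2 * pi * (G 0 + c * t\<^sup>2) \<le> m"
  proof (rule ccontr)
    assume "\<not> ?thesis"
    then have lt: "m < 2 * pi * (G 0 + c * t\<^sup>2)" by simp
    define X where "X = 2 * pi * (G 0 + c * t\<^sup>2)"
    \<comment> \<open>Chosen so that replacing c by c - \<delta> costs half of the assumed
      gap.\<close>
    define \<delta> where "\<delta> = (2 * pi * (G 0 + c * t\<^sup>2) - m) / (4 * pi * t\<^sup>2)"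
    have \<delta>: "0 < \<delta>" using lt t by (simp add: \<delta>_def)
    have "2 * pi * (G 0 + (c - \<delta>) * t\<^sup>2) \<le> m" using \<delta> by (intro main) simp
    moreover have "2 * pi * (\<delta> * t\<^sup>2) = (2 * pi * (G 0 + c * t\<^sup>2) - m) / 2"
      using t by (simp add: \<delta>_def field_simps)
    moreover have "2 * pi * (G 0 + (c - \<delta>) * t\<^sup>2) = 2 * pi * (G 0 + c * t\<^sup>2) - 2 * pi * (\<delta> * t\<^sup>2)"
      by (simp add: algebra_simps)
    ultimately have "X - (X - m) / 2 \<le> m" by (simp only: X_def)
    then show False using lt unfolding X_def[symmetric] by (simp add: field_simps)
  qed
  then show ?thesis by (simp only: m_def)
qed

subsection \<open>The mean value inequality for the logarithmic determinant\<close>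

text \<open>By the Leibniz formula the determinant is a polynomial in entries that are visibly
  continuous. The level l and the point z may vary together, as the exchange of the two integrals
  demands.\<close>

lemma continuous_on_det_gram:
  fixes f :: "'x::topological_space \<Rightarrow> real" and g :: "'x \<Rightarrow> complex"
  assumes A: "A \<in> carrier_mat n n" and B: "B \<in> carrier_mat n n"
    and f: "continuous_on S f" and g: "continuous_on S g"
  shows "continuous_on S (\<lambda>x. Re (Determinant.det (gram n (f x) (A + g x \<cdot>\<^sub>m B))))"
proof -
  have T: "A + z \<cdot>\<^sub>m B \<in> carrier_mat n n" for z using A B by simp
  have ent: "(A + z \<cdot>\<^sub>m B) $$ (k, i) = A $$ (k, i) + z * B $$ (k, i)" if "k < n" "i < n" for z k i
    using A B that by simp
  have "continuous_on S (\<lambda>x. gram n (f x) (A + g x \<cdot>\<^sub>m B) $$ (i, j))" if ij: "i < n" "j < n" for i j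
  proof -
    have eq: "gram n (f x) (A + g x \<cdot>\<^sub>m B) $$ (i, j) = (if i = j then complex_of_real (f x) else 0)
      + (\<Sum>k<n. cnj (A $$ (k, i) + g x * B $$ (k, i)) * (A $$ (k, j) + g x * B $$ (k, j)))" for x
      unfolding gram_index[OF T ij] using ij
      by (intro arg_cong2[where f = "(+)"] refl sum.cong) (simp_all add: ent)
    show ?thesis unfolding eq using f g by (cases "i = j") (auto intro!: continuous_intros)
  qed
  note entry = this
  show ?thesis
    unfolding det_def'[OF gram_carrier[OF T]]
  proof (intro continuous_intros entry)
    fix p i assume "p \<in> {p. p permutes {0..<n}}" "i \<in> {0..<n}"
    then show "i < n" "p i < n" using permutes_in_image[of p "{0..<n}" i] by auto
  qed
qed

lemma holomorphic_det_one_plus: "(\<lambda>w. Determinant.det (one_plus n w L)) holomorphic_on S"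
  unfolding det_def'[OF one_plus_carrier]
proof (intro holomorphic_intros)
  fix p i assume "p \<in> {p. p permutes {0..<n}}" "i \<in> {0..<n}"
  then have "i < n" "p i < n" using permutes_in_image[of p "{0..<n}" i] by auto
  then show "(\<lambda>w. one_plus n w L $$ (i, p i)) holomorphic_on S"
    by (cases "i = p i") (auto simp: one_plus_def intro!: holomorphic_intros)
qed

lemma frame_svd_exists:
  "frame n (e :: nat \<Rightarrow> 'a::chilbert_space) \<Longrightarrow> A \<in> carrier_mat n n \<Longrightarrow> \<exists>U s V. is_svd n A U s V"
  using svd_exists[of n e A] by blast

lemma det_gram_pos:
  assumes "frame n (e :: nat \<Rightarrow> 'a::chilbert_space)" "T \<in> carrier_mat n n" "0 < l"
  shows "0 < Re (Determinant.det (gram n l T))"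
proof -
  obtain U s V where svd: "is_svd n T U s V" using frame_svd_exists[OF assms(1,2)] by blast
  have "0 < (\<Prod>i<n. l + (s i)\<^sup>2)" using assms(3) by (intro prod_pos) (auto intro: add_pos_nonneg)
  then show ?thesis by (simp only: is_svd_det_gram[OF svd] Re_complex_of_real)
qed

text \<open>U and V belong to the base point z and depend on neither w nor l, so all of A + (z + w)
  B is moved to a diagonal base point at once, with B' = \<open>adj U * B * V\<close>.\<close>

lemma svd_perturbation:
  assumes svd: "is_svd n (A + z \<cdot>\<^sub>m B) U s V" and A: "A \<in> carrier_mat n n" and B: "B \<in> carrier_mat n n"
  obtains B' where "B' \<in> carrier_mat n n" "frob2 n B' = frob2 n B"
    "\<And>w l. Determinant.det (gram n l (A + (z + w) \<cdot>\<^sub>m B)) = Determinant.det (gram n l (diagm n s + w \<cdot>\<^sub>m B'))"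
proof -
  have U: "unitary_mat n U" and V: "unitary_mat n V" and eq: "A + z \<cdot>\<^sub>m B = U * diagm n s * adj V"
    using svd by (simp_all add: is_svd_def)
  have Uc: "U \<in> carrier_mat n n" and Vc: "V \<in> carrier_mat n n" using U V by (simp_all add: unitary_mat_def)
  note Ua = adj_carrier[OF Uc]
  note Va = adj_carrier[OF Vc]
  define B' where "B' = adj U * B * V"
  have UB: "adj U * B \<in> carrier_mat n n" by (rule mult_carrier_mat[OF Ua B])
  have B': "B' \<in> carrier_mat n n" unfolding B'_def by (rule mult_carrier_mat[OF UB Vc])
  have recover: "U * B' * adj V = B"
  proof -
    have "U * B' * adj V = U * (B' * adj V)" by (rule assoc_mult_mat[OF Uc B' Va])
    also have "B' * adj V = adj U * B * (V * adj V)"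
      unfolding B'_def by (rule assoc_mult_mat[OF UB Vc Va])
    also have "\<dots> = adj U * B" by (simp only: unitary_mat_right[OF V] right_mult_one_mat[OF UB])
    also have "U * (adj U * B) = U * adj U * B" by (rule assoc_mult_mat[OF Uc Ua B, symmetric])
    finally show ?thesis using B by (simp add: unitary_mat_right[OF U])
  qed
  have "frob2 n B' = frob2 n B" using frob2_unitary[OF U V B'] by (simp only: recover)
  moreover have "Determinant.det (gram n l (A + (z + w) \<cdot>\<^sub>m B)) = Determinant.det (gram n l (diagm n s + w \<cdot>\<^sub>m B'))" for w l
  proof -
    have wB': "w \<cdot>\<^sub>m B' \<in> carrier_mat n n" using B' by simp
    have "U * (diagm n s + w \<cdot>\<^sub>m B') * adj V = (U * diagm n s + U * (w \<cdot>\<^sub>m B')) * adj V"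
      by (simp only: mult_add_distrib_mat[OF Uc diagm_carrier wB'])
    also have "\<dots> = U * diagm n s * adj V + U * (w \<cdot>\<^sub>m B') * adj V"
      by (rule add_mult_distrib_mat[OF mult_carrier_mat[OF Uc diagm_carrier] mult_carrier_mat[OF Uc wB'] Va])
    also have "U * (w \<cdot>\<^sub>m B') * adj V = w \<cdot>\<^sub>m (U * B' * adj V)"
      by (simp only: mult_smult_distrib[OF Uc B'] mult_smult_assoc_mat[OF mult_carrier_mat[OF Uc B'] Va])
    also have "U * diagm n s * adj V + w \<cdot>\<^sub>m (U * B' * adj V) = A + (z + w) \<cdot>\<^sub>m B"
      unfolding recover eq[symmetric] using A B by (intro eq_matI) (simp_all add: algebra_simps)
    finally have "A + (z + w) \<cdot>\<^sub>m B = U * (diagm n s + w \<cdot>\<^sub>m B') * adj V" by (rule sym)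
    then show ?thesis using det_gram_unitary[OF U V, of "diagm n s + w \<cdot>\<^sub>m B'" l] B' by simp
  qed
  ultimately show ?thesis using that B' by blast
qed

text \<open>Integrates the pointwise bound \<open>Fw\<close> over the circle. The term 2 ln |det (1
  + w L)| is harmonic where |w| q < 1 and vanishes at w = 0, so it has mean zero. The remaining gain
  involves z only through the bound M.\<close>

lemma local_mean_ln_det:
  fixes e :: "nat \<Rightarrow> 'a::chilbert_space"
  assumes e: "frame n e" and A: "A \<in> carrier_mat n n" and B: "B \<in> carrier_mat n n" and l: "0 < l"
    and M: "onorm (op_mat n e (A + z \<cdot>\<^sub>m B)) \<le> M"
  defines "F \<equiv> \<lambda>z. ln (Re (Determinant.det (gram n l (A + z \<cdot>\<^sub>m B))))"
  defines "\<kappa> \<equiv> l * frob2 n B / (l + M\<^sup>2)\<^sup>2" and "q \<equiv> M * sqrt (frob2 n B) / l"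
  assumes \<rho>: "cmod \<rho> * q < 1"
  shows "2 * pi * (F z + ln (1 + (cmod \<rho>)\<^sup>2 * (\<kappa> / (1 + cmod \<rho> * q)\<^sup>2)))
    \<le> integral {0..2 * pi} (\<lambda>\<theta>. F (z + \<rho> * cis \<theta>))"
proof -
  have Tc: "A + w \<cdot>\<^sub>m B \<in> carrier_mat n n" for w using A B by simp
  obtain U s V where svd: "is_svd n (A + z \<cdot>\<^sub>m B) U s V" and sM: "\<And>i. i < n \<Longrightarrow> s i \<le> M"
    using svd_exists[OF e Tc[of z]] M by (meson order.trans)
  have s0: "0 \<le> s i" if "i < n" for i using svd that by (simp add: is_svd_def)
  obtain B' where B': "B' \<in> carrier_mat n n" and fB': "frob2 n B' = frob2 n B" and
    detB': "\<And>w l. Determinant.det (gram n l (A + (z + w) \<cdot>\<^sub>m B)) = Determinant.det (gram n l (diagm n s + w \<cdot>\<^sub>m B'))"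
    using svd_perturbation[OF svd A B] by metis
  define x where "x i = sqrt (l + (s i)\<^sup>2)" for i
  define L where "L = Matrix.mat n n (\<lambda>(i, j). complex_of_real (s i / (x i * x j)) * B' $$ (i, j))"
  define Y where "Y = Matrix.mat n n (\<lambda>(i, j). complex_of_real (sqrt l / (x i * x j)) * B' $$ (i, j))"
  have Lc: "L \<in> carrier_mat n n" by (simp add: L_def)
  have M0: "0 \<le> M"
    using M onorm_pos_le[OF bounded_clinear_bounded_linear[OF compact_operator_bounded_clinear[OF compact_operator_op_mat]]]
    by (rule order.trans[rotated])
  have xl: "sqrt l \<le> x i" for i by (simp add: x_def)
  have x0: "0 < x i" for i using xl[of i] l by (meson order_less_le_trans real_sqrt_gt_zero)
  have xx: "l \<le> x i * x j" for i j
    using mult_mono[OF xl[of i] xl[of j]] x0[of i] l by simp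
  have xM: "(x i)\<^sup>2 \<le> l + M\<^sup>2" if "i < n" for i
  proof -
    have "(s i)\<^sup>2 \<le> M\<^sup>2" using sM[OF that] s0[OF that] by (intro power_mono)
    then show ?thesis using l by (simp add: x_def add_pos_nonneg less_imp_le)
  qed
  \<comment> \<open>From s_i \<le> M and x_i x_j \<ge> l.\<close>
  have fL: "frob2 n L \<le> q\<^sup>2"
  proof -
    have "frob2 n L \<le> (\<Sum>i<n. \<Sum>j<n. (M / l)\<^sup>2 * (cmod (B' $$ (i, j)))\<^sup>2)"
      unfolding frob2_def
    proof (intro sum_mono)
      fix i j assume "i \<in> {..<n}" "j \<in> {..<n}"
      then have ij: "i < n" "j < n" by simp_all
      have "s i / (x i * x j) \<le> M / l"
        using sM[OF ij(1)] s0[OF ij(1)] xx l by (intro frac_le) auto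
      then have "(s i / (x i * x j))\<^sup>2 \<le> (M / l)\<^sup>2"
        using s0[OF ij(1)] x0[of i] x0[of j] by (intro power_mono divide_nonneg_nonneg mult_nonneg_nonneg) auto
      then show "(cmod (L $$ (i, j)))\<^sup>2 \<le> (M / l)\<^sup>2 * (cmod (B' $$ (i, j)))\<^sup>2"
      proof -
        have "L $$ (i, j) = complex_of_real (s i / (x i * x j)) * B' $$ (i, j)"
          using ij by (simp add: L_def del: of_real_divide of_real_mult)
        then have "(cmod (L $$ (i, j)))\<^sup>2 = (s i / (x i * x j))\<^sup>2 * (cmod (B' $$ (i, j)))\<^sup>2"
          by (simp only: norm_mult norm_of_real power_mult_distrib power2_abs)
        then show ?thesis using \<open>(s i / (x i * x j))\<^sup>2 \<le> (M / l)\<^sup>2\<close> by (simp only: mult_right_mono zero_le_power2)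
      qed
    qed
    also have "\<dots> = (M / l)\<^sup>2 * frob2 n B'" by (simp add: frob2_def sum_distrib_left)
    also have "\<dots> = q\<^sup>2" by (simp add: q_def fB' power_mult_distrib power_divide frob2_nonneg)
    finally show ?thesis .
  qed
  have q0: "0 \<le> q" using M0 l by (simp add: q_def frob2_nonneg)
  have sL: "sqrt (frob2 n L) \<le> q" using real_sqrt_le_mono[OF fL] q0 by simp
  \<comment> \<open>From x_i^2 \<le> l + M^2; this is where the operator norms enter the final
    bound.\<close>
  have fY: "\<kappa> \<le> frob2 n Y"
  proof -
    have "\<kappa> = (\<Sum>i<n. \<Sum>j<n. l / (l + M\<^sup>2)\<^sup>2 * (cmod (B' $$ (i, j)))\<^sup>2)"
      unfolding \<kappa>_def fB'[symmetric] by (simp add: frob2_def sum_distrib_left sum_divide_distrib)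
    also have "\<dots> \<le> frob2 n Y"
      unfolding frob2_def
    proof (intro sum_mono)
      fix i j assume "i \<in> {..<n}" "j \<in> {..<n}"
      then have ij: "i < n" "j < n" by simp_all
      have xx_le: "(x i)\<^sup>2 * (x j)\<^sup>2 \<le> (l + M\<^sup>2) * (l + M\<^sup>2)"
        using xM[OF ij(1)] xM[OF ij(2)] l by (intro mult_mono) auto
      have "l / (l + M\<^sup>2)\<^sup>2 \<le> l / ((x i)\<^sup>2 * (x j)\<^sup>2)"
      proof (intro frac_le)
        show "(x i)\<^sup>2 * (x j)\<^sup>2 \<le> (l + M\<^sup>2)\<^sup>2"
          using xx_le by (simp only: power2_eq_square[of "l + M\<^sup>2"])
        show "0 < (x i)\<^sup>2 * (x j)\<^sup>2" using x0[of i] x0[of j] by simp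
      qed (use l in auto)
      also have "\<dots> = (sqrt l / (x i * x j))\<^sup>2"
        using l by (simp add: power_divide power_mult_distrib)
      finally have le: "l / (l + M\<^sup>2)\<^sup>2 \<le> (sqrt l / (x i * x j))\<^sup>2" .
      show "l / (l + M\<^sup>2)\<^sup>2 * (cmod (B' $$ (i, j)))\<^sup>2 \<le> (cmod (Y $$ (i, j)))\<^sup>2"
      proof -
        have "Y $$ (i, j) = complex_of_real (sqrt l / (x i * x j)) * B' $$ (i, j)"
          using ij by (simp add: Y_def del: of_real_divide of_real_mult)
        then have "(cmod (Y $$ (i, j)))\<^sup>2 = (sqrt l / (x i * x j))\<^sup>2 * (cmod (B' $$ (i, j)))\<^sup>2"
          by (simp only: norm_mult norm_of_real power_mult_distrib power2_abs)
        then show ?thesis using le by (simp only: mult_right_mono zero_le_power2)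
      qed
    qed
    finally show ?thesis .
  qed
  define c where "c w = Determinant.det (one_plus n w L)" for w
  have c0: "c 0 = 1"
  proof -
    have "one_plus n 0 L = 1\<^sub>m n" by (intro eq_matI) (auto simp: one_plus_def)
    then show ?thesis by (simp add: c_def)
  qed
  have cnz: "c w \<noteq> 0" if "cmod w * q < 1" for w
    unfolding c_def
  proof (rule det_one_plus_nonzero[OF Lc])
    show "cmod w * sqrt (frob2 n L) < 1" using mult_left_mono[OF sL, of "cmod w"] that by simp
  qed
  have \<kappa>0: "0 \<le> \<kappa>" using l by (simp add: \<kappa>_def frob2_nonneg)
  define \<delta> where "\<delta> r = ln (1 + r\<^sup>2 * (\<kappa> / (1 + r * q)\<^sup>2))" for r :: real
  have Fw: "F z + 2 * ln (cmod (c w)) + \<delta> (cmod w) \<le> F (z + w)" if w: "cmod w * q < 1" for w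
  proof -
    let ?P = "\<Prod>i<n. l + (s i)\<^sup>2" and ?k = "(cmod w)\<^sup>2 * (\<kappa> / (1 + cmod w * q)\<^sup>2)"
    have P: "0 < ?P" using l by (intro prod_pos) (auto intro: add_pos_nonneg)
    have k0: "0 \<le> ?k" using \<kappa>0 by simp
    have den: "0 < 1 + cmod w * sqrt (frob2 n L)" by (intro add_pos_nonneg) (simp_all add: frob2_nonneg)
    have "\<kappa> / (1 + cmod w * q)\<^sup>2 \<le> frob2 n Y / (1 + cmod w * sqrt (frob2 n L))\<^sup>2"
    proof (rule frac_le)
      show "(1 + cmod w * sqrt (frob2 n L))\<^sup>2 \<le> (1 + cmod w * q)\<^sup>2"
        using den mult_left_mono[OF sL, of "cmod w"] by (intro power_mono) auto
    qed (use fY \<kappa>0 den in \<open>auto simp: frob2_nonneg\<close>)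
    then have kle: "?k \<le> (cmod w)\<^sup>2 * (frob2 n Y / (1 + cmod w * sqrt (frob2 n L))\<^sup>2)"
      by (intro mult_left_mono) simp_all
    have "?P * ((cmod (c w))\<^sup>2 * (1 + ?k))
        \<le> ?P * ((cmod (c w))\<^sup>2 * (1 + (cmod w)\<^sup>2 * (frob2 n Y / (1 + cmod w * sqrt (frob2 n L))\<^sup>2)))"
      by (rule mult_left_mono[OF mult_left_mono[OF add_left_mono[OF kle]]]) (use P in auto)
    also have "\<dots> \<le> Re (Determinant.det (gram n l (diagm n s + w \<cdot>\<^sub>m B')))"
      using gram_perturbed_diagonal[OF B' l cnz[OF w, unfolded c_def L_def x_def] frame_svd_exists[OF e]]
      by (simp only: c_def L_def[symmetric, unfolded x_def] Y_def[symmetric, unfolded x_def])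
    also have "\<dots> = Re (Determinant.det (gram n l (A + (z + w) \<cdot>\<^sub>m B)))" by (simp only: detB')
    finally have le: "?P * ((cmod (c w))\<^sup>2 * (1 + ?k)) \<le> Re (Determinant.det (gram n l (A + (z + w) \<cdot>\<^sub>m B)))" .
    have cpos: "0 < cmod (c w)" using cnz[OF w] by simp
    have "F z = ln ?P" by (simp only: F_def is_svd_det_gram[OF svd] Re_complex_of_real)
    moreover have "ln (?P * ((cmod (c w))\<^sup>2 * (1 + ?k))) = ln ?P + (2 * ln (cmod (c w)) + \<delta> (cmod w))"
      using P cpos k0 by (simp add: ln_mult_pos ln_realpow \<delta>_def add_pos_nonneg)
    moreover have "ln (?P * ((cmod (c w))\<^sup>2 * (1 + ?k))) \<le> F (z + w)"
      unfolding F_def using le P cpos k0 by (intro ln_mono) (auto intro!: mult_pos_pos add_pos_nonneg)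
    ultimately show ?thesis by simp
  qed
  \<comment> \<open>Radius of a disc on which \<open>c\<close> has no zeros. For q = 0 the quotient
    1 / q would be 0, and any radius beyond |\<rho>| is right.\<close>
  define R where "R = (if q = 0 then cmod \<rho> + 1 else 1 / q)"
  have R: "cmod \<rho> < R" "\<And>w. cmod w < R \<Longrightarrow> cmod w * q < 1"
    using \<rho> q0 by (auto simp: R_def field_simps split: if_splits)
  have "c holomorphic_on ball 0 R" unfolding c_def by (rule holomorphic_det_one_plus)
  then have "((\<lambda>\<theta>. ln (cmod (c (\<rho> * cis \<theta>)))) has_integral 2 * pi * ln (cmod (c 0))) {0..2 * pi}"
    by (rule has_integral_ln_norm_circle[OF _ _ R(1)]) (use R(2) cnz in simp)
  from has_integral_mult_right[OF this, of 2]
  have c_int: "((\<lambda>\<theta>. 2 * ln (cmod (c (\<rho> * cis \<theta>)))) has_integral 0) {0..2 * pi}" by (simp add: c0)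
  have const: "((\<lambda>\<theta>::real. F z + \<delta> (cmod \<rho>)) has_integral 2 * pi * (F z + \<delta> (cmod \<rho>))) {0..2 * pi}"
    using has_integral_const_real[of "F z + \<delta> (cmod \<rho>)" 0 "2 * pi"] by simp
  have "((\<lambda>\<theta>. (F z + \<delta> (cmod \<rho>)) + 2 * ln (cmod (c (\<rho> * cis \<theta>)))) has_integral
      2 * pi * (F z + \<delta> (cmod \<rho>)) + 0) {0..2 * pi}"
    by (rule has_integral_add[OF const c_int])
  moreover have "((\<lambda>\<theta>. F (z + \<rho> * cis \<theta>)) has_integral integral {0..2 * pi} (\<lambda>\<theta>. F (z + \<rho> * cis \<theta>))) {0..2 * pi}"
  proof (rule integrable_integral, rule integrable_continuous_real)
    show "continuous_on {0..2 * pi} (\<lambda>\<theta>. F (z + \<rho> * cis \<theta>))"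
      unfolding F_def
    proof (rule continuous_on_ln[OF continuous_on_det_gram[OF A B]])
      show "\<forall>x\<in>{0..2 * pi}. Re (Determinant.det (gram n l (A + (z + \<rho> * cis x) \<cdot>\<^sub>m B))) \<noteq> 0"
        using det_gram_pos[OF e Tc l] by (metis less_irrefl)
    qed (auto intro!: continuous_intros continuous_on_cis)
  qed
  ultimately have "2 * pi * (F z + \<delta> (cmod \<rho>)) + 0 \<le> integral {0..2 * pi} (\<lambda>\<theta>. F (z + \<rho> * cis \<theta>))"
  proof (rule has_integral_le)
    fix \<theta> :: real
    show "F z + \<delta> (cmod \<rho>) + 2 * ln (cmod (c (\<rho> * cis \<theta>))) \<le> F (z + \<rho> * cis \<theta>)"
      using Fw[of "\<rho> * cis \<theta>"] \<rho> by (simp add: norm_mult)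
  qed
  then show ?thesis by (simp add: \<delta>_def)
qed

text \<open>ln (1 + x) \<ge> x / (1 + x), and for the present x this quotient is r^2 times a
  function \<open>?h\<close> of r that tends to \<kappa> as r tends to 0.\<close>

lemma ln_quadratic_lower:
  fixes \<kappa> q c' :: real
  assumes "0 \<le> \<kappa>" "0 \<le> q" "c' < \<kappa>"
  shows "\<exists>r0>0. \<forall>r. 0 < r \<longrightarrow> r \<le> r0 \<longrightarrow> r * q < 1 \<and> c' * r\<^sup>2 \<le> ln (1 + r\<^sup>2 * (\<kappa> / (1 + r * q)\<^sup>2))"
proof -
  let ?h = "\<lambda>r::real. \<kappa> / ((1 + r * q)\<^sup>2 + r\<^sup>2 * \<kappa>)"
  have "isCont ?h 0" by (intro continuous_intros) simp
  then have "(?h \<longlongrightarrow> \<kappa>) (at 0)" by (simp add: isCont_def)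
  then have "\<forall>\<^sub>F r in at 0. c' < ?h r" using assms(3) by (rule order_tendstoD)
  moreover have "isCont (\<lambda>r::real. r * q) 0" by (intro continuous_intros)
  then have "((\<lambda>r::real. r * q) \<longlongrightarrow> 0) (at 0)" by (simp add: isCont_def)
  then have "\<forall>\<^sub>F r in at 0. r * q < 1" by (rule order_tendstoD) simp
  ultimately have "\<forall>\<^sub>F r in at 0. c' < ?h r \<and> r * q < 1" by (rule eventually_conj)
  then obtain d where d: "0 < d" "\<And>r. r \<noteq> 0 \<Longrightarrow> dist r 0 < d \<Longrightarrow> c' < ?h r \<and> r * q < 1"
    unfolding eventually_at by blast
  have "r * q < 1 \<and> c' * r\<^sup>2 \<le> ln (1 + r\<^sup>2 * (\<kappa> / (1 + r * q)\<^sup>2))" if r: "0 < r" "r \<le> d / 2" for r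
  proof
    have h: "c' < ?h r" "r * q < 1" using d(2)[of r] r d(1) by auto
    show "r * q < 1" by (rule h)
    let ?a = "(1 + r * q)\<^sup>2" and ?x = "r\<^sup>2 * (\<kappa> / (1 + r * q)\<^sup>2)"
    have a: "0 < ?a" using r assms by (intro zero_less_power add_pos_nonneg) auto
    have x: "0 \<le> ?x" using assms by simp
    have "c' * r\<^sup>2 \<le> ?h r * r\<^sup>2" using h by (intro mult_right_mono) auto
    also have "\<dots> = ?x / (1 + ?x)"
    proof -
      have "?a + r\<^sup>2 * \<kappa> \<noteq> 0" using a assms by (intro less_imp_neq[symmetric] add_pos_nonneg) auto
      moreover have "1 + ?x = (?a + r\<^sup>2 * \<kappa>) / ?a" using a by (simp add: add_divide_distrib)
      ultimately show ?thesis using a by simp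
    qed
    also have "\<dots> \<le> ln (1 + ?x)"
    proof -
      have "ln (1 / (1 + ?x)) \<le> 1 / (1 + ?x) - 1" using x by (intro ln_le_minus_one) simp
      moreover have "ln (1 / (1 + ?x)) = - ln (1 + ?x)" using x by (simp add: ln_div)
      moreover have "1 / (1 + ?x) - 1 = - (?x / (1 + ?x))" using x by (simp add: field_simps)
      ultimately show ?thesis by linarith
    qed
    finally show "c' * r\<^sup>2 \<le> ln (1 + ?x)" .
  qed
  then show ?thesis using d(1) by (intro exI[of _ "d / 2"]) simp
qed

text \<open>The radius r0 is determined by \<kappa> and q, hence by l, M and
  \<open>frob2 n B\<close>. It serves all centres of the disc simultaneously, which is the
  uniformity asked for by \<open>local_to_global_mean\<close>.\<close>

theorem mean_ln_det_gram:
  fixes e :: "nat \<Rightarrow> 'a::chilbert_space"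
  assumes e: "frame n e" and A: "A \<in> carrier_mat n n" and B: "B \<in> carrier_mat n n" and l: "0 < l" and t: "0 < t"
    and M: "\<And>z. cmod z \<le> t \<Longrightarrow> onorm (op_mat n e (A + z \<cdot>\<^sub>m B)) \<le> M"
  defines "F \<equiv> \<lambda>z. ln (Re (Determinant.det (gram n l (A + z \<cdot>\<^sub>m B))))"
  shows "2 * pi * (F 0 + l * frob2 n B / (l + M\<^sup>2)\<^sup>2 * t\<^sup>2)
    \<le> integral {0..2 * pi} (\<lambda>\<theta>. F (complex_of_real t * cis \<theta>))"
proof (rule local_to_global_mean[OF _ t])
  have Tc: "A + w \<cdot>\<^sub>m B \<in> carrier_mat n n" for w using A B by simp
  show "continuous_on UNIV F"
    unfolding F_def
  proof (rule continuous_on_ln[OF continuous_on_det_gram[OF A B]])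
    show "\<forall>x\<in>UNIV. Re (Determinant.det (gram n l (A + x \<cdot>\<^sub>m B))) \<noteq> 0"
      using det_gram_pos[OF e Tc l] by (metis less_irrefl)
  qed (auto intro!: continuous_intros)
  fix c' assume c': "c' < l * frob2 n B / (l + M\<^sup>2)\<^sup>2"
  have M0: "0 \<le> M"
  proof -
    have "0 \<le> onorm (op_mat n e (A + 0 \<cdot>\<^sub>m B))"
      by (intro onorm_pos_le bounded_clinear_bounded_linear compact_operator_bounded_clinear compact_operator_op_mat)
    also have "\<dots> \<le> M" using t by (intro M) simp
    finally show ?thesis .
  qed
  define q where "q = M * sqrt (frob2 n B) / l"
  define \<kappa> where "\<kappa> = l * frob2 n B / (l + M\<^sup>2)\<^sup>2"
  have "0 \<le> q" "0 \<le> \<kappa>" using M0 l by (simp_all add: q_def \<kappa>_def frob2_nonneg)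
  then obtain r0 where r0: "0 < r0"
    "\<And>r. 0 < r \<Longrightarrow> r \<le> r0 \<Longrightarrow> r * q < 1 \<and> c' * r\<^sup>2 \<le> ln (1 + r\<^sup>2 * (\<kappa> / (1 + r * q)\<^sup>2))"
    using ln_quadratic_lower[of \<kappa> q c'] c' by (auto simp: \<kappa>_def)
  have "2 * pi * (F z + c' * (cmod \<rho>)\<^sup>2) \<le> integral {0..2 * pi} (\<lambda>\<theta>. F (z + \<rho> * cis \<theta>))"
    if "cmod z \<le> t" "0 < cmod \<rho>" "cmod \<rho> \<le> r0" for z \<rho>
  proof -
    have r: "cmod \<rho> * q < 1" "c' * (cmod \<rho>)\<^sup>2 \<le> ln (1 + (cmod \<rho>)\<^sup>2 * (\<kappa> / (1 + cmod \<rho> * q)\<^sup>2))"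
      using r0(2)[OF that(2,3)] by simp_all
    have "2 * pi * (F z + c' * (cmod \<rho>)\<^sup>2) \<le> 2 * pi * (F z + ln (1 + (cmod \<rho>)\<^sup>2 * (\<kappa> / (1 + cmod \<rho> * q)\<^sup>2)))"
      using r(2) by (intro mult_left_mono add_left_mono) simp_all
    also have "\<dots> \<le> integral {0..2 * pi} (\<lambda>\<theta>. F (z + \<rho> * cis \<theta>))"
      unfolding F_def \<kappa>_def q_def
      by (rule local_mean_ln_det[OF e A B l M[OF that(1)] r(1)[unfolded q_def]])
    finally show ?thesis .
  qed
  then show "\<exists>r0>0. \<forall>z \<rho>. cmod z \<le> t \<longrightarrow> 0 < cmod \<rho> \<longrightarrow> cmod \<rho> \<le> r0 \<longrightarrow>
      2 * pi * (F z + c' * (cmod \<rho>)\<^sup>2) \<le> integral {0..2 * pi} (\<lambda>\<theta>. F (z + \<rho> * cis \<theta>))"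
    using r0(1) by blast
qed

subsection \<open>The logarithmic representation of powers\<close>

definition weight_primitive :: "real \<Rightarrow> real \<Rightarrow> real" where
  "weight_primitive q x = integral {0..x} (\<lambda>u. u powr q / (1 + u)\<^sup>2)"

text \<open>The Beta integral B(1 + q, 1 - q) for 0 < q < 1, taken as a supremum of primitives. It
  divides out at the end, so positivity and finiteness are all that is proved about it.\<close>

definition weight_mass :: "real \<Rightarrow> real" where
  "weight_mass q = Sup (weight_primitive q ` {0..})"

lemma continuous_on_weight:
  assumes "0 < q"
  shows "continuous_on {0..x} (\<lambda>u::real. u powr q / (1 + u)\<^sup>2)"
proof (rule continuous_on_divide)
  show "continuous_on {0..x} (\<lambda>u::real. u powr q)"
    using assms by (intro continuous_on_powr' continuous_intros) auto
qed (auto intro!: continuous_intros)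

lemma inverse_Suc_le_Suc: "1 / real (Suc N) \<le> real (Suc N)"
proof -
  have "1 / real (Suc N) \<le> 1" by simp
  also have "1 \<le> real (Suc N)" by simp
  finally show ?thesis .
qed

lemma weight_primitive_mono:
  assumes q: "0 < q" and "0 \<le> x" "x \<le> y"
  shows "weight_primitive q x \<le> weight_primitive q y"
  unfolding weight_primitive_def
  by (rule integral_subset_le) (use assms in \<open>auto intro!: integrable_continuous_real continuous_on_weight\<close>)

lemma weight_primitive_0: "weight_primitive q 0 = 0"
  by (simp add: weight_primitive_def)

lemma weight_primitive_deriv:
  assumes q: "0 < q" and x: "0 < x"
  shows "(weight_primitive q has_real_derivative x powr q / (1 + x)\<^sup>2) (at x)"
proof -
  have "((\<lambda>y. integral {0..y} (\<lambda>u. u powr q / (1 + u)\<^sup>2)) has_real_derivative x powr q / (1 + x)\<^sup>2)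
      (at x within {0..x + 1})"
    by (rule integral_has_real_derivative[OF continuous_on_weight[OF q]]) (use x in auto)
  moreover have "at x within {0..x + 1} = at x" by (rule at_within_Icc_at) (use x in auto)
  ultimately show ?thesis by (simp add: weight_primitive_def[abs_def])
qed

lemma weight_primitive_bounded:
  assumes q: "0 < q" "q < 1" and x: "0 \<le> x"
  shows "weight_primitive q x \<le> weight_primitive q 1 + 1 / (1 - q)"
proof (cases "x \<le> 1")
  case True
  then have "weight_primitive q x \<le> weight_primitive q 1" using q x by (intro weight_primitive_mono)
  then show ?thesis using q by (simp add: add_increasing2)
next
  case False
  \<comment> \<open>For y \<ge> 1 the integrand is at most y^(q-2), whose tail integral is y^(q-1) /
    (1 - q); adding this tail makes the sum nonincreasing.\<close>
  define Q where "Q y = weight_primitive q y + y powr (q - 1) / (1 - q)" for y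
  have "Q x \<le> Q 1"
  proof (rule DERIV_nonpos_imp_nonincreasing[of 1 x Q])
    show "1 \<le> x" using False by simp
    fix y :: real assume y: "1 \<le> y" "y \<le> x"
    have "(Q has_real_derivative y powr q / (1 + y)\<^sup>2 + ((q - 1) * y powr (q - 1 - 1)) / (1 - q)) (at y)"
      unfolding Q_def using y by (intro DERIV_add DERIV_cdivide weight_primitive_deriv has_real_derivative_powr q) auto
    moreover have "y powr q / (1 + y)\<^sup>2 + ((q - 1) * y powr (q - 1 - 1)) / (1 - q) \<le> 0"
    proof -
      have "((q - 1) * y powr (q - 1 - 1)) / (1 - q) = - (y powr (q - 2))"
        using q by (simp add: field_simps)
      moreover have "y powr q / (1 + y)\<^sup>2 \<le> y powr q / y\<^sup>2"
        using y by (intro divide_left_mono power_mono) auto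
      moreover have "y powr q / y\<^sup>2 = y powr (q - 2)"
        using y by (simp add: powr_diff)
      ultimately show ?thesis by simp
    qed
    ultimately show "\<exists>d. (Q has_real_derivative d) (at y) \<and> d \<le> 0" by blast
  qed
  moreover have "weight_primitive q x \<le> Q x" using q by (simp add: Q_def)
  ultimately show ?thesis by (simp add: Q_def)
qed

lemma weight_primitive_bdd: "0 < q \<Longrightarrow> q < 1 \<Longrightarrow> bdd_above (weight_primitive q ` {0..})"
  by (rule bdd_aboveI[of _ "weight_primitive q 1 + 1 / (1 - q)"]) (auto intro: weight_primitive_bounded)

lemma weight_primitive_at_top:
  assumes q: "0 < q" "q < 1"
  shows "(weight_primitive q \<longlongrightarrow> weight_mass q) at_top"
proof (rule increasing_tendsto)
  show "\<forall>\<^sub>F x in at_top. weight_primitive q x \<le> weight_mass q"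
    using eventually_ge_at_top[of 0] unfolding weight_mass_def
    by eventually_elim (auto intro!: cSup_upper weight_primitive_bdd q)
  fix y assume "y < weight_mass q"
  then obtain x where x: "0 \<le> x" "y < weight_primitive q x"
    using less_cSupD[of "weight_primitive q ` {0..}" y] by (auto simp: weight_mass_def)
  show "\<forall>\<^sub>F x in at_top. y < weight_primitive q x"
    using eventually_ge_at_top[of x]
    by eventually_elim (use x weight_primitive_mono[OF q(1) x(1)] in force)
qed

lemma weight_mass_pos:
  assumes q: "0 < q" "q < 1"
  shows "0 < weight_mass q"
proof -
  have "integral {1..2} (\<lambda>u::real. 1 / 9) \<le> integral {1..2} (\<lambda>u. u powr q / (1 + u)\<^sup>2)"
  proof (rule integral_le)
    show "(\<lambda>u. u powr q / (1 + u)\<^sup>2) integrable_on {1..2::real}"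
      by (intro integrable_continuous_real continuous_on_subset[OF continuous_on_weight[OF q(1), of 2]]) auto
    fix u :: real assume u: "u \<in> {1..2}"
    have "(1 + u)\<^sup>2 \<le> 3\<^sup>2" using u by (intro power_mono) auto
    then have "1 / 9 \<le> 1 / (1 + u)\<^sup>2" using u by (intro frac_le) auto
    also have "\<dots> \<le> u powr q / (1 + u)\<^sup>2" using u q by (intro divide_right_mono ge_one_powr_ge_zero) auto
    finally show "1 / 9 \<le> u powr q / (1 + u)\<^sup>2" .
  qed (rule integrable_const_ivl)
  also have "\<dots> \<le> weight_primitive q 2"
    unfolding weight_primitive_def
    by (rule integral_subset_le)
      (use q in \<open>auto intro!: integrable_continuous_real continuous_on_weight continuous_on_subset[OF continuous_on_weight[OF q(1), of 2]]\<close>)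
  also have "\<dots> \<le> weight_mass q"
    unfolding weight_mass_def by (intro cSup_upper weight_primitive_bdd q) auto
  finally show ?thesis by simp
qed

lemma weight_primitive_at_0:
  assumes q: "0 < q" "q < 1"
  shows "(weight_primitive q \<longlongrightarrow> 0) (at_right 0)"
proof (rule tendsto_sandwich)
  show "\<forall>\<^sub>F x in at_right 0. 0 \<le> weight_primitive q x"
    using eventually_at_right_less[of 0]
    by eventually_elim (use weight_primitive_mono[OF q(1), of 0] in \<open>simp add: weight_primitive_0\<close>)
  have "weight_primitive q x \<le> x powr q * x" if "0 < x" for x
  proof -
    have "weight_primitive q x \<le> integral {0..x} (\<lambda>u. x powr q)"
      unfolding weight_primitive_def
    proof (rule integral_le)
      show "(\<lambda>u. u powr q / (1 + u)\<^sup>2) integrable_on {0..x}"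
        by (intro integrable_continuous_real continuous_on_weight q)
      fix u assume u: "u \<in> {0..x}"
      have "1\<^sup>2 \<le> (1 + u)\<^sup>2" using u by (intro power_mono) auto
      then have "u powr q / (1 + u)\<^sup>2 \<le> u powr q / 1" using u by (intro frac_le) auto
      also have "\<dots> \<le> x powr q" using u q by (simp add: powr_mono2)
      finally show "u powr q / (1 + u)\<^sup>2 \<le> x powr q" .
    qed (rule integrable_const_ivl)
    then show ?thesis using that by (simp add: mult.commute)
  qed
  then show "\<forall>\<^sub>F x in at_right 0. weight_primitive q x \<le> x powr q * x"
    using eventually_at_right_less[of 0] by (auto elim: eventually_mono)
  show "((\<lambda>x. x powr q * x) \<longlongrightarrow> 0) (at_right 0)" using q by real_asymp
qed simp

text \<open>The substitution l = c u, carried out on the primitive.\<close>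

lemma integral_weight:
  assumes q: "0 < q" and c: "0 < c" and ab: "0 < a" "a \<le> b"
  shows "integral {a..b} (\<lambda>l. l powr q / (l + c)\<^sup>2)
    = c powr (q - 1) * weight_primitive q (b / c) - c powr (q - 1) * weight_primitive q (a / c)"
proof (rule integral_unique, rule fundamental_theorem_of_calculus[OF ab(2)])
  fix l assume "l \<in> {a..b}"
  then have l: "0 < l" using ab by simp
  have "((\<lambda>l. weight_primitive q (l / c)) has_real_derivative ((l / c) powr q / (1 + l / c)\<^sup>2) * (1 / c)) (at l)"
    by (rule DERIV_chain2[OF weight_primitive_deriv[OF q]]) (use l c in \<open>auto intro!: derivative_eq_intros\<close>)
  from DERIV_cmult[OF this, of "c powr (q - 1)"]
  have "((\<lambda>l. c powr (q - 1) * weight_primitive q (l / c)) has_real_derivative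
      c powr (q - 1) * (((l / c) powr q / (1 + l / c)\<^sup>2) * (1 / c))) (at l)" .
  moreover have "c powr (q - 1) * (((l / c) powr q / (1 + l / c)\<^sup>2) * (1 / c)) = l powr q / (l + c)\<^sup>2"
  proof -
    have "1 + l / c = (l + c) / c" using c by (simp add: field_simps)
    moreover define X where "X = c powr q"
    moreover define D where "D = (l + c)\<^sup>2"
    ultimately have "c powr (q - 1) * (((l / c) powr q / (1 + l / c)\<^sup>2) * (1 / c))
        = X / c * ((l powr q / X) / (D / c\<^sup>2) * (1 / c))"
      using c l by (simp add: powr_divide powr_diff power_divide)
    also have "\<dots> = l powr q / D"
    proof -
      have "0 < X" "0 < D" using c l by (simp_all add: X_def D_def)
      then show ?thesis using c by (simp add: power2_eq_square)
    qed
    finally show ?thesis by (simp only: D_def)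
  qed
  ultimately show "((\<lambda>l. c powr (q - 1) * weight_primitive q (l / c)) has_vector_derivative l powr q / (l + c)\<^sup>2)
      (at l within {a..b})"
    by (simp add: has_real_derivative_iff_has_vector_derivative has_vector_derivative_at_within)
qed

text \<open>Two integrations by parts, each contributing a factor 1/q: the first replaces the
  logarithm by c / (l (l + c)), the second replaces 1 / (l + c) by 1 / (l + c)^2. \<Psi> collects
  the boundary terms. The factor 1/q^2 is the origin of the constant in the theorem.\<close>

lemma integral_log_weight:
  fixes a b c q :: real
  assumes q: "0 < q" and c: "0 < c" and ab: "0 < a" "a \<le> b"
  defines "\<Psi> \<equiv> \<lambda>l. l powr q / q * ln (1 + c / l) + (l powr q * c / (l + c)) / q\<^sup>2"
  shows "integral {a..b} (\<lambda>l. ln (1 + c / l) * l powr (q - 1))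
    = \<Psi> b - \<Psi> a + c / q\<^sup>2 * integral {a..b} (\<lambda>l. l powr q / (l + c)\<^sup>2)"
proof -
  have "((\<lambda>l. ln (1 + c / l) * l powr (q - 1) - c / q\<^sup>2 * (l powr q / (l + c)\<^sup>2)) has_integral \<Psi> b - \<Psi> a) {a..b}"
  proof (rule fundamental_theorem_of_calculus[OF ab(2)])
    fix l assume "l \<in> {a..b}"
    then have l: "0 < l" using ab by simp
    have lc: "0 < 1 + c / l" "0 < l + c" using l c by (auto intro: add_pos_pos)
    have d1: "((\<lambda>l. l powr q / q * ln (1 + c / l)) has_real_derivative
        l powr (q - 1) * ln (1 + c / l) + l powr q / q * (- (c / l\<^sup>2) / (1 + c / l))) (at l)"
      using l lc q
      by (auto intro!: derivative_eq_intros simp: power2_eq_square diff_divide_distrib mult.commute mult.left_commute)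
    have "((\<lambda>l. l powr q * c / (l + c)) has_real_derivative
        (q * l powr (q - 1) * c * (l + c) - l powr q * c) / (l + c)\<^sup>2) (at l)"
      using l lc q by (auto intro!: derivative_eq_intros simp: power2_eq_square)
    then have d2: "((\<lambda>l. (l powr q * c / (l + c)) / q\<^sup>2) has_real_derivative
        ((q * l powr (q - 1) * c * (l + c) - l powr q * c) / (l + c)\<^sup>2) / q\<^sup>2) (at l)"
      by (rule DERIV_cdivide)
    have eq: "l powr (q - 1) * ln (1 + c / l) + l powr q / q * (- (c / l\<^sup>2) / (1 + c / l))
        + ((q * l powr (q - 1) * c * (l + c) - l powr q * c) / (l + c)\<^sup>2) / q\<^sup>2
      = ln (1 + c / l) * l powr (q - 1) - c / q\<^sup>2 * (l powr q / (l + c)\<^sup>2)"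
    proof -
      define w where "w = l powr (q - 1)"
      have w: "l powr q = w * l" using l by (simp add: w_def powr_diff)
      have "w * l / q * (- (c / l\<^sup>2) / (1 + c / l)) = - (w * c / (q * (l + c)))"
      proof -
        have "1 + c / l = (l + c) / l" using l by (simp add: field_simps)
        then show ?thesis using l lc q by (simp add: power2_eq_square mult.commute)
      qed
      moreover have "((q * w * c * (l + c) - w * l * c) / (l + c)\<^sup>2) / q\<^sup>2
          = w * c / (q * (l + c)) - c / q\<^sup>2 * (w * l / (l + c)\<^sup>2)"
      proof -
        have "(q * w * c * (l + c)) / (l + c)\<^sup>2 / q\<^sup>2 = w * c / (q * (l + c))"
          using lc q by (simp add: power2_eq_square)
        then show ?thesis by (simp add: diff_divide_distrib mult.commute)
      qed
      ultimately show ?thesis unfolding w w_def[symmetric] by (simp add: mult.commute)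
    qed
    show "(\<Psi> has_vector_derivative (ln (1 + c / l) * l powr (q - 1) - c / q\<^sup>2 * (l powr q / (l + c)\<^sup>2)))
        (at l within {a..b})"
      using DERIV_add[OF d1 d2] unfolding eq \<Psi>_def
      by (simp add: has_real_derivative_iff_has_vector_derivative has_vector_derivative_at_within)
  qed
  moreover have int: "(\<lambda>l. l powr q / (l + c)\<^sup>2) integrable_on {a..b}"
    using ab c q by (intro integrable_continuous_real continuous_intros) auto
  then have "((\<lambda>l. c / q\<^sup>2 * (l powr q / (l + c)\<^sup>2)) has_integral c / q\<^sup>2 * integral {a..b} (\<lambda>l. l powr q / (l + c)\<^sup>2)) {a..b}"
    by (intro has_integral_mult_right integrable_integral)
  ultimately have "((\<lambda>l. (ln (1 + c / l) * l powr (q - 1) - c / q\<^sup>2 * (l powr q / (l + c)\<^sup>2))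
      + c / q\<^sup>2 * (l powr q / (l + c)\<^sup>2)) has_integral
      \<Psi> b - \<Psi> a + c / q\<^sup>2 * integral {a..b} (\<lambda>l. l powr q / (l + c)\<^sup>2)) {a..b}"
    by (rule has_integral_add)
  then show ?thesis by (simp add: integral_unique)
qed

lemma integral_weight_tendsto:
  assumes q: "0 < q" "q < 1" and c: "0 < c"
  shows "(\<lambda>N. integral {1 / real (Suc N)..real (Suc N)} (\<lambda>l. l powr q / (l + c)\<^sup>2))
    \<longlonglongrightarrow> c powr (q - 1) * weight_mass q"
proof -
  have "(\<lambda>N. weight_primitive q (real (Suc N) / c)) \<longlonglongrightarrow> weight_mass q"
    by (rule filterlim_compose[OF weight_primitive_at_top[OF q]]) (use c in real_asymp)
  moreover have "(\<lambda>N. weight_primitive q (1 / real (Suc N) / c)) \<longlonglongrightarrow> 0"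
    by (rule filterlim_compose[OF weight_primitive_at_0[OF q]]) (use c in real_asymp)
  ultimately have "(\<lambda>N. c powr (q - 1) * weight_primitive q (real (Suc N) / c)
      - c powr (q - 1) * weight_primitive q (1 / real (Suc N) / c)) \<longlonglongrightarrow> c powr (q - 1) * weight_mass q - c powr (q - 1) * 0"
    by (intro tendsto_intros)
  moreover have "integral {1 / real (Suc N)..real (Suc N)} (\<lambda>l. l powr q / (l + c)\<^sup>2)
      = c powr (q - 1) * weight_primitive q (real (Suc N) / c)
      - c powr (q - 1) * weight_primitive q (1 / real (Suc N) / c)" for N
    by (rule integral_weight[OF q(1) c]) (simp, rule inverse_Suc_le_Suc)
  ultimately show ?thesis by simp
qed

lemma integral_log_weight_tendsto:
  assumes q: "0 < q" "q < 1" and c: "0 < c"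
  shows "(\<lambda>N. integral {1 / real (Suc N)..real (Suc N)} (\<lambda>l. ln (1 + c / l) * l powr (q - 1)))
    \<longlonglongrightarrow> c powr q * weight_mass q / q\<^sup>2"
proof -
  define \<Psi> where "\<Psi> l = l powr q / q * ln (1 + c / l) + (l powr q * c / (l + c)) / q\<^sup>2" for l
  \<comment> \<open>At infinity both terms of \<Psi> are of order l^(q-1), which vanishes as q < 1;
    at 0 they are of order l^q ln (1/l) and l^q.\<close>
  have 1: "(\<lambda>N. \<Psi> (real (Suc N))) \<longlonglongrightarrow> 0"
    unfolding \<Psi>_def using q c by real_asymp
  have 2: "(\<lambda>N. \<Psi> (1 / real (Suc N))) \<longlonglongrightarrow> 0"
    unfolding \<Psi>_def using q c by real_asymp
  have "(\<lambda>N. \<Psi> (real (Suc N)) - \<Psi> (1 / real (Suc N)) + c / q\<^sup>2 * integral {1 / real (Suc N)..real (Suc N)} (\<lambda>l. l powr q / (l + c)\<^sup>2))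
      \<longlonglongrightarrow> 0 - 0 + c / q\<^sup>2 * (c powr (q - 1) * weight_mass q)"
    by (intro tendsto_intros 1 2 integral_weight_tendsto q c)
  moreover have "integral {1 / real (Suc N)..real (Suc N)} (\<lambda>l. ln (1 + c / l) * l powr (q - 1))
      = \<Psi> (real (Suc N)) - \<Psi> (1 / real (Suc N)) + c / q\<^sup>2 * integral {1 / real (Suc N)..real (Suc N)} (\<lambda>l. l powr q / (l + c)\<^sup>2)" for N
    unfolding \<Psi>_def by (rule integral_log_weight[OF q(1) c]) (simp, rule inverse_Suc_le_Suc)
  moreover have "0 - 0 + c / q\<^sup>2 * (c powr (q - 1) * weight_mass q) = c powr q * weight_mass q / q\<^sup>2"
  proof -
    have "c powr q = c * c powr (q - 1)" using c by (simp add: powr_diff)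
    then show ?thesis by simp
  qed
  ultimately show ?thesis by (simp only:)
qed

lemma integrable_log_weight:
  assumes "0 \<le> c" "0 < a"
  shows "(\<lambda>l::real. ln (1 + c / l) * l powr (q - 1)) integrable_on {a..b}"
proof (intro integrable_continuous_real continuous_intros ballI)
  fix l assume "l \<in> {a..b}"
  then have "0 < 1 + c / l" using assms by (intro add_pos_nonneg) auto
  then show "1 + c / l \<noteq> 0" by simp
qed (use assms in auto)

text \<open>The integrand is nonnegative, so truncated integrals increase to their limit. The value
  c = 0 is included for vanishing singular values; both sides are then 0.\<close>

lemma integral_log_weight_le:
  assumes q: "0 < q" "q < 1" and c: "0 \<le> c"
  shows "integral {1 / real (Suc N)..real (Suc N)} (\<lambda>l. ln (1 + c / l) * l powr (q - 1))
    \<le> c powr q * weight_mass q / q\<^sup>2"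
proof (cases "c = 0")
  case False
  then have c': "0 < c" using c by simp
  show ?thesis
  proof (rule incseq_le[OF _ integral_log_weight_tendsto[OF q c']])
    have "integral {1 / real (Suc m)..real (Suc m)} (\<lambda>l. ln (1 + c / l) * l powr (q - 1))
        \<le> integral {1 / real (Suc n)..real (Suc n)} (\<lambda>l. ln (1 + c / l) * l powr (q - 1))" if "m \<le> n" for m n
    proof (rule integral_subset_le)
      have "1 / real (Suc n) \<le> 1 / real (Suc m)" using that by (intro frac_le) simp_all
      moreover have "real (Suc m) \<le> real (Suc n)" using that by simp
      ultimately show "{1 / real (Suc m)..real (Suc m)} \<subseteq> {1 / real (Suc n)..real (Suc n)}"
        by (simp add: atLeastatMost_subset_iff)
      show "\<forall>l\<in>{1 / real (Suc n)..real (Suc n)}. 0 \<le> ln (1 + c / l) * l powr (q - 1)"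
      proof
        fix l assume "l \<in> {1 / real (Suc n)..real (Suc n)}"
        moreover have "0 < 1 / real (Suc n)" by simp
        ultimately have "0 < l" unfolding atLeastAtMost_iff by linarith
        then show "0 \<le> ln (1 + c / l) * l powr (q - 1)" using c by (intro mult_nonneg_nonneg ln_ge_zero) auto
      qed
    qed (auto intro!: integrable_log_weight c)
    then show "incseq (\<lambda>N. integral {1 / real (Suc N)..real (Suc N)} (\<lambda>l. ln (1 + c / l) * l powr (q - 1)))"
      by (rule monoI)
  qed
qed simp

subsection \<open>Compressions to finite-dimensional subspaces\<close>

lemma frame_exists:
  fixes X :: "'a::chilbert_space set"
  assumes "finite X"
  obtains n and e :: "nat \<Rightarrow> 'a" where "frame n e" "X \<subseteq> complex_vector.span (e ` {..<n})"
proof -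
  have "orthonormal ({} :: 'a set)" by (simp add: orthonormal_def)
  then obtain B where B: "B \<subseteq> complex_vector.span X" "orthonormal B"
    "\<And>x. x \<in> complex_vector.span X \<Longrightarrow> \<forall>v\<in>B. cinner x v = 0 \<Longrightarrow> norm x \<noteq> 1"
    using maximal_orthonormal_extension[of "{}" "complex_vector.span X"] by blast
  have fin: "finite B" using card_orthonormal_le[OF assms B(2,1)] by simp
  have span: "complex_vector.span B = complex_vector.span X"
    by (rule span_maximal_orthonormal[OF complex_vector.subspace_span fin B(2,1,3)])
  obtain b where b: "bij_betw b {..<card B} B"
    using finite_same_card_bij[of "{..<card B}" B] fin by auto
  have "X \<subseteq> complex_vector.span (b ` {..<card B})"
    using b span complex_vector.span_superset[of X] by (simp add: bij_betw_def)
  then show ?thesis using that frame_of_bij[OF B(2) b] by blast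
qed

definition frame_proj :: "nat \<Rightarrow> (nat \<Rightarrow> 'a::chilbert_space) \<Rightarrow> 'a \<Rightarrow> 'a" where
  "frame_proj n e x = (\<Sum>i<n. cinner x (e i) *\<^sub>C e i)"

definition mat_of :: "nat \<Rightarrow> (nat \<Rightarrow> 'a::chilbert_space) \<Rightarrow> ('a \<Rightarrow> 'a) \<Rightarrow> complex Matrix.mat" where
  "mat_of n e T = Matrix.mat n n (\<lambda>(i, j). cinner (T (e j)) (e i))"

lemma mat_of_carrier [simp]: "mat_of n e T \<in> carrier_mat n n"
  by (simp add: mat_of_def)

lemma cinner_frame_proj: "cinner (frame_proj n e x) y = cinner x (frame_proj n e y)"
proof -
  have "cinner (frame_proj n e x) y = (\<Sum>i<n. cinner x (e i) * cinner (e i) y)"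
    by (simp add: frame_proj_def cinner_sum_left cinner_scaleC_left)
  also have "\<dots> = (\<Sum>i<n. cnj (cinner y (e i)) * cinner x (e i))"
    by (intro sum.cong refl) (simp add: cinner_commute[of _ y])
  also have "\<dots> = cinner x (frame_proj n e y)"
    by (simp add: frame_proj_def cinner_sum_right cinner_scaleC_right)
  finally show ?thesis .
qed

lemma frame_proj_eq:
  "frame n e \<Longrightarrow> x \<in> complex_vector.span (e ` {..<n}) \<Longrightarrow> frame_proj n e x = x"
  unfolding frame_proj_def by (rule frame_expansion[symmetric])

lemma frame_proj_span: "frame_proj n e x \<in> complex_vector.span (e ` {..<n})"
  unfolding frame_proj_def
  by (intro complex_vector.span_sum complex_vector.span_scale complex_vector.span_base) auto

lemma norm_frame_proj_le:
  assumes "frame n e"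
  shows "norm (frame_proj n e x) \<le> norm x"
proof (cases "frame_proj n e x = 0")
  case False
  have "complex_of_real ((norm (frame_proj n e x))\<^sup>2) = cinner x (frame_proj n e x)"
    using cinner_frame_proj[of n e x "frame_proj n e x"] frame_proj_eq[OF assms frame_proj_span]
    by (simp only: cinner_self)
  then have "(norm (frame_proj n e x))\<^sup>2 = cmod (cinner x (frame_proj n e x))"
    by (metis norm_of_real abs_of_nonneg zero_le_power2)
  also have "\<dots> \<le> norm x * norm (frame_proj n e x)" by (rule norm_cinner_le)
  finally show ?thesis using False by (simp add: power2_eq_square)
qed simp

lemma op_mat_mat_of:
  assumes T: "bounded_clinear T"
  shows "op_mat n e (mat_of n e T) x = frame_proj n e (T (frame_proj n e x))"
proof -
  have "T (frame_proj n e x) = (\<Sum>j<n. cinner x (e j) *\<^sub>C T (e j))"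
    by (simp add: frame_proj_def bounded_clinear_sum[OF T] bounded_clinear_scaleC[OF T])
  then have "frame_proj n e (T (frame_proj n e x))
      = (\<Sum>i<n. (\<Sum>j<n. cinner x (e j) * cinner (T (e j)) (e i)) *\<^sub>C e i)"
    by (simp add: frame_proj_def cinner_sum_left cinner_scaleC_left)
  also have "\<dots> = op_mat n e (mat_of n e T) x"
    unfolding op_mat_alt by (intro sum.cong refl arg_cong2[where f = "(*\<^sub>C)"]) (simp add: mat_of_def mult.commute)
  finally show ?thesis by (rule sym)
qed

lemma mat_of_add_scaled:
  "mat_of n e (\<lambda>x. S x + c *\<^sub>C T x) = mat_of n e S + c \<cdot>\<^sub>m mat_of n e T"
  by (intro eq_matI) (simp_all add: mat_of_def cinner_add_left cinner_scaleC_left)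

text \<open>With P the frame projection, |P T P x| \<le> |T P x|, so
  \<open>sum_le_schatten_sum\<close> bounds every finite family approximating the sum of the
  compression.\<close>

lemma schatten_sum_compression_le:
  assumes e: "frame n e" and T: "T \<in> schatten_class p" and p: "0 < p"
  shows "schatten_sum p (op_mat n e (mat_of n e T)) \<le> schatten_sum p T"
proof (rule ccontr)
  let ?R = "op_mat n e (mat_of n e T)"
  assume "\<not> ?thesis"
  then have "schatten_sum p T < schatten_sum p ?R" by simp
  then obtain F where F: "finite F" "orthonormal F"
    "\<And>v w. v \<in> F \<Longrightarrow> w \<in> F \<Longrightarrow> v \<noteq> w \<Longrightarrow> cinner (?R v) (?R w) = 0"
    "schatten_sum p T < (\<Sum>v\<in>F. norm (?R v) powr p)"
    using schatten_sum_lower_approx[OF schatten_class_op_mat[OF e]] by metis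
  note Tb = compact_operator_bounded_clinear[OF schatten_class_compact[OF T]]
  have "(\<Sum>v\<in>F. max 0 (norm (?R v) - 0) powr p) \<le> schatten_sum p T"
  proof (rule sum_le_schatten_sum[OF T p compact_operator_bounded_clinear[OF compact_operator_op_mat] F(1)])
    fix x y
    show "norm (?R x) \<le> norm (T (frame_proj n e x)) + 0 * norm x"
      unfolding op_mat_mat_of[OF Tb] using norm_frame_proj_le[OF e] by simp
    show "cinner (frame_proj n e x) y = cinner x (frame_proj n e y)" by (rule cinner_frame_proj)
    show "norm (frame_proj n e x) \<le> norm x" by (rule norm_frame_proj_le[OF e])
  qed (use F in \<open>auto simp: orthonormal_def\<close>)
  then show False using F(4) by simp
qed

text \<open>The span contains F and its image, so the compression coincides with T on F and the
  images stay orthogonal.\<close>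

lemma schatten_sum_compression_ge:
  assumes e: "frame n e" and T: "bounded_clinear T" and p: "0 < p" and F: "finite F" "orthonormal F"
    and orth: "\<And>v w. v \<in> F \<Longrightarrow> w \<in> F \<Longrightarrow> v \<noteq> w \<Longrightarrow> cinner (T v) (T w) = 0"
    and span: "F \<subseteq> complex_vector.span (e ` {..<n})" "T ` F \<subseteq> complex_vector.span (e ` {..<n})"
  shows "(\<Sum>v\<in>F. norm (T v) powr p) \<le> schatten_sum p (op_mat n e (mat_of n e T))"
proof -
  let ?R = "op_mat n e (mat_of n e T)"
  have R: "?R v = T v" if "v \<in> F" for v
    unfolding op_mat_mat_of[OF T] using that span frame_proj_eq[OF e] by (simp add: image_subset_iff subset_iff)
  have "(\<Sum>v\<in>F. max 0 (norm (?R v) - 0) powr p) \<le> schatten_sum p ?R"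
    by (rule sum_le_schatten_sum[OF schatten_class_op_mat[OF e] p
          compact_operator_bounded_clinear[OF compact_operator_op_mat] F(1), where P = "\<lambda>x. x" and Q = "\<lambda>x. x"])
      (use F(2) orth R in \<open>auto simp: orthonormal_def\<close>)
  then show ?thesis using R by simp
qed

text \<open>Source of the denominator in the theorem: a bound valid on the whole disc and
  independent of the chosen frame.\<close>

lemma onorm_compression_le:
  fixes A B :: "'a::chilbert_space \<Rightarrow> 'a"
  assumes e: "frame n e" and A: "bounded_clinear A" and B: "bounded_clinear B" and z: "cmod z \<le> t"
  shows "onorm (op_mat n e (mat_of n e A + z \<cdot>\<^sub>m mat_of n e B)) \<le> onorm A + t * onorm B"
proof (rule onorm_bound)
  note Al = bounded_clinear_bounded_linear[OF A]
  note Bl = bounded_clinear_bounded_linear[OF B]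
  have "0 \<le> t" using z norm_ge_zero[of z] by linarith
  then show "0 \<le> onorm A + t * onorm B"
    by (intro add_nonneg_nonneg mult_nonneg_nonneg onorm_pos_le Al Bl)
  fix x
  have T: "bounded_clinear (\<lambda>x. A x + z *\<^sub>C B x)" by (intro bounded_clinear_plus bounded_clinear_scaled A B)
  let ?y = "frame_proj n e x"
  have y: "norm ?y \<le> norm x" by (rule norm_frame_proj_le[OF e])
  have "norm (op_mat n e (mat_of n e A + z \<cdot>\<^sub>m mat_of n e B) x) \<le> norm (A ?y + z *\<^sub>C B ?y)"
    unfolding mat_of_add_scaled[symmetric] op_mat_mat_of[OF T] by (rule norm_frame_proj_le[OF e])
  also have "\<dots> \<le> norm (A ?y) + cmod z * norm (B ?y)"
    using norm_triangle_ineq[of "A ?y" "z *\<^sub>C B ?y"] by simp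
  also have "norm (A ?y) \<le> onorm A * norm x"
    using onorm[OF Al, of ?y] mult_left_mono[OF y onorm_pos_le[OF Al]] by linarith
  also have "cmod z * norm (B ?y) \<le> t * (onorm B * norm x)"
  proof (rule mult_mono[OF z])
    show "norm (B ?y) \<le> onorm B * norm x"
      using onorm[OF Bl, of ?y] mult_left_mono[OF y onorm_pos_le[OF Bl]] by linarith
    show "0 \<le> t" using z norm_ge_zero[of z] by linarith
  qed simp
  finally show "norm (op_mat n e (mat_of n e A + z \<cdot>\<^sub>m mat_of n e B) x) \<le> (onorm A + t * onorm B) * norm x"
    by (simp add: distrib_right mult.assoc)
qed

text \<open>s^r \<le> |T|^(r-p) s^p with the operator norm |T|. For B and r = 2 this makes
  \<open>schatten_sum 2 B\<close> a convergent sum instead of the default 0 of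
  \<open>infsum\<close>.\<close>

lemma schatten_class_mono:
  assumes T: "T \<in> schatten_class p" and p: "0 < p" "p \<le> r"
  shows "T \<in> schatten_class r"
proof -
  note Tc = schatten_class_compact[OF T]
  note Tl = bounded_clinear_bounded_linear[OF compact_operator_bounded_clinear[OF Tc]]
  obtain B where B: "singular_system T B" "(\<lambda>v. norm (T v) powr p) summable_on B"
    "schatten_sum p T = (\<Sum>\<^sub>\<infinity>v\<in>B. norm (T v) powr p)"
    by (rule schatten_class_singular_system[OF T])
  let ?K = "onorm T powr (r - p)"
  have "(\<lambda>v. norm (T v) powr r) summable_on B"
  proof (rule summable_on_comparison_test)
    show "(\<lambda>v. ?K * norm (T v) powr p) summable_on B" by (intro summable_on_cmult_right B(2))
    fix v assume v: "v \<in> B"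
    have "norm v = 1" using B(1) v by (simp add: singular_system_def orthonormal_def)
    then have "norm (T v) \<le> onorm T" using onorm[OF Tl, of v] by simp
    then have "norm (T v) powr (r - p) \<le> ?K" using p by (intro powr_mono2) auto
    moreover have "norm (T v) powr r = norm (T v) powr (r - p) * norm (T v) powr p"
      by (simp add: powr_add[symmetric])
    ultimately show "norm (T v) powr r \<le> ?K * norm (T v) powr p" by (simp add: mult_right_mono)
  qed simp
  then show ?thesis using Tc singular_system_summable_iff(1)[OF B(1), of r] by (simp add: schatten_class_def)
qed

lemma schatten_sum_op_mat_2:
  assumes e: "frame n e" and A: "A \<in> carrier_mat n n"
  shows "schatten_sum 2 (op_mat n e A) = frob2 n A"
proof -
  obtain U s V where svd: "is_svd n A U s V" and S: "\<forall>p>0. schatten_sum p (op_mat n e A) = (\<Sum>i<n. s i powr p)"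
    using svd_exists[OF e A] by blast
  have "(\<Sum>i<n. s i powr 2) = (\<Sum>i<n. (s i)\<^sup>2)"
    using svd by (intro sum.cong refl) (simp add: is_svd_def)
  then show ?thesis using S is_svd_frob2[OF svd] by simp
qed

subsection \<open>Integrability over the circle\<close>

text \<open>Open superlevel sets give Borel measurability, and the quasi-triangle inequality gives a
  constant majorant. \<open>integral\<close> is 0 for non-integrable functions, so this precedes any
  comparison of integrals over the circle.\<close>

lemma integrable_schatten_sum_circle:
  fixes A B :: "'a::chilbert_space \<Rightarrow> 'a"
  assumes A: "A \<in> schatten_class p" and B: "B \<in> schatten_class p" and p: "0 < p" and t: "0 < t"
  shows "(\<lambda>\<theta>. schatten_sum p (\<lambda>x. A x + (complex_of_real t * cis \<theta>) *\<^sub>C B x)) integrable_on {0..2 * pi}"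
proof -
  let ?\<Phi> = "\<lambda>\<theta>. schatten_sum p (\<lambda>x. A x + (complex_of_real t * cis \<theta>) *\<^sub>C B x)"
  define C where "C = 2 powr p * (schatten_sum p A + t powr p * schatten_sum p B)"
  have bound: "norm (?\<Phi> \<theta>) \<le> C" for \<theta>
    using schatten_class_add_scaled(2)[OF A B p, of "complex_of_real t * cis \<theta>"] t
    by (simp add: C_def norm_mult abs_of_nonneg[OF schatten_sum_nonneg])
  have "?\<Phi> \<in> borel_measurable borel"
  proof (rule borel_measurableI_greater)
    fix c
    have "open ((\<lambda>\<theta>. complex_of_real t * cis \<theta>) -` {z. c < schatten_sum p (\<lambda>x. A x + z *\<^sub>C B x)})"
      by (intro open_vimage schatten_sum_lower_semicontinuous A B p continuous_intros continuous_on_cis)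
    then show "{\<theta> \<in> space borel. c < ?\<Phi> \<theta>} \<in> sets borel" by (simp add: vimage_def)
  qed
  then have "?\<Phi> \<in> borel_measurable (lebesgue_on {0..2 * pi})"
    by (intro measurable_restrict_space1 measurable_completion) simp
  then show ?thesis
    by (rule measurable_bounded_by_integrable_imp_integrable[where g = "\<lambda>_. C"])
      (use bound in auto)
qed

subsection \<open>The lower bound\<close>

text \<open>Subtracting n ln l, the value for A = 0, leaves decay of order 1/l at infinity, so that
  the weight l^(q-1) becomes integrable there. The subtracted term is independent of A and cancels
  in the mean inequality.\<close>

lemma ln_det_gram_svd:
  assumes svd: "is_svd n A U s V" and l: "0 < l"
  shows "ln (Re (Determinant.det (gram n l A))) - real n * ln l = (\<Sum>i<n. ln (1 + (s i)\<^sup>2 / l))"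
proof -
  have pos: "0 < l + (s i)\<^sup>2" for i using l by (intro add_pos_nonneg) auto
  then have nz: "l + (s i)\<^sup>2 \<noteq> 0" for i by (metis less_irrefl)
  have "ln (Re (Determinant.det (gram n l A))) = (\<Sum>i<n. ln (l + (s i)\<^sup>2))"
    unfolding is_svd_det_gram[OF svd] Re_complex_of_real
    by (intro ln_prod) (simp_all add: nz)
  moreover have "ln (1 + (s i)\<^sup>2 / l) = ln (l + (s i)\<^sup>2) - ln l" for i
  proof -
    have "1 + (s i)\<^sup>2 / l = (l + (s i)\<^sup>2) / l" using l by (simp add: field_simps)
    then show ?thesis using pos[of i] l by (simp add: ln_div)
  qed
  ultimately show ?thesis by (simp add: sum_subtractf)
qed

text \<open>The singular values enter through
  \<open>\<integral> ln (1 + s\<^sup>2 / l) l\<^bsup>p/2 - 1\<^esup> dl = const \<cdot> s\<^bsup>p\<^esup>\<close>; truncating the integral to \<open>[1/N, N]\<close> makes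
  all the integrands continuous.\<close>

lemma compression_mean_less_2:
  fixes e :: "nat \<Rightarrow> 'a::chilbert_space" and A B :: "'a \<Rightarrow> 'a"
  assumes e: "frame n e" and A: "A \<in> schatten_class p" and B: "B \<in> schatten_class p"
    and p: "0 < p" "p < 2" and t: "0 < t" and M: "0 < onorm A + t * onorm B"
  shows "2 * pi * (schatten_sum p (op_mat n e (mat_of n e A))
      + p\<^sup>2 / 4 * t\<^sup>2 * frob2 n (mat_of n e B) * (onorm A + t * onorm B) powr (p - 2))
    \<le> integral {0..2 * pi} (\<lambda>\<theta>. schatten_sum p (\<lambda>x. A x + (complex_of_real t * cis \<theta>) *\<^sub>C B x))"
proof -
  define q where "q = p / 2"
  have q: "0 < q" "q < 1" using p by (auto simp: q_def)
  \<comment> \<open>The full weighted integral of ln (1 + s^2 / l) equals W s^p.\<close>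
  define W where "W = weight_mass q / q\<^sup>2"
  have W: "0 < W" using weight_mass_pos[OF q] q by (simp add: W_def)
  define a where "a = mat_of n e A"
  define b where "b = mat_of n e B"
  have ac: "a \<in> carrier_mat n n" and bc: "b \<in> carrier_mat n n" by (simp_all add: a_def b_def)
  define M where "M = onorm A + t * onorm B"
  have M0: "0 < M" using M by (simp add: M_def)
  note Ab = compact_operator_bounded_clinear[OF schatten_class_compact[OF A]]
  note Bb = compact_operator_bounded_clinear[OF schatten_class_compact[OF B]]
  define z where "z \<theta> = complex_of_real t * cis \<theta>" for \<theta>
  define T where "T \<theta> = a + z \<theta> \<cdot>\<^sub>m b" for \<theta>
  have Tc: "a + w \<cdot>\<^sub>m b \<in> carrier_mat n n" for w using ac bc by simp
  let ?I = "{0..2 * pi}"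
  let ?\<Phi> = "\<lambda>\<theta>. schatten_sum p (\<lambda>x. A x + z \<theta> *\<^sub>C B x)"
  define g where "g w l = (ln (Re (Determinant.det (gram n l (a + w \<cdot>\<^sub>m b)))) - real n * ln l) * l powr (q - 1)"
    for w and l :: real
  let ?J = "\<lambda>N. {1 / real (Suc N)..real (Suc N)}"
  have Jpos: "0 < l" if "l \<in> ?J N" for l N
  proof -
    have "0 < 1 / real (Suc N)" by simp
    then show ?thesis using that unfolding atLeastAtMost_iff by linarith
  qed
  have spow: "(x\<^sup>2) powr q = x powr p" if "0 \<le> x" for x :: real
    using that by (simp add: q_def powr_powr flip: powr_numeral)
  have g_int: "integral (?J N) (g w) = (\<Sum>i<n. integral (?J N) (\<lambda>l. ln (1 + (s i)\<^sup>2 / l) * l powr (q - 1)))"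
    if svd: "is_svd n (a + w \<cdot>\<^sub>m b) U s V" for w U s V N
  proof -
    have "integral (?J N) (g w) = integral (?J N) (\<lambda>l. \<Sum>i<n. ln (1 + (s i)\<^sup>2 / l) * l powr (q - 1))"
      by (rule Henstock_Kurzweil_Integration.integral_cong)
        (use Jpos in \<open>simp add: g_def ln_det_gram_svd[OF svd] sum_distrib_right\<close>)
    also have "\<dots> = (\<Sum>i<n. integral (?J N) (\<lambda>l. ln (1 + (s i)\<^sup>2 / l) * l powr (q - 1)))"
      by (rule integral_sum) (auto intro: integrable_log_weight)
    finally show ?thesis .
  qed
  \<comment> \<open>Truncating the integral and compressing the operator both err downwards, the
    harmless direction for a lower bound on the circle mean.\<close>
  have upper: "integral (?J N) (g (z \<theta>)) \<le> W * ?\<Phi> \<theta>" for N \<theta>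
  proof -
    obtain U s V where svd: "is_svd n (a + z \<theta> \<cdot>\<^sub>m b) U s V"
      and S: "\<forall>p>0. schatten_sum p (op_mat n e (a + z \<theta> \<cdot>\<^sub>m b)) = (\<Sum>i<n. s i powr p)"
      using svd_exists[OF e Tc] by blast
    have s0: "0 \<le> s i" if "i < n" for i using svd that by (simp add: is_svd_def)
    have "integral (?J N) (g (z \<theta>)) \<le> (\<Sum>i<n. ((s i)\<^sup>2) powr q * weight_mass q / q\<^sup>2)"
      unfolding g_int[OF svd] by (intro sum_mono integral_log_weight_le q) simp
    also have "\<dots> = W * (\<Sum>i<n. s i powr p)"
      unfolding sum_distrib_left by (intro sum.cong refl) (simp add: spow s0 W_def)
    also have "(\<Sum>i<n. s i powr p) = schatten_sum p (op_mat n e (a + z \<theta> \<cdot>\<^sub>m b))" using S p by simp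
    also have "\<dots> \<le> ?\<Phi> \<theta>"
      unfolding a_def b_def mat_of_add_scaled[symmetric]
      by (rule schatten_sum_compression_le[OF e schatten_class_add_scaled(1)[OF A B p(1)] p(1)])
    finally show ?thesis using W by simp
  qed
  obtain U s V where svd: "is_svd n a U s V" and S: "\<forall>p>0. schatten_sum p (op_mat n e a) = (\<Sum>i<n. s i powr p)"
    using svd_exists[OF e ac] by blast
  have a0: "a + 0 \<cdot>\<^sub>m b = a" using ac bc by (intro eq_matI) auto
  have contg: "continuous_on S (\<lambda>x. g (u x) (v x))"
    if "continuous_on S u" "continuous_on S v" "\<And>x. x \<in> S \<Longrightarrow> 0 < v x" for S :: "'z::topological_space set" and u v
  proof -
    have "Re (Determinant.det (gram n (v x) (a + u x \<cdot>\<^sub>m b))) \<noteq> 0" if "x \<in> S" for x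
      using det_gram_pos[OF e Tc[of "u x"] \<open>\<And>x. x \<in> S \<Longrightarrow> 0 < v x\<close>[OF that]] by simp
    then have c1: "continuous_on S (\<lambda>x. ln (Re (Determinant.det (gram n (v x) (a + u x \<cdot>\<^sub>m b)))))"
      by (intro continuous_on_ln continuous_on_det_gram[OF ac bc that(2,1)] ballI)
    have v: "v x \<noteq> 0" if "x \<in> S" for x using \<open>\<And>x. x \<in> S \<Longrightarrow> 0 < v x\<close>[OF that] by simp
    have c2: "continuous_on S (\<lambda>x. ln (v x))" by (intro continuous_on_ln that(2) ballI v)
    have c3: "continuous_on S (\<lambda>x. v x powr (q - 1))" by (intro continuous_on_powr that(2) continuous_on_const ballI v)
    show ?thesis
      unfolding g_def
      by (rule continuous_on_mult[OF continuous_on_diff[OF c1 continuous_on_mult[OF continuous_on_const c2]] c3])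
  qed
  have contz: "continuous_on S (\<lambda>x. z (f x))" if "continuous_on S f" for S :: "'z::topological_space set" and f
    unfolding z_def by (intro continuous_intros continuous_on_compose2[OF continuous_on_cis[OF continuous_on_id] that]) auto
  \<comment> \<open>The value at the centre plus the gain, both truncated; its limit is the asserted
    lower bound multiplied by W.\<close>
  define L where "L N = 2 * pi * ((\<Sum>i<n. integral (?J N) (\<lambda>l. ln (1 + (s i)\<^sup>2 / l) * l powr (q - 1)))
      + t\<^sup>2 * frob2 n b * integral (?J N) (\<lambda>l. l powr q / (l + M\<^sup>2)\<^sup>2))" for N
  have LN: "L N \<le> W * integral ?I ?\<Phi>" for N
  proof -
    have inner: "2 * pi * (g 0 l + t\<^sup>2 * frob2 n b * (l powr q / (l + M\<^sup>2)\<^sup>2)) \<le> integral ?I (\<lambda>\<theta>. g (z \<theta>) l)"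
      if l: "0 < l" for l
    proof -
      let ?F = "\<lambda>w. ln (Re (Determinant.det (gram n l (a + w \<cdot>\<^sub>m b))))"
      have le: "2 * pi * (?F 0 + l * frob2 n b / (l + M\<^sup>2)\<^sup>2 * t\<^sup>2) \<le> integral ?I (\<lambda>\<theta>. ?F (z \<theta>))"
        unfolding z_def
        by (rule mean_ln_det_gram[OF e ac bc l t])
          (unfold a_def b_def M_def, rule onorm_compression_le[OF e Ab Bb])
      have int: "(\<lambda>\<theta>. ?F (z \<theta>)) integrable_on ?I"
      proof (intro integrable_continuous_real continuous_on_ln continuous_on_det_gram[OF ac bc]
          continuous_on_const contz continuous_on_id)
        show "\<forall>x\<in>?I. Re (Determinant.det (gram n l (a + z x \<cdot>\<^sub>m b))) \<noteq> 0"
          using det_gram_pos[OF e Tc l] by (metis less_irrefl)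
      qed
      have "integral ?I (\<lambda>\<theta>. g (z \<theta>) l) = (integral ?I (\<lambda>\<theta>. ?F (z \<theta>)) - 2 * pi * (real n * ln l)) * l powr (q - 1)"
      proof -
        have "integral ?I (\<lambda>\<theta>. g (z \<theta>) l) = integral ?I (\<lambda>\<theta>. ?F (z \<theta>) - real n * ln l) * l powr (q - 1)"
          unfolding g_def by (rule integral_mult_left)
        also have "integral ?I (\<lambda>\<theta>. ?F (z \<theta>) - real n * ln l)
            = integral ?I (\<lambda>\<theta>. ?F (z \<theta>)) - integral ?I (\<lambda>\<theta>::real. real n * ln l)"
          by (rule integral_diff[OF int integrable_const_ivl])
        finally show ?thesis by simp
      qed
      moreover have "2 * pi * (g 0 l + t\<^sup>2 * frob2 n b * (l powr q / (l + M\<^sup>2)\<^sup>2))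
        = (2 * pi * (?F 0 + l * frob2 n b / (l + M\<^sup>2)\<^sup>2 * t\<^sup>2) - 2 * pi * (real n * ln l)) * l powr (q - 1)"
      proof -
        have lq: "l powr q = l * l powr (q - 1)" using l by (simp add: powr_diff)
        define D where "D = (l + M\<^sup>2)\<^sup>2"
        show ?thesis unfolding g_def lq D_def[symmetric] by (simp add: algebra_simps)
      qed
      moreover have "(2 * pi * (?F 0 + l * frob2 n b / (l + M\<^sup>2)\<^sup>2 * t\<^sup>2) - 2 * pi * (real n * ln l)) * l powr (q - 1)
        \<le> (integral ?I (\<lambda>\<theta>. ?F (z \<theta>)) - 2 * pi * (real n * ln l)) * l powr (q - 1)"
        using le by (intro mult_right_mono) simp_all
      ultimately show ?thesis by simp
    qed
    have cont0: "continuous_on (?J N) (g 0)"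
      using contg[of "?J N" "\<lambda>_. 0" "\<lambda>l. l"] Jpos by (simp add: continuous_on_const continuous_on_id)
    have int0: "g 0 integrable_on ?J N" by (rule integrable_continuous_real[OF cont0])
    have intw: "(\<lambda>l. l powr q / (l + M\<^sup>2)\<^sup>2) integrable_on ?J N"
    proof (intro integrable_continuous_real continuous_intros)
      show "\<forall>l\<in>?J N. (l + M\<^sup>2)\<^sup>2 \<noteq> 0"
      proof
        fix l assume "l \<in> ?J N"
        then have "0 < l + M\<^sup>2" using Jpos by (intro add_pos_nonneg) auto
        then show "(l + M\<^sup>2)\<^sup>2 \<noteq> 0" by simp
      qed
    qed (use Jpos in force)+
    have "L N = integral (?J N) (\<lambda>l. 2 * pi * (g 0 l + t\<^sup>2 * frob2 n b * (l powr q / (l + M\<^sup>2)\<^sup>2)))"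
    proof -
      have "integral (?J N) (\<lambda>l. g 0 l + t\<^sup>2 * frob2 n b * (l powr q / (l + M\<^sup>2)\<^sup>2))
        = integral (?J N) (g 0) + t\<^sup>2 * frob2 n b * integral (?J N) (\<lambda>l. l powr q / (l + M\<^sup>2)\<^sup>2)"
        by (subst integral_add[OF int0 integrable_cmul[OF intw, of "t\<^sup>2 * frob2 n b", unfolded real_scaleR_def]])
          (simp only: integral_mult_right)
      moreover have "integral (?J N) (g 0) = (\<Sum>i<n. integral (?J N) (\<lambda>l. ln (1 + (s i)\<^sup>2 / l) * l powr (q - 1)))"
        using g_int[of 0 U s V N] svd by (simp only: a0)
      ultimately show ?thesis by (simp add: L_def)
    qed
    also have "\<dots> \<le> integral (?J N) (\<lambda>l. integral ?I (\<lambda>\<theta>. g (z \<theta>) l))"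
    proof (rule integral_le)
      show "(\<lambda>l. 2 * pi * (g 0 l + t\<^sup>2 * frob2 n b * (l powr q / (l + M\<^sup>2)\<^sup>2))) integrable_on ?J N"
        using integrable_cmul[OF integrable_add[OF int0 integrable_cmul[OF intw, of "t\<^sup>2 * frob2 n b"]], of "2 * pi"]
        by simp
      have "continuous_on (?J N) (\<lambda>l. integral (cbox 0 (2 * pi)) (\<lambda>\<theta>. g (z \<theta>) l))"
        by (rule integral_continuous_on_param)
          (use Jpos in \<open>auto simp: case_prod_beta intro!: contg contz continuous_intros\<close>)
      then show "(\<lambda>l. integral ?I (\<lambda>\<theta>. g (z \<theta>) l)) integrable_on ?J N"
        by (intro integrable_continuous_real) simp
      fix l assume "l \<in> ?J N"
      then show "2 * pi * (g 0 l + t\<^sup>2 * frob2 n b * (l powr q / (l + M\<^sup>2)\<^sup>2)) \<le> integral ?I (\<lambda>\<theta>. g (z \<theta>) l)"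
        by (intro inner Jpos)
    qed
    also have "\<dots> = integral ?I (\<lambda>\<theta>. integral (?J N) (g (z \<theta>)))"
    proof -
      have "continuous_on (cbox (1 / real (Suc N), 0) (real (Suc N), 2 * pi)) (\<lambda>(l, \<theta>). g (z \<theta>) l)"
        unfolding case_prod_beta
      proof (intro contg contz continuous_intros)
        fix x :: "real \<times> real" assume "x \<in> cbox (1 / real (Suc N), 0) (real (Suc N), 2 * pi)"
        then have "fst x \<in> ?J N" by (cases x) (simp add: cbox_Pair_eq)
        then show "0 < fst x" by (rule Jpos)
      qed
      from integral_swap_continuous[OF this] show ?thesis by simp
    qed
    also have "\<dots> \<le> integral ?I (\<lambda>\<theta>. W * ?\<Phi> \<theta>)"
    proof (rule integral_le)
      have "continuous_on ?I (\<lambda>\<theta>. integral (cbox (1 / real (Suc N)) (real (Suc N))) (\<lambda>l. g (z \<theta>) l))"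
      proof (rule integral_continuous_on_param)
        show "continuous_on (?I \<times> cbox (1 / real (Suc N)) (real (Suc N))) (\<lambda>(\<theta>, l). g (z \<theta>) l)"
          unfolding case_prod_beta
        proof (intro contg contz continuous_intros)
          fix x assume "x \<in> ?I \<times> cbox (1 / real (Suc N)) (real (Suc N))"
          then have "snd x \<in> ?J N" by (cases x) simp
          then show "0 < snd x" by (rule Jpos)
        qed
      qed
      then show "(\<lambda>\<theta>. integral (?J N) (g (z \<theta>))) integrable_on ?I"
        by (intro integrable_continuous_real) simp
      show "(\<lambda>\<theta>. W * ?\<Phi> \<theta>) integrable_on ?I"
        using integrable_cmul[OF integrable_schatten_sum_circle[OF A B p(1) t], of W] by (simp add: z_def)
    qed (rule upper)
    also have "\<dots> = W * integral ?I ?\<Phi>" by simp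
    finally show ?thesis .
  qed
  have "L \<longlonglongrightarrow> 2 * pi * ((\<Sum>i<n. s i powr p * W) + t\<^sup>2 * frob2 n b * ((M\<^sup>2) powr (q - 1) * weight_mass q))"
    unfolding L_def
  proof (intro tendsto_intros integral_weight_tendsto q)
    show "0 < M\<^sup>2" using M0 by simp
    fix i assume "i \<in> {..<n}"
    then have s0: "0 \<le> s i" using svd by (simp add: is_svd_def)
    show "(\<lambda>N. integral (?J N) (\<lambda>l. ln (1 + (s i)\<^sup>2 / l) * l powr (q - 1))) \<longlonglongrightarrow> s i powr p * W"
    proof (cases "s i = 0")
      case False
      then have "0 < (s i)\<^sup>2" by simp
      from integral_log_weight_tendsto[OF q this] show ?thesis by (simp add: spow s0 W_def)
    qed simp
  qed
  then have "2 * pi * ((\<Sum>i<n. s i powr p * W) + t\<^sup>2 * frob2 n b * ((M\<^sup>2) powr (q - 1) * weight_mass q))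
      \<le> W * integral ?I ?\<Phi>"
    by (rule LIMSEQ_le_const2) (use LN in blast)
  moreover have "(M\<^sup>2) powr (q - 1) = M powr (p - 2)"
    using M0 by (simp add: q_def powr_powr right_diff_distrib flip: powr_numeral)
  \<comment> \<open>The constant p^2/4 appears here as q^2, the ratio of the two weighted
    integrals.\<close>
  moreover have "weight_mass q = W * (p\<^sup>2 / 4)" using q by (simp add: W_def q_def power2_eq_square)
  moreover have "(\<Sum>i<n. s i powr p * W) = schatten_sum p (op_mat n e a) * W"
    using S p by (simp add: sum_distrib_right)
  ultimately have "W * (2 * pi * (schatten_sum p (op_mat n e a) + p\<^sup>2 / 4 * t\<^sup>2 * frob2 n b * M powr (p - 2)))
      \<le> W * integral ?I ?\<Phi>"
    by (simp add: algebra_simps)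
  then show ?thesis using W by (simp add: a_def b_def M_def z_def)
qed

text \<open>For q = 1 the weight integral diverges, but \<open>schatten_sum 2\<close> of a matrix is
  its sum of squared entries, and the cross term of each entry averages out.\<close>

lemma compression_mean_2:
  fixes e :: "nat \<Rightarrow> 'a::chilbert_space" and A B :: "'a \<Rightarrow> 'a"
  assumes e: "frame n e" and A: "A \<in> schatten_class 2" and B: "B \<in> schatten_class 2" and t: "0 < t"
  shows "2 * pi * (schatten_sum 2 (op_mat n e (mat_of n e A)) + t\<^sup>2 * frob2 n (mat_of n e B))
    \<le> integral {0..2 * pi} (\<lambda>\<theta>. schatten_sum 2 (\<lambda>x. A x + (complex_of_real t * cis \<theta>) *\<^sub>C B x))"
proof -
  define a where "a = mat_of n e A"
  define b where "b = mat_of n e B"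
  have ac: "a \<in> carrier_mat n n" and bc: "b \<in> carrier_mat n n" by (simp_all add: a_def b_def)
  let ?I = "{0..2 * pi}"
  let ?f = "\<lambda>i j \<theta>. (cmod (a $$ (i, j) + (complex_of_real t * b $$ (i, j)) * cis \<theta>))\<^sup>2"
  have int: "?f i j integrable_on ?I" for i j
    by (intro integrable_continuous_real continuous_intros continuous_on_cis)
  have frob: "frob2 n (a + (complex_of_real t * cis \<theta>) \<cdot>\<^sub>m b) = (\<Sum>i<n. \<Sum>j<n. ?f i j \<theta>)" for \<theta>
    unfolding frob2_def using ac bc by (intro sum.cong refl) (simp add: mult_ac)
  have "integral ?I (\<lambda>\<theta>. frob2 n (a + (complex_of_real t * cis \<theta>) \<cdot>\<^sub>m b))
      = (\<Sum>i<n. \<Sum>j<n. integral ?I (?f i j))"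
    unfolding frob by (simp add: integral_sum integrable_sum int)
  also have "\<dots> = 2 * pi * (frob2 n a + t\<^sup>2 * frob2 n b)"
    unfolding integral_circle_norm_square
    using t by (simp add: frob2_def norm_mult power_mult_distrib sum.distrib sum_distrib_left distrib_left)
  finally have eq: "integral ?I (\<lambda>\<theta>. frob2 n (a + (complex_of_real t * cis \<theta>) \<cdot>\<^sub>m b))
      = 2 * pi * (frob2 n a + t\<^sup>2 * frob2 n b)" .
  have "integral ?I (\<lambda>\<theta>. frob2 n (a + (complex_of_real t * cis \<theta>) \<cdot>\<^sub>m b))
    \<le> integral ?I (\<lambda>\<theta>. schatten_sum 2 (\<lambda>x. A x + (complex_of_real t * cis \<theta>) *\<^sub>C B x))"
  proof (rule integral_le)
    show "(\<lambda>\<theta>. frob2 n (a + (complex_of_real t * cis \<theta>) \<cdot>\<^sub>m b)) integrable_on ?I"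
      unfolding frob by (intro integrable_sum int) simp_all
    show "(\<lambda>\<theta>. schatten_sum 2 (\<lambda>x. A x + (complex_of_real t * cis \<theta>) *\<^sub>C B x)) integrable_on ?I"
      by (rule integrable_schatten_sum_circle[OF A B _ t]) simp
    fix \<theta>
    have "frob2 n (a + (complex_of_real t * cis \<theta>) \<cdot>\<^sub>m b)
        = schatten_sum 2 (op_mat n e (a + (complex_of_real t * cis \<theta>) \<cdot>\<^sub>m b))"
      by (rule schatten_sum_op_mat_2[OF e, symmetric]) (use ac bc in simp)
    also have "\<dots> \<le> schatten_sum 2 (\<lambda>x. A x + (complex_of_real t * cis \<theta>) *\<^sub>C B x)"
      unfolding a_def b_def mat_of_add_scaled[symmetric]
      by (rule schatten_sum_compression_le[OF e schatten_class_add_scaled(1)[OF A B]]) simp_all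
    finally show "frob2 n (a + (complex_of_real t * cis \<theta>) \<cdot>\<^sub>m b)
      \<le> schatten_sum 2 (\<lambda>x. A x + (complex_of_real t * cis \<theta>) *\<^sub>C B x)" .
  qed
  from this[unfolded eq] show ?thesis
    by (simp only: a_def b_def schatten_sum_op_mat_2[OF e mat_of_carrier])
qed

lemma onorm_pos_of_nonzero:
  assumes "bounded_linear f" "f \<noteq> (\<lambda>x. 0)"
  shows "0 < onorm f"
proof -
  have "\<not> (\<forall>x. f x = 0)" using assms(2) by auto
  then show ?thesis using onorm_pos_lt[OF assms(1)] by blast
qed

text \<open>F exhausts most of \<open>schatten_sum p A\<close> and H most of
  \<open>schatten_sum 2 B\<close>; two families are taken because the singular vectors of A and B
  are unrelated. One frame contains both with their images, and k involves the norms of the full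
  operators, so it does not change with the frame.\<close>

theorem schatten_mean_lower_bound:
  fixes A B :: "'a::chilbert_space \<Rightarrow> 'a"
  assumes p: "0 < p" "p \<le> 2" and A: "A \<in> schatten_class p" and B: "B \<in> schatten_class p"
    and t: "0 < t" and "B \<noteq> (\<lambda>x. 0)"
  shows "2 * pi * (schatten_sum p A + p\<^sup>2 / 4 * t\<^sup>2 * schatten_sum 2 B * (onorm A + t * onorm B) powr (p - 2))
    \<le> integral {0..2 * pi} (\<lambda>\<theta>. schatten_sum p (\<lambda>x. A x + (complex_of_real t * cis \<theta>) *\<^sub>C B x))"
proof -
  define I where "I = integral {0..2 * pi} (\<lambda>\<theta>. schatten_sum p (\<lambda>x. A x + (complex_of_real t * cis \<theta>) *\<^sub>C B x))"
  note Ab = compact_operator_bounded_clinear[OF schatten_class_compact[OF A]]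
  note Bb = compact_operator_bounded_clinear[OF schatten_class_compact[OF B]]
  have M: "0 < onorm A + t * onorm B"
    using onorm_pos_of_nonzero[OF bounded_clinear_bounded_linear[OF Bb] assms(6)]
      onorm_pos_le[OF bounded_clinear_bounded_linear[OF Ab]] t
    by (intro add_nonneg_pos mult_pos_pos)
  define k where "k = p\<^sup>2 / 4 * t\<^sup>2 * (onorm A + t * onorm B) powr (p - 2)"
  have k: "0 < k" using p t M by (simp add: k_def)
  have B2: "B \<in> schatten_class 2" by (rule schatten_class_mono[OF B p])
  have approx: "2 * pi * (x + k * y) \<le> I" if x: "x < schatten_sum p A" and y: "y < schatten_sum 2 B" for x y
  proof -
    obtain F where F: "finite F" "orthonormal F"
      "\<And>v w. v \<in> F \<Longrightarrow> w \<in> F \<Longrightarrow> v \<noteq> w \<Longrightarrow> cinner (A v) (A w) = 0" "x < (\<Sum>v\<in>F. norm (A v) powr p)"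
      using schatten_sum_lower_approx[OF A x] by metis
    obtain H where H: "finite H" "orthonormal H"
      "\<And>v w. v \<in> H \<Longrightarrow> w \<in> H \<Longrightarrow> v \<noteq> w \<Longrightarrow> cinner (B v) (B w) = 0" "y < (\<Sum>v\<in>H. norm (B v) powr 2)"
      using schatten_sum_lower_approx[OF B2 y] by metis
    have "finite (F \<union> A ` F \<union> H \<union> B ` H)" using F(1) H(1) by simp
    then obtain n and e :: "nat \<Rightarrow> 'a" where e: "frame n e"
      and span: "F \<union> A ` F \<union> H \<union> B ` H \<subseteq> complex_vector.span (e ` {..<n})"
      by (rule frame_exists)
    have 1: "(\<Sum>v\<in>F. norm (A v) powr p) \<le> schatten_sum p (op_mat n e (mat_of n e A))"
      by (rule schatten_sum_compression_ge[OF e Ab p(1) F(1,2) F(3)]) (use span in auto)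
    have "(\<Sum>v\<in>H. norm (B v) powr 2) \<le> schatten_sum 2 (op_mat n e (mat_of n e B))"
      by (rule schatten_sum_compression_ge[OF e Bb _ H(1,2) H(3)]) (use span in auto)
    also have "\<dots> = frob2 n (mat_of n e B)" by (rule schatten_sum_op_mat_2[OF e mat_of_carrier])
    finally have 2: "(\<Sum>v\<in>H. norm (B v) powr 2) \<le> frob2 n (mat_of n e B)" .
    have "x + k * y \<le> schatten_sum p (op_mat n e (mat_of n e A)) + k * frob2 n (mat_of n e B)"
      using 1 2 F(4) H(4) k by (intro add_mono mult_left_mono) auto
    then have "2 * pi * (x + k * y)
        \<le> 2 * pi * (schatten_sum p (op_mat n e (mat_of n e A)) + k * frob2 n (mat_of n e B))"
      by (intro mult_left_mono) auto
    also have "\<dots> \<le> I"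
    proof (cases "p = 2")
      case True
      \<comment> \<open>Positivity of the base matters: x powr 0 is 1 for x > 0, but
        \<open>0 powr 0 = 0\<close>.\<close>
      then have "k = t\<^sup>2" using M by (simp add: k_def)
      then show ?thesis using compression_mean_2[OF e _ _ t, of A B] A B True by (simp add: I_def)
    next
      case False
      then have "p < 2" using p by simp
      from compression_mean_less_2[OF e A B p(1) this t M] show ?thesis by (simp add: I_def k_def mult_ac)
    qed
    finally show ?thesis .
  qed
  have "2 * pi * (schatten_sum p A + k * schatten_sum 2 B) \<le> I"
  proof (rule ccontr)
    assume "\<not> ?thesis"
    then have lt: "I < 2 * pi * (schatten_sum p A + k * schatten_sum 2 B)" by simp
    \<comment> \<open>Lowering both sums by d costs 2 pi (1 + k) d, which is half of the assumed
      gap.\<close>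
    define d where "d = (2 * pi * (schatten_sum p A + k * schatten_sum 2 B) - I) / (4 * pi * (1 + k))"
    have d: "0 < d" using lt k by (simp add: d_def)
    have "2 * pi * ((schatten_sum p A - d) + k * (schatten_sum 2 B - d)) \<le> I"
      using d by (intro approx) auto
    moreover have "2 * pi * ((schatten_sum p A - d) + k * (schatten_sum 2 B - d))
      = 2 * pi * (schatten_sum p A + k * schatten_sum 2 B) - 2 * pi * ((1 + k) * d)"
      by (simp add: algebra_simps)
    moreover have "2 * pi * ((1 + k) * d) = (2 * pi * (schatten_sum p A + k * schatten_sum 2 B) - I) / 2"
      using k by (simp add: d_def)
    moreover define X where "X = 2 * pi * (schatten_sum p A + k * schatten_sum 2 B)"
    ultimately have "X - (X - I) / 2 \<le> I" "I < X" using lt by simp_all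
    then show False by (simp add: field_simps)
  qed
  then show ?thesis by (simp add: I_def k_def mult_ac)
qed

subsection \<open>Sharpness of the constant\<close>

text \<open>|1 + z|^(2q) = |f z|^2 for the principal power f z = (1 + z)^q = 1 + q z + r z. The part
  |1 + q z|^2 has mean 1 + q^2 t^2, the part 2 Re (r z) has mean zero because r 0 = 0, and the rest
  is at most (2 q \<epsilon> + \<epsilon>^2) t^2.\<close>

lemma powr_circle_mean_le:
  assumes q: "0 < q" and \<epsilon>: "0 < \<epsilon>"
  shows "\<exists>d>0. \<forall>t. 0 < t \<longrightarrow> t < d \<longrightarrow>
    integral {0..2 * pi} (\<lambda>\<theta>. cmod (1 + complex_of_real t * cis \<theta>) powr (2 * q)) \<le> 2 * pi * (1 + (q + \<epsilon>)\<^sup>2 * t\<^sup>2)"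
proof -
  let ?I = "{0..2 * pi}"
  define f where "f z = exp (complex_of_real q * Ln (1 + z))" for z :: complex
  \<comment> \<open>Differentiability at 0 only gives r z = o(z). This suffices for a second-order
    estimate, since the linear occurrence of r averages out and elsewhere r is multiplied by z or by
    itself.\<close>
  define r where "r z = f z - (1 + complex_of_real q * z)" for z
  have nonneg: "1 + z \<notin> \<real>\<^sub>\<le>\<^sub>0" if "cmod z < 1" for z
  proof
    assume "1 + z \<in> \<real>\<^sub>\<le>\<^sub>0"
    then have "Re z \<le> - 1" by (simp add: complex_nonpos_Reals_iff)
    then have "1 \<le> cmod z" using abs_Re_le_cmod[of z] by linarith
    then show False using that by simp
  qed
  have f_hol: "f holomorphic_on ball 0 1"
    unfolding f_def using nonneg by (intro holomorphic_intros) auto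
  have r_hol: "r holomorphic_on ball 0 1"
    unfolding r_def by (intro holomorphic_intros f_hol)
  have f0: "f 0 = 1" by (simp add: f_def)
  have "(f has_field_derivative complex_of_real q) (at 0)"
    unfolding f_def by (auto intro!: derivative_eq_intros)
  then have "((\<lambda>z. (f z - f 0) / (z - 0)) \<longlongrightarrow> complex_of_real q) (at 0)"
    by (simp add: has_field_derivative_iff)
  then have "\<forall>\<^sub>F z in at 0. dist ((f z - f 0) / (z - 0)) (complex_of_real q) < \<epsilon>"
    using \<epsilon> by (rule tendstoD)
  then obtain d where d: "0 < d" "\<And>z. z \<noteq> 0 \<Longrightarrow> dist z 0 < d \<Longrightarrow> dist ((f z - f 0) / (z - 0)) (complex_of_real q) < \<epsilon>"
    unfolding eventually_at by blast
  have r_small: "cmod (r z) \<le> \<epsilon> * cmod z" if z: "z \<noteq> 0" "cmod z < d" for z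
  proof -
    have "cmod ((f z - f 0) / (z - 0) - complex_of_real q) < \<epsilon>" using d(2)[of z] z by (simp add: dist_norm)
    moreover have "(f z - f 0) / (z - 0) - complex_of_real q = r z / z"
      using z by (simp add: r_def f0 field_simps)
    ultimately have "cmod (r z) / cmod z < \<epsilon>" by (simp add: norm_divide)
    then show ?thesis using z by (simp add: field_simps)
  qed
  have main: "integral ?I (\<lambda>\<theta>. cmod (1 + complex_of_real t * cis \<theta>) powr (2 * q)) \<le> 2 * pi * (1 + (q + \<epsilon>)\<^sup>2 * t\<^sup>2)"
    if t: "0 < t" "t < min d 1" for t
  proof -
    let ?z = "\<lambda>\<theta>. complex_of_real t * cis \<theta>"
    have nz: "cmod (?z \<theta>) = t" for \<theta> using t by (simp add: norm_mult)
    have fz: "(cmod (f (?z \<theta>)))\<^sup>2 = cmod (1 + ?z \<theta>) powr (2 * q)" for \<theta>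
    proof -
      have "1 + ?z \<theta> \<noteq> 0" using nonneg[of "?z \<theta>"] nz[of \<theta>] t by auto
      then have "cmod (f (?z \<theta>)) = exp (q * ln (cmod (1 + ?z \<theta>)))" by (simp add: f_def)
      then show ?thesis
        using \<open>1 + ?z \<theta> \<noteq> 0\<close> by (simp add: powr_def exp_double[symmetric] mult.assoc)
    qed
    have r_int: "((\<lambda>\<theta>. Re (2 * r (?z \<theta>))) has_integral 0) ?I"
    proof -
      have "((\<lambda>\<theta>. 2 * r (?z \<theta>)) has_integral (2 * pi) *\<^sub>R (2 * r 0)) ?I"
        by (rule has_integral_circle_holomorphic[of "\<lambda>z. 2 * r z" 1]) (use r_hol t in \<open>auto intro!: holomorphic_intros\<close>)
      from has_integral_linear[OF this bounded_linear_Re] show ?thesis by (simp add: comp_def r_def f0)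
    qed
    have sq_int: "((\<lambda>\<theta>. (cmod (1 + complex_of_real (q * t) * cis \<theta>))\<^sup>2) has_integral 2 * pi * (1 + q\<^sup>2 * t\<^sup>2)) ?I"
    proof -
      have "(\<lambda>\<theta>. (cmod (1 + complex_of_real (q * t) * cis \<theta>))\<^sup>2) integrable_on ?I"
        by (intro integrable_continuous_real continuous_intros continuous_on_cis)
      then show ?thesis
        using integral_circle_norm_square[of 1 "complex_of_real (q * t)"] q t
        by (simp add: has_integral_integral norm_mult power_mult_distrib del: of_real_mult)
    qed
    have const: "((\<lambda>\<theta>::real. (2 * q * \<epsilon> + \<epsilon>\<^sup>2) * t\<^sup>2) has_integral 2 * pi * ((2 * q * \<epsilon> + \<epsilon>\<^sup>2) * t\<^sup>2)) ?I"
      using has_integral_const_real[of "(2 * q * \<epsilon> + \<epsilon>\<^sup>2) * t\<^sup>2" 0 "2 * pi"] by simp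
    have upper: "((\<lambda>\<theta>. (cmod (1 + complex_of_real (q * t) * cis \<theta>))\<^sup>2 + Re (2 * r (?z \<theta>)) + (2 * q * \<epsilon> + \<epsilon>\<^sup>2) * t\<^sup>2)
        has_integral 2 * pi * (1 + q\<^sup>2 * t\<^sup>2) + 0 + 2 * pi * ((2 * q * \<epsilon> + \<epsilon>\<^sup>2) * t\<^sup>2)) ?I"
      by (intro has_integral_add sq_int r_int const)
    have pointwise: "cmod (1 + ?z \<theta>) powr (2 * q)
        \<le> (cmod (1 + complex_of_real (q * t) * cis \<theta>))\<^sup>2 + Re (2 * r (?z \<theta>)) + (2 * q * \<epsilon> + \<epsilon>\<^sup>2) * t\<^sup>2" for \<theta>
    proof -
      let ?u = "complex_of_real (q * t) * cis \<theta>" and ?r = "r (?z \<theta>)"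
      have "?z \<theta> \<noteq> 0" using t by simp
      then have r: "cmod ?r \<le> \<epsilon> * t" using r_small[of "?z \<theta>"] nz[of \<theta>] t by simp
      have "f (?z \<theta>) = 1 + ?u + ?r" by (simp add: r_def mult.assoc)
      then have "(cmod (f (?z \<theta>)))\<^sup>2 = (cmod (1 + ?u))\<^sup>2 + Re (2 * ?r) + 2 * Re (cnj ?u * ?r) + (cmod ?r)\<^sup>2"
        by (simp only: cmod_power2) (simp add: power2_eq_square algebra_simps)
      moreover have "Re (cnj ?u * ?r) \<le> q * t * (\<epsilon> * t)"
      proof -
        have "Re (cnj ?u * ?r) \<le> cmod (cnj ?u * ?r)" by (rule complex_Re_le_cmod)
        also have "\<dots> = q * t * cmod ?r" using q t by (simp add: norm_mult)
        also have "\<dots> \<le> q * t * (\<epsilon> * t)" using r q t by (intro mult_left_mono) auto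
        finally show ?thesis .
      qed
      moreover have "(cmod ?r)\<^sup>2 \<le> (\<epsilon> * t)\<^sup>2" using r by (intro power_mono) auto
      ultimately have "(cmod (f (?z \<theta>)))\<^sup>2 \<le> (cmod (1 + ?u))\<^sup>2 + Re (2 * ?r) + 2 * (q * t * (\<epsilon> * t)) + (\<epsilon> * t)\<^sup>2"
        by linarith
      then show ?thesis unfolding fz by (simp add: power2_eq_square algebra_simps)
    qed
    have "(\<lambda>\<theta>. cmod (1 + ?z \<theta>) powr (2 * q)) integrable_on ?I"
      unfolding fz[symmetric] f_def
    proof (intro integrable_continuous_real continuous_intros continuous_on_cis ballI)
      fix \<theta> show "1 + ?z \<theta> \<notin> \<real>\<^sub>\<le>\<^sub>0" using nonneg[of "?z \<theta>"] nz[of \<theta>] t by simp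
    qed
    from has_integral_le[OF integrable_integral[OF this] upper pointwise]
    have "integral ?I (\<lambda>\<theta>. cmod (1 + ?z \<theta>) powr (2 * q))
      \<le> 2 * pi * (1 + q\<^sup>2 * t\<^sup>2) + 0 + 2 * pi * ((2 * q * \<epsilon> + \<epsilon>\<^sup>2) * t\<^sup>2)" .
    then show ?thesis by (simp add: power2_eq_square algebra_simps)
  qed
  show ?thesis using d(1) main by (intro exI[of _ "min d 1"]) auto
qed

definition rank_one_proj :: "'a::chilbert_space \<Rightarrow> 'a \<Rightarrow> 'a" where
  "rank_one_proj u x = cinner x u *\<^sub>C u"

text \<open>Read as a 1 by 1 matrix over the frame u, whose single singular value is found from its
  Frobenius norm.\<close>

lemma schatten_sum_rank_one:
  fixes u :: "'a::chilbert_space"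
  assumes u: "norm u = 1" and p: "0 < p"
  shows "schatten_sum p (\<lambda>x. c *\<^sub>C rank_one_proj u x) = cmod c powr p"
    and "(\<lambda>x. c *\<^sub>C rank_one_proj u x) \<in> schatten_class p"
proof -
  have e: "frame 1 (\<lambda>_. u)" using u by (simp add: frame_def cinner_self)
  define C where "C = Matrix.mat 1 1 (\<lambda>_. c)"
  have Cc: "C \<in> carrier_mat 1 1" by (simp add: C_def)
  have op: "op_mat 1 (\<lambda>_. u) C = (\<lambda>x. c *\<^sub>C rank_one_proj u x)"
    by (simp add: op_mat_def fun_eq_iff C_def rank_one_proj_def scaleC_scaleC)
  obtain U s V where svd: "is_svd 1 C U s V"
    and S: "\<forall>p>0. schatten_sum p (op_mat 1 (\<lambda>_. u) C) = (\<Sum>i<1. s i powr p)"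
    using svd_exists[OF e Cc] by blast
  have "(cmod c)\<^sup>2 = (s 0)\<^sup>2" using is_svd_frob2[OF svd] by (simp add: frob2_def C_def)
  moreover have "0 \<le> s 0" using svd by (simp add: is_svd_def)
  ultimately have "s 0 = cmod c" by (simp add: power2_eq_iff_nonneg)
  then show "schatten_sum p (\<lambda>x. c *\<^sub>C rank_one_proj u x) = cmod c powr p"
    using S p by (simp add: op[symmetric])
  show "(\<lambda>x. c *\<^sub>C rank_one_proj u x) \<in> schatten_class p"
    unfolding op[symmetric] by (rule schatten_class_op_mat[OF e])
qed

lemma onorm_rank_one_proj:
  fixes u :: "'a::chilbert_space"
  assumes u: "norm u = 1"
  shows "onorm (rank_one_proj u) = 1"
proof (rule antisym)
  show "onorm (rank_one_proj u) \<le> 1"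
  proof (rule onorm_bound)
    fix x show "norm (rank_one_proj u x) \<le> 1 * norm x"
      using norm_cinner_le[of x u] u by (simp add: rank_one_proj_def)
  qed simp
  have "bounded_linear (rank_one_proj u)"
    unfolding rank_one_proj_def[abs_def]
    by (intro bounded_clinear_bounded_linear compact_operator_bounded_clinear compact_operator_rank_one)
  from onorm[OF this, of u] show "1 \<le> onorm (rank_one_proj u)"
    using u by (simp add: rank_one_proj_def cinner_self)
qed

lemma scaleC_one: "1 *\<^sub>C x = (x :: 'a::chilbert_space)"
  using scaleC_of_real[of 1 x] by simp

text \<open>For this pair the integrand is |1 + z|^p and the denominator is (1 + t)^(2-p). Dividing
  by t^2 and letting t tend to 0 with \<epsilon> fixed gives C \<le> (q + \<epsilon>)^2; then
  \<epsilon> tends to 0.\<close>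

lemma schatten_mean_sharp:
  assumes u: "norm (u :: 'a::chilbert_space) = 1" and p: "0 < p"
    and C: "\<And>t. 0 < t \<Longrightarrow> 2 * pi * (schatten_sum p (rank_one_proj u)
        + C * (t\<^sup>2 * schatten_sum 2 (rank_one_proj u) / (onorm (rank_one_proj u) + t * onorm (rank_one_proj u)) powr (2 - p)))
      \<le> integral {0..2 * pi} (\<lambda>\<theta>. schatten_sum p (\<lambda>x. rank_one_proj u x + (complex_of_real t * cis \<theta>) *\<^sub>C rank_one_proj u x))"
  shows "C \<le> p\<^sup>2 / 4"
proof -
  define q where "q = p / 2"
  have q: "0 < q" using p by (simp add: q_def)
  have S1: "schatten_sum r (rank_one_proj u) = 1" if "0 < r" for r
    using schatten_sum_rank_one(1)[OF u that, of 1] by (simp add: scaleC_one)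
  have S2: "schatten_sum p (\<lambda>x. rank_one_proj u x + z *\<^sub>C rank_one_proj u x) = cmod (1 + z) powr (2 * q)" for z
    using schatten_sum_rank_one(1)[OF u p, of "1 + z"] by (simp add: scaleC_one scaleC_add_left q_def)
  have bound: "C \<le> (q + \<epsilon>)\<^sup>2" if \<epsilon>: "0 < \<epsilon>" for \<epsilon>
  proof -
    obtain d where d: "0 < d" "\<And>t. 0 < t \<Longrightarrow> t < d \<Longrightarrow>
        integral {0..2 * pi} (\<lambda>\<theta>. cmod (1 + complex_of_real t * cis \<theta>) powr (2 * q)) \<le> 2 * pi * (1 + (q + \<epsilon>)\<^sup>2 * t\<^sup>2)"
      using powr_circle_mean_le[OF q \<epsilon>] by blast
    have ev: "C \<le> (q + \<epsilon>)\<^sup>2 * (1 + t) powr (2 - p)" if t: "0 < t" "t < d" for t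
    proof -
      have "2 * pi * (1 + C * (t\<^sup>2 * 1 / (1 + t * 1) powr (2 - p))) \<le> 2 * pi * (1 + (q + \<epsilon>)\<^sup>2 * t\<^sup>2)"
        using order.trans[OF C[OF t(1), unfolded S2] d(2)[OF t]] S1[OF p] S1[of 2]
        by (simp only: onorm_rank_one_proj[OF u])
      then have "C * (t\<^sup>2 / (1 + t) powr (2 - p)) \<le> (q + \<epsilon>)\<^sup>2 * t\<^sup>2" by simp
      moreover have "0 < (1 + t) powr (2 - p)" using t by simp
      ultimately have "C * t\<^sup>2 \<le> ((q + \<epsilon>)\<^sup>2 * (1 + t) powr (2 - p)) * t\<^sup>2"
        by (simp add: divide_le_eq mult_ac)
      then show ?thesis using t by simp
    qed
    have "((\<lambda>t. (q + \<epsilon>)\<^sup>2 * (1 + t) powr (2 - p)) \<longlongrightarrow> (q + \<epsilon>)\<^sup>2 * (1 + 0) powr (2 - p)) (at_right 0)"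
      by (intro tendsto_intros) auto
    moreover have "\<forall>\<^sub>F t in at_right 0. C \<le> (q + \<epsilon>)\<^sup>2 * (1 + t) powr (2 - p)"
      unfolding eventually_at_right_field using d(1) ev by blast
    ultimately have "C \<le> (q + \<epsilon>)\<^sup>2 * (1 + 0) powr (2 - p)"
      by (rule tendsto_lowerbound) simp
    then show ?thesis by simp
  qed
  have "((\<lambda>\<epsilon>. (q + \<epsilon>)\<^sup>2) \<longlongrightarrow> (q + 0)\<^sup>2) (at_right 0)" by (intro tendsto_intros)
  moreover have "\<forall>\<^sub>F \<epsilon> in at_right 0. C \<le> (q + \<epsilon>)\<^sup>2"
    using eventually_at_right_less[of 0] by (rule eventually_mono) (rule bound)
  ultimately have "C \<le> (q + 0)\<^sup>2" by (rule tendsto_lowerbound) simp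
  then show ?thesis by (simp add: q_def power2_eq_square)
qed

lemma schatten_norm_square: "(schatten_norm 2 T)\<^sup>2 = schatten_sum 2 T"
proof -
  have "0 \<le> schatten_norm 2 T" by (simp add: schatten_norm_def)
  then show ?thesis using schatten_norm_powr[of 2 T] by simp
qed

text \<open>Sharpness is shown within each single nonzero space, which implies the version with C
  admissible for all spaces. On the zero space there is no B \<noteq> 0, so every C is admissible
  there and the restriction is unavoidable.\<close>

theorem theorem3p1:
  fixes p :: real
  assumes "0 < p" and "p \<le> 2"
  shows
    "(\<forall>(A :: 'a::chilbert_space \<Rightarrow> 'a) \<in> schatten_class p. \<forall>B \<in> schatten_class p. \<forall>t > 0.
        B \<noteq> (\<lambda>x. 0) \<longrightarrow>
        1 / (2 * pi) * integral {0..2 * pi}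
            (\<lambda>\<theta>. schatten_norm p (\<lambda>x. A x + (of_real t * exp (\<i> * of_real \<theta>)) *\<^sub>C B x) powr p)
          - schatten_norm p A powr p
        \<ge> p\<^sup>2 / 4 * (t\<^sup>2 * (schatten_norm 2 B)\<^sup>2 / (onorm A + t * onorm B) powr (2 - p)))
     \<and>
     ((\<exists>x :: 'a. x \<noteq> 0) \<longrightarrow>
      (\<forall>C :: real.
        (\<forall>(A :: 'a \<Rightarrow> 'a) \<in> schatten_class p. \<forall>B \<in> schatten_class p. \<forall>t > 0.
            B \<noteq> (\<lambda>x. 0) \<longrightarrow>
            1 / (2 * pi) * integral {0..2 * pi}
                (\<lambda>\<theta>. schatten_norm p (\<lambda>x. A x + (of_real t * exp (\<i> * of_real \<theta>)) *\<^sub>C B x) powr p)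
              - schatten_norm p A powr p
            \<ge> C * (t\<^sup>2 * (schatten_norm 2 B)\<^sup>2 / (onorm A + t * onorm B) powr (2 - p)))
        \<longrightarrow> C \<le> p\<^sup>2 / 4))"
proof (intro conjI ballI allI impI)
  fix A B :: "'a \<Rightarrow> 'a" and t :: real
  assume A: "A \<in> schatten_class p" and B: "B \<in> schatten_class p" and t: "0 < t" and B0: "B \<noteq> (\<lambda>x. 0)"
  let ?I = "integral {0..2 * pi} (\<lambda>\<theta>. schatten_sum p (\<lambda>x. A x + (complex_of_real t * cis \<theta>) *\<^sub>C B x))"
  let ?M = "onorm A + t * onorm B"
  have "2 * pi * (schatten_sum p A + p\<^sup>2 / 4 * t\<^sup>2 * schatten_sum 2 B * ?M powr (p - 2)) \<le> ?I"
    by (rule schatten_mean_lower_bound[OF assms A B t B0])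
  then have "schatten_sum p A + p\<^sup>2 / 4 * t\<^sup>2 * schatten_sum 2 B * ?M powr (p - 2) \<le> 1 / (2 * pi) * ?I"
    by (simp add: le_divide_eq mult.commute)
  moreover have "p\<^sup>2 / 4 * t\<^sup>2 * schatten_sum 2 B * ?M powr (p - 2)
      = p\<^sup>2 / 4 * (t\<^sup>2 * (schatten_norm 2 B)\<^sup>2 / ?M powr (2 - p))"
    unfolding schatten_norm_square using powr_minus_divide[of ?M "2 - p"] by simp
  ultimately show "1 / (2 * pi) * integral {0..2 * pi}
        (\<lambda>\<theta>. schatten_norm p (\<lambda>x. A x + (of_real t * exp (\<i> * of_real \<theta>)) *\<^sub>C B x) powr p)
      - schatten_norm p A powr p
    \<ge> p\<^sup>2 / 4 * (t\<^sup>2 * (schatten_norm 2 B)\<^sup>2 / ?M powr (2 - p))"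
    by (simp only: schatten_norm_powr[OF assms(1)] cis_conv_exp)
next
  fix C :: real
  assume "\<exists>x :: 'a. x \<noteq> 0"
  then obtain x :: 'a where "x \<noteq> 0" by blast
  define u where "u = (1 / norm x) *\<^sub>R x"
  have u: "norm u = 1" using \<open>x \<noteq> 0\<close> by (simp add: u_def)
  let ?P = "rank_one_proj u"
  assume H: "\<forall>(A :: 'a \<Rightarrow> 'a) \<in> schatten_class p. \<forall>B \<in> schatten_class p. \<forall>t > 0.
            B \<noteq> (\<lambda>x. 0) \<longrightarrow>
            1 / (2 * pi) * integral {0..2 * pi}
                (\<lambda>\<theta>. schatten_norm p (\<lambda>x. A x + (of_real t * exp (\<i> * of_real \<theta>)) *\<^sub>C B x) powr p)
              - schatten_norm p A powr p
            \<ge> C * (t\<^sup>2 * (schatten_norm 2 B)\<^sup>2 / (onorm A + t * onorm B) powr (2 - p))"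
  have P: "?P \<in> schatten_class p"
    using schatten_sum_rank_one(2)[OF u assms(1), of 1] by (simp add: scaleC_one)
  have "?P u \<noteq> 0" using u by (auto simp: rank_one_proj_def cinner_self scaleC_one)
  then have P0: "?P \<noteq> (\<lambda>x. 0)" by auto
  show "C \<le> p\<^sup>2 / 4"
  proof (rule schatten_mean_sharp[OF u assms(1)])
    fix t :: real assume t: "0 < t"
    let ?I = "integral {0..2 * pi} (\<lambda>\<theta>. schatten_sum p (\<lambda>x. ?P x + (complex_of_real t * cis \<theta>) *\<^sub>C ?P x))"
    from H[rule_format, OF P P t P0]
    have "C * (t\<^sup>2 * schatten_sum 2 ?P / (onorm ?P + t * onorm ?P) powr (2 - p)) \<le> 1 / (2 * pi) * ?I - schatten_sum p ?P"
      by (simp only: schatten_norm_powr[OF assms(1)] schatten_norm_square cis_conv_exp)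
    then have "schatten_sum p ?P + C * (t\<^sup>2 * schatten_sum 2 ?P / (onorm ?P + t * onorm ?P) powr (2 - p))
        \<le> ?I / (2 * pi)" by simp
    then show "2 * pi * (schatten_sum p ?P + C * (t\<^sup>2 * schatten_sum 2 ?P / (onorm ?P + t * onorm ?P) powr (2 - p))) \<le> ?I"
      by (simp only: le_divide_eq) (simp add: mult.commute)
  qed
qed

end
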